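(* Let $d\ge2$ and let $G_{1234}(x_1,x_2,x_3,x_4)=\langle\mathcal{O}_1(x_1)\mathcal{O}_2(x_2)\mathcal{O}_3(x_3)\mathcal{O}_4(x_4)\rangle$ be a Euclidean four-point function of (possibly non-identical) scalar primary operators $\mathcal{O}_i$ with scaling dimensions $\Delta_i$ in a unitary CFT. Then $G_{1234}$ extends from $\mathcal{D}_E$ to a function on $\mathcal{D}$ that is analytic in the temporal variables $\tau_k$ and continuous in the spatial variables $\mathbf{x}_k$, and its OPE convergence properties are the same as for identical scalar operators; that is, for $C_L\in\mathcal{D}_L$ the Lorentzian four-point function is analytic at $C_L$, and given by the corresponding convergent channel expansion, whenever one of the following holds at $C_L$: (s) $z,\bar z\notin(1,+\infty)$ (s-channel); (t) $z,\bar z\notin(-\infty,0)$ and $N_t(C_L)=0$ (t-channel); (u) $z,\bar z\notin(0,1)$ and $N_u(C_L)=0$ (u-channel).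
   Context: Kinematics. Points are $x_k=(\tau_k,\mathbf{x}_k)$, $\tau_k\in\mathbb{C}$, $\mathbf{x}_k\in\mathbb{R}^{d-1}$; $x_{ij}^2=(\tau_i-\tau_j)^2+(\mathbf{x}_i-\mathbf{x}_j)^2$. $\mathcal{D}$ is the set of four-point configurations with $\mathrm{Re}\,\tau_1>\mathrm{Re}\,\tau_2>\mathrm{Re}\,\tau_3>\mathrm{Re}\,\tau_4$; $\mathcal{D}_E\subset\mathcal{D}$ is the subset with all $\tau_k$ real; $\mathcal{D}_L$ is the set of Lorentzian configurations $x_k=(it_k,\mathbf{x}_k)$ ($t_k$ real) with $x_{ij}^2\ne0$ for all $i\neq j$. $u=\frac{x_{12}^2x_{34}^2}{x_{13}^2x_{24}^2}$, $v=\frac{x_{14}^2x_{23}^2}{x_{13}^2x_{24}^2}$; $z,\bar z$ are the two solutions (unordered) of $u=z\bar z$, $v=(1-z)(1-\bar z)$. $\Gamma=\{C\in\mathcal{D}: z=\bar z\}$. $\rho(z)=\frac{(1-\sqrt{1-z})^2}{z}$ maps $\mathbb{C}\setminus[1,\infty)$ bijectively to the open unit disc; $\rho=\rho(z)$, $\bar\rho=\rho(\bar z)$. Known fact (to be used as given): $z,\bar z\notin\{0\}\cup[1,\infty)$ on $\mathcal{D}$. Paths and crossing numbers. For $C\in\mathcal{D}_L$ take a continuous path $\gamma:[0,1]\to\overline{\mathcal{D}}$ with $\gamma(0)\in\mathcal{D}_E\setminus\Gamma$, $\gamma(s)\in\mathcal{D}\setminus\Gamma$ for $s<1$, $\gamma(1)=C$.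 At $\gamma(0)$, $\bar z=z^*$ is non-real; label so that $\mathrm{Im}\,z>0$ and continue $z,\bar z$ continuously. If at $C$ $z,\bar z\notin(-\infty,0)$: $n_t$ is the number of times $z$ crosses $(-\infty,0)$ from above minus the number of times from below along $\gamma$, $\bar n_t$ the same for $\bar z$, and $N_t(C)=n_t+\bar n_t$. If at $C$ $z,\bar z\notin(0,1)$: $N_u(C)=n_u+\bar n_u$ is defined in the same way with $(-\infty,0)$ replaced by $(0,1)$. $N_t(C)$ and $N_u(C)$ do not depend on $\gamma$. Standing properties of the Euclidean correlators. The correlators $G_{ijkl}(x_i,x_j,x_k,x_l)=\langle\mathcal{O}_i(x_i)\mathcal{O}_j(x_j)\mathcal{O}_k(x_k)\mathcal{O}_l(x_l)\rangle$ do not depend on the order in which the operators are written, and $$G_{1234}=\frac{1}{(x_{12}^2)^{\frac{\Delta_1+\Delta_2}{2}}(x_{34}^2)^{\frac{\Delta_3+\Delta_4}{2}}}\Big(\frac{x_{24}^2}{x_{14}^2}\Big)^{\frac{\Delta_1-\Delta_2}{2}}\Big(\frac{x_{14}^2}{x_{13}^2}\Big)^{\frac{\Delta_3-\Delta_4}{2}}g_{1234}(\rho,\bar\rho),$$ similarly for other orderings (cross-ratios computed in the corresponding order; e.g. exchanging points 1 and 3 gives the t-channel with $z_t=1-z,\bar z_t=1-\bar z$, exchanging 2 and 3 gives the u-channel with $z_u=1/z,\bar z_u=1/\bar z$). In the Euclidean region $\bar\rho=\rho^*$, $|\rho|<1$, there are expansions $$g_{ijkl}(\rho,\bar\rho)=\sum_{\mathcal{O}}C_{ij\mathcal{O}}C_{kl\mathcal{O}}\sum_{\psi\in[\mathcal{O}]}a_{ij\psi}b_{kl\psi}\,\rho^{h(\psi)}\bar\rho^{\bar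 h(\psi)}$$ over primaries $\mathcal{O}$ and orthonormal bases $\psi$ of their conformal multiplets $[\mathcal{O}]$, with real coefficients, $h,\bar h\ge0$, $h-\bar h\in\mathbb{Z}$. For $0\le r<1$ one has $\sum_{\mathcal{O},\psi}C_{ij\mathcal{O}}^2a_{ij\psi}^2r^{h+\bar h}\le g_{ijji}(r,r)<\infty$ and $\sum_{\mathcal{O},\psi}C_{kl\mathcal{O}}^2b_{kl\psi}^2r^{h+\bar h}\le g_{lkkl}(r,r)<\infty$. Moreover the series can be rearranged as $\sum_{\delta\ge0}\sum_{l\in\mathbb{N}}c_{\delta,l}(\rho\bar\rho)^{\delta/2}C_l^{d/2-1}(\cos\theta)$ with real $c_{\delta,l}$, where $\rho=re^{i\theta},\bar\rho=re^{-i\theta}$ and $C_l^{d/2-1}$ are Gegenbauer polynomials. "Analytic at $C_L$" means: the continuation on $\mathcal{D}$ extends to a neighbourhood of $C_L$ (complex $\tau_k$, real $\mathbf{x}_k$) as a function analytic in the $\tau_k$ and continuous in the $\mathbf{x}_k$; its value at $C_L$ is the limit from $\mathcal{D}$ along $\epsilon_k+it_k$, $\epsilon_k\to0$, $\epsilon_1>\epsilon_2>\epsilon_3>\epsilon_4$. *)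

theory Defs
  imports "HOL-Analysis.Analysis"
begin

text \<open>
  A configuration is a pair of the temporal coordinates \<open>\<tau>\<close> and the spatial coordinates, indexed by
  the four-element type \<open>4\<close> (whose numeral \<open>4\<close> coincides with \<open>0\<close>).  The spatial
  coordinates lie in \<open>\<real>\<close> to the power \<open>d - 1\<close>, rendered as \<open>real ^ 'n\<close>, so that
  \<open>d = CARD('n) + 1 \<ge> 2\<close>.
\<close>

type_synonym 'n config = "(complex ^ 4) \<times> ((real ^ 'n) ^ 4)"

definition x2 :: "'n::finite config \<Rightarrow> 4 \<Rightarrow> 4 \<Rightarrow> complex" where
  "x2 C i j = (fst C $ i - fst C $ j)\<^sup>2 + of_real ((norm (snd C $ i - snd C $ j))\<^sup>2)"

definition DD :: "'n::finite config set" where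
  "DD = {C. Re (fst C $ 1) > Re (fst C $ 2) \<and> Re (fst C $ 2) > Re (fst C $ 3)
          \<and> Re (fst C $ 3) > Re (fst C $ 4)}"

definition DE :: "'n::finite config set" where
  "DE = {C \<in> DD. \<forall>k. Im (fst C $ k) = 0}"

definition DL :: "'n::finite config set" where
  "DL = {C. (\<forall>k. Re (fst C $ k) = 0) \<and> (\<forall>i j. i \<noteq> j \<longrightarrow> x2 C i j \<noteq> 0)}"

definition cross_u :: "'n::finite config \<Rightarrow> complex" where
  "cross_u C = (x2 C 1 2 * x2 C 3 4) / (x2 C 1 3 * x2 C 2 4)"

definition cross_v :: "'n::finite config \<Rightarrow> complex" where
  "cross_v C = (x2 C 1 4 * x2 C 2 3) / (x2 C 1 3 * x2 C 2 4)"

definition cross_roots :: "'n::finite config \<Rightarrow> complex \<Rightarrow> complex \<Rightarrow> bool" where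
  "cross_roots C z zb \<longleftrightarrow> z * zb = cross_u C \<and> (1 - z) * (1 - zb) = cross_v C"

definition Gam :: "'n::finite config set" where
  "Gam = {C \<in> DD. \<exists>z. cross_roots C z z}"

definition roots_avoid :: "'n::finite config \<Rightarrow> real set \<Rightarrow> bool" where
  "roots_avoid C I \<longleftrightarrow>
     (\<forall>z zb. cross_roots C z zb \<longrightarrow> z \<notin> complex_of_real ` I \<and> zb \<notin> complex_of_real ` I)"

definition rho :: "complex \<Rightarrow> complex" where
  "rho z = (1 - csqrt (1 - z))\<^sup>2 / z"

text \<open>
  The configuration whose \<open>k\<close>-th point is the \<open>\<sigma> k\<close>-th point of \<open>C\<close>.  The s-, t- and u-channels are
  the orderings 1234, 3214 and 1324, that is, \<open>\<sigma>\<close> is the identity, the exchange of 1 and 3, and the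
  exchange of 2 and 3.
\<close>

definition permute_points :: "(4 \<Rightarrow> 4) \<Rightarrow> 'n::finite config \<Rightarrow> 'n config" where
  "permute_points \<sigma> C = (\<chi> k. fst C $ \<sigma> k, \<chi> k. snd C $ \<sigma> k)"

definition s_channel :: "4 \<Rightarrow> 4" where "s_channel = id"
definition t_channel :: "4 \<Rightarrow> 4" where "t_channel = id(1 := 3, 3 := 1)"
definition u_channel :: "4 \<Rightarrow> 4" where "u_channel = id(2 := 3, 3 := 2)"

definition crosses_from_above :: "(real \<Rightarrow> complex) \<Rightarrow> real set \<Rightarrow> real \<Rightarrow> bool" where
  "crosses_from_above f I s \<longleftrightarrow> f s \<in> complex_of_real ` I
     \<and> (\<forall>\<^sub>F t in at_left s. Im (f t) > 0) \<and> (\<forall>\<^sub>F t in at_right s. Im (f t) < 0)"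

definition crosses_from_below :: "(real \<Rightarrow> complex) \<Rightarrow> real set \<Rightarrow> real \<Rightarrow> bool" where
  "crosses_from_below f I s \<longleftrightarrow> f s \<in> complex_of_real ` I
     \<and> (\<forall>\<^sub>F t in at_left s. Im (f t) < 0) \<and> (\<forall>\<^sub>F t in at_right s. Im (f t) > 0)"

definition signed_crossings :: "(real \<Rightarrow> complex) \<Rightarrow> real set \<Rightarrow> int" where
  "signed_crossings f I = int (card {s \<in> {0<..<1}. crosses_from_above f I s})
                        - int (card {s \<in> {0<..<1}. crosses_from_below f I s})"

text \<open>
  \<open>has_crossing_number I C N\<close>: some path as in the definition of \<open>N\<^sub>t\<close>
  (for \<open>I = {..<0}\<close>) or \<open>N\<^sub>u\<close> (for \<open>I = {0<..<1}\<close>) has total crossing number \<open>N\<close>.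
  Crossings are literally counted, hence the path has to meet \<open>I\<close> at finitely many times only
  (\<open>card\<close> would be 0 on an infinite set).  As the number does not depend on the path, the
  existential quantifier determines it.
\<close>

definition has_crossing_number :: "real set \<Rightarrow> 'n::finite config \<Rightarrow> int \<Rightarrow> bool" where
  "has_crossing_number I C N \<longleftrightarrow>
     (\<exists>(\<gamma> :: real \<Rightarrow> 'n config) z zb.
        continuous_on {0..1} \<gamma> \<and> \<gamma> 0 \<in> DE - Gam \<and> (\<forall>s\<in>{0..<1}. \<gamma> s \<in> DD - Gam) \<and> \<gamma> 1 = C \<and>
        continuous_on {0..1} z \<and> continuous_on {0..1} zb \<and>
        (\<forall>s\<in>{0..1}. cross_roots (\<gamma> s) (z s) (zb s)) \<and> Im (z 0) > 0 \<and>
        finite {s \<in> {0..1}. z s \<in> complex_of_real ` I \<or> zb s \<in> complex_of_real ` I} \<and>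
        N = signed_crossings z I + signed_crossings zb I)"

fun gegenbauer :: "real \<Rightarrow> nat \<Rightarrow> real \<Rightarrow> real" where
  "gegenbauer lam 0 x = 1"
| "gegenbauer lam (Suc 0) x = 2 * lam * x"
| "gegenbauer lam (Suc (Suc n)) x =
     (2 * x * (real n + 1 + lam) * gegenbauer lam (Suc n) x
       - (real n + 2 * lam) * gegenbauer lam n x) / (real n + 2)"

text \<open>
  In \<open>d = 2\<close> the recurrence degenerates; as usual, the Gegenbauer polynomial with parameter 0 is then
  replaced by its renormalised limit, the Chebyshev polynomial (\<open>cos (l \<theta>)\<close> at \<open>x = cos \<theta>\<close>).
\<close>

definition gegenbauer_dim :: "nat \<Rightarrow> nat \<Rightarrow> real \<Rightarrow> real" where
  "gegenbauer_dim d l x =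
     (if d = 2 then cos (real l * arccos x) else gegenbauer (real d / 2 - 1) l x)"

text \<open>\<open>r\<close> to the power \<open>a\<close> for \<open>r, a \<ge> 0\<close>, with value 1 at \<open>r = a = 0\<close> (where \<open>powr\<close> gives 0).\<close>

definition rpow :: "real \<Rightarrow> real \<Rightarrow> real" where
  "rpow r a = (if a = 0 then 1 else r powr a)"

text \<open>
  The kinematic prefactor of the four-point function, as a function of the logarithms \<open>l i j\<close> of the
  squared distances, so that the branch of the powers can be specified.
\<close>

definition prefactor ::
    "real \<Rightarrow> real \<Rightarrow> real \<Rightarrow> real \<Rightarrow> (4 \<Rightarrow> 4 \<Rightarrow> complex) \<Rightarrow> complex" where
  "prefactor \<Delta>1 \<Delta>2 \<Delta>3 \<Delta>4 l =
     1 / (exp (of_real ((\<Delta>1 + \<Delta>2) / 2) * l 1 2) * exp (of_real ((\<Delta>3 + \<Delta>4) / 2) * l 3 4))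
     * exp (of_real ((\<Delta>1 - \<Delta>2) / 2) * (l 2 4 - l 1 4))
     * exp (of_real ((\<Delta>3 - \<Delta>4) / 2) * (l 1 4 - l 1 3))"

text \<open>
  \<open>'op\<close> labels the scalar primaries considered, \<open>'p\<close> the exchanged primaries and \<open>'s\<close> the states.
  \<open>basis P\<close> is the orthonormal basis of the conformal multiplet of \<open>P\<close>.  \<open>corr\<close> is only meaningful on
  Euclidean configurations and \<open>gfun i j k l\<close> only on pairs \<open>(\<rho>, cnj \<rho>)\<close> with \<open>norm \<rho> < 1\<close>.
\<close>

record ('op, 'p, 's, 'n) cft =
  sdim :: "'op \<Rightarrow> real"
  corr :: "'op \<Rightarrow> 'op \<Rightarrow> 'op \<Rightarrow> 'op \<Rightarrow> 'n config \<Rightarrow> complex"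
  gfun :: "'op \<Rightarrow> 'op \<Rightarrow> 'op \<Rightarrow> 'op \<Rightarrow> complex \<Rightarrow> complex \<Rightarrow> complex"
  primaries :: "'p set"
  basis :: "'p \<Rightarrow> 's set"
  ope :: "'op \<Rightarrow> 'op \<Rightarrow> 'p \<Rightarrow> real"
  acoef :: "'op \<Rightarrow> 'op \<Rightarrow> 's \<Rightarrow> real"
  bcoef :: "'op \<Rightarrow> 'op \<Rightarrow> 's \<Rightarrow> real"
  hwt :: "'s \<Rightarrow> real"
  hbwt :: "'s \<Rightarrow> real"

definition states :: "('op, 'p, 's, 'n::finite) cft \<Rightarrow> ('p \<times> 's) set" where
  "states T = (SIGMA P:primaries T. basis T P)"

definition coef ::
    "('op, 'p, 's, 'n::finite) cft \<Rightarrow> 'op \<Rightarrow> 'op \<Rightarrow> 'op \<Rightarrow> 'op \<Rightarrow> 'p \<Rightarrow> 's \<Rightarrow> real" where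
  "coef T i j k l P \<psi> = ope T i j P * ope T k l P * (acoef T i j \<psi> * bcoef T k l \<psi>)"

text \<open>Euclidean configurations of four distinct points, not necessarily ordered in time.\<close>

definition euclidean_configs :: "'n::finite config set" where
  "euclidean_configs = {C. (\<forall>k. Im (fst C $ k) = 0) \<and> (\<forall>i j. i \<noteq> j \<longrightarrow> x2 C i j \<noteq> 0)}"

text \<open>
  In polar coordinates \<open>\<rho> = r exp(i \<theta>)\<close>, \<open>\<rho>\<^sup>*= r exp(-i \<theta>)\<close> the monomial with exponents \<open>h, hb\<close> is
  \<open>r\<close> to the power \<open>h + hb\<close> times \<open>exp(i (h - hb) \<theta>)\<close>, which is single-valued as \<open>h - hb\<close> is an integer.
  (Separate principal powers of \<open>\<rho>\<close> and \<open>\<rho>\<^sup>*\<close> would be wrong for negative \<open>\<rho>\<close>.)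
\<close>

locale unitary_cft =
  fixes T :: "('op, 'p, 's, 'n::finite) cft"
  assumes order_independence:
    "\<And>\<O> \<sigma> C. C \<in> euclidean_configs \<Longrightarrow> bij \<sigma> \<Longrightarrow>
       corr T (\<O> (\<sigma> 1)) (\<O> (\<sigma> 2)) (\<O> (\<sigma> 3)) (\<O> (\<sigma> 4)) (permute_points \<sigma> C)
         = corr T (\<O> 1) (\<O> 2) (\<O> 3) (\<O> 4) C"
  and conformal_covariance:
    "\<And>i j k l C z. C \<in> euclidean_configs \<Longrightarrow> cross_roots C z (cnj z) \<Longrightarrow>
       z \<notin> complex_of_real ` {1..} \<Longrightarrow>
       corr T i j k l C
         = prefactor (sdim T i) (sdim T j) (sdim T k) (sdim T l) (\<lambda>m n. Ln (x2 C m n))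
           * gfun T i j k l (rho z) (rho (cnj z))"
  and weights_nonneg:
    "\<And>P \<psi>. (P, \<psi>) \<in> states T \<Longrightarrow> hwt T \<psi> \<ge> 0 \<and> hbwt T \<psi> \<ge> 0"
  and integer_spin:
    "\<And>P \<psi>. (P, \<psi>) \<in> states T \<Longrightarrow> hwt T \<psi> - hbwt T \<psi> \<in> \<int>"
  and rho_expansion:
    "\<And>i j k l r \<theta>. 0 \<le> r \<Longrightarrow> r < 1 \<Longrightarrow>
       ((\<lambda>(P, \<psi>). of_real (coef T i j k l P \<psi> * rpow r (hwt T \<psi> + hbwt T \<psi>))
                   * cis ((hwt T \<psi> - hbwt T \<psi>) * \<theta>))
         has_sum gfun T i j k l (rcis r \<theta>) (rcis r (- \<theta>))) (states T)"
  and a_bound: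
    "\<And>i j r. 0 \<le> r \<Longrightarrow> r < 1 \<Longrightarrow>
       (\<lambda>(P, \<psi>). (ope T i j P)\<^sup>2 * (acoef T i j \<psi>)\<^sup>2 * rpow r (hwt T \<psi> + hbwt T \<psi>))
         summable_on states T \<and>
       (\<Sum>\<^sub>\<infinity>(P, \<psi>)\<in>states T.
          (ope T i j P)\<^sup>2 * (acoef T i j \<psi>)\<^sup>2 * rpow r (hwt T \<psi> + hbwt T \<psi>))
         \<le> Re (gfun T i j j i (of_real r) (of_real r))"
  and b_bound:
    "\<And>k l r. 0 \<le> r \<Longrightarrow> r < 1 \<Longrightarrow>
       (\<lambda>(P, \<psi>). (ope T k l P)\<^sup>2 * (bcoef T k l \<psi>)\<^sup>2 * rpow r (hwt T \<psi> + hbwt T \<psi>))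
         summable_on states T \<and>
       (\<Sum>\<^sub>\<infinity>(P, \<psi>)\<in>states T.
          (ope T k l P)\<^sup>2 * (bcoef T k l \<psi>)\<^sup>2 * rpow r (hwt T \<psi> + hbwt T \<psi>))
         \<le> Re (gfun T l k k l (of_real r) (of_real r))"
  and gegenbauer_expansion:
    "\<And>i j k l. \<exists>c :: real \<Rightarrow> nat \<Rightarrow> real. \<forall>r \<theta>. 0 \<le> r \<and> r < 1 \<longrightarrow>
       ((\<lambda>(\<delta>, m). of_real (c \<delta> m * rpow r \<delta> * gegenbauer_dim (CARD('n) + 1) m (cos \<theta>)))
         has_sum gfun T i j k l (rcis r \<theta>) (rcis r (- \<theta>))) ({0..} \<times> UNIV)"

text \<open>
  Analytic in the temporal variables and continuous in the spatial ones (for open \<open>S\<close>): jointly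
  continuous on \<open>S\<close>, and at each point of \<open>S\<close> complex differentiable as a function of
  \<open>\<tau> \<in> complex ^ 4\<close>, i.e. with complex linear Frechet derivative.
\<close>

definition time_analytic_on :: "('n::finite config \<Rightarrow> complex) \<Rightarrow> 'n config set \<Rightarrow> bool" where
  "time_analytic_on F S \<longleftrightarrow> continuous_on S F \<and>
     (\<forall>\<tau> x. (\<tau>, x) \<in> S \<longrightarrow>
        (\<exists>F'. ((\<lambda>\<tau>'. F (\<tau>', x)) has_derivative F') (at \<tau>) \<and> (\<forall>c v. F' (c *s v) = c * F' v)))"

definition analytic_at_with_value ::
    "('n::finite config \<Rightarrow> complex) \<Rightarrow> 'n config \<Rightarrow> complex \<Rightarrow> bool" where
  "analytic_at_with_value F C w \<longleftrightarrow>
     (\<exists>U H. open U \<and> C \<in> U \<and> time_analytic_on H U \<and> (\<forall>C'\<in>U \<inter> DD. H C' = F C') \<and> H C = w) \<and>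
     ((\<lambda>\<epsilon> :: real ^ 4. F (\<chi> k. of_real (\<epsilon> $ k) + fst C $ k, snd C)) \<longlongrightarrow> w)
       (at 0 within {\<epsilon>. \<epsilon> $ 1 > \<epsilon> $ 2 \<and> \<epsilon> $ 2 > \<epsilon> $ 3 \<and> \<epsilon> $ 3 > \<epsilon> $ 4})"

text \<open>
  On \<open>DD\<close> no squared distance is in \<open>(-\<infinity>, 0]\<close>, so the principal logarithm is there the continuation
  of the real logarithm from \<open>DE\<close>.  At a boundary configuration take its limit from \<open>DD\<close>.
\<close>

definition log_x2 :: "'n::finite config \<Rightarrow> 4 \<Rightarrow> 4 \<Rightarrow> complex" where
  "log_x2 C i j = Lim (at C within DD) (\<lambda>C'. Ln (x2 C' i j))"

text \<open>
  The logarithm of \<open>\<rho> \<rho>b\<close> for \<open>\<rho> = rho z\<close>, \<open>\<rho>b = rho zb\<close>, \<open>z, zb \<notin> [1, \<infinity>)\<close>, given the logarithms \<open>l\<close> of the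
  squared distances: \<open>rho z = z / (1 + csqrt (1 - z))\<^sup>2\<close> and \<open>z * zb = u\<close>, so that
  \<open>\<rho> \<rho>b = u / ((1 + csqrt (1 - z))\<^sup>2 (1 + csqrt (1 - zb))\<^sup>2)\<close>.  The numbers \<open>1 + csqrt _\<close> have positive
  real part, hence the branch is real in the Euclidean region and all the phase picked up by the
  continuation to a Lorentzian configuration is that of \<open>u\<close>.
\<close>

definition log_rho_rhob :: "(4 \<Rightarrow> 4 \<Rightarrow> complex) \<Rightarrow> complex \<Rightarrow> complex \<Rightarrow> complex" where
  "log_rho_rhob l z zb = (l 1 2 + l 3 4 - l 1 3 - l 2 4)
     - 2 * Ln (1 + csqrt (1 - z)) - 2 * Ln (1 + csqrt (1 - zb))"

text \<open>
  The monomial \<open>\<rho>\<close> to the \<open>h\<close> times \<open>\<rho>b\<close> to the \<open>hb\<close> for the branch \<open>L\<close> of the logarithm of \<open>\<rho> \<rho>b\<close>.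
  Since \<open>h - hb\<close> is an integer, only the sum \<open>L\<close> of the two logarithms matters: any other
  logarithm of \<open>\<rho>\<close> in place of \<open>Ln \<rho>\<close> gives the same value.
\<close>

definition rho_monomial :: "complex \<Rightarrow> complex \<Rightarrow> real \<Rightarrow> real \<Rightarrow> complex" where
  "rho_monomial L \<rho> h hb = exp (of_real h * Ln \<rho> + of_real hb * (L - Ln \<rho>))"

text \<open>
  \<open>w\<close> is the value at \<open>C\<close> of the (convergent) expansion in the channel \<open>\<sigma>\<close>, with the cross-ratios
  computed in the order \<open>\<sigma>\<close>.
\<close>

definition given_by_channel ::
    "('op, 'p, 's, 'n::finite) cft \<Rightarrow> (4 \<Rightarrow> 'op) \<Rightarrow> (4 \<Rightarrow> 4) \<Rightarrow> 'n config \<Rightarrow> complex \<Rightarrow> bool" where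
  "given_by_channel T \<O> \<sigma> C w \<longleftrightarrow>
     (let i = \<O> (\<sigma> 1); j = \<O> (\<sigma> 2); k = \<O> (\<sigma> 3); l = \<O> (\<sigma> 4);
          lg = (\<lambda>m n. log_x2 C (\<sigma> m) (\<sigma> n))
      in \<forall>z zb. cross_roots (permute_points \<sigma> C) z zb \<longrightarrow>
           (\<exists>S. ((\<lambda>(P, \<psi>). of_real (coef T i j k l P \<psi>)
                     * rho_monomial (log_rho_rhob lg z zb) (rho z) (hwt T \<psi>) (hbwt T \<psi>))
                  has_sum S) (states T) \<and>
                w = prefactor (sdim T i) (sdim T j) (sdim T k) (sdim T l) lg * S))"

end

(*
  Write rho, rhob as exponentials of mu, nu.  The channel sum psi(mu, nu) = Sum c exp(h mu + hb nu)
  converges for Re mu, Re nu < 0 by Cauchy-Schwarz.  It is symmetric, because it is on the Euclidean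
  slice nu = cnj mu, and antidiagonals are sets of uniqueness.  Hence it is a sum of
  exp((h + hb) (mu + nu) / 2) times a Chebyshev polynomial in cosh((mu - nu) / 2), and both
  mu + nu and this cosh are analytic functions of the times even where z = zb.  As z, zb never meet
  [1, oo) on DD (convexity of inverses of matrices with positive real part), the s-channel sum
  converges on DD, and near every Lorentzian point of case (s).

  For the t- and u-channels no continuation of the t- or u-channel sum along the path is needed.
  On D x D, where D is the plane without the cuts of both channels, the s-channel sum with
  log u = log z + log zb (principal branches, resp. those of the plane cut along [0, oo)) agrees with
  the crossed sum: both are analytic there and coincide for zb = cnj z, where they are Euclidean
  correlators.  That the branch of log u found at a Lorentzian point is the one required is exactly
  the vanishing of the total crossing number.
*)

theory Submission
  imports Defs "HOL-Complex_Analysis.Conformal_Mappings"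
begin

section \<open>The roots avoid the cut on the forward tube\<close>

text \<open>The obstacle is the locus where the two roots coincide. \<open>DD\<close> contains such
  configurations, the roots are continuous only as an unordered pair, and their square roots and
  logarithms cannot be followed separately across the locus. So only combinations symmetric in the
  roots are shown to be analytic. Integer spin makes this possible: moving mu by 2 pi i and nu by -
  2 pi i changes no term, so a branch has to be fixed for mu + nu only. It is fixed by the
  logarithms of the squared distances, which on \<open>DD\<close> are the principal ones.

  The path in the definition of a crossing number is used to find one configuration close to C_L.
  There log u differs from the sum of the principal logarithms of the roots (of their negatives in
  the u-channel) by 2 pi i times the total number of signed crossings, up to sign. A ball around C_L
  meets \<open>DD\<close> in a convex set, and two continuous logarithms of one function differ by a
  constant on a connected set. Hence agreement at that single configuration gives agreement on the
  whole intersection.\<close>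

lemma isometry_span_three_points:
  fixes a b c :: "'a::euclidean_space"
  obtains f :: "'a \<Rightarrow> real ^ 3"
  where "linear f" "\<And>v. v \<in> span {a, b, c} \<Longrightarrow> norm (f v) = norm v"
proof -
  let ?S = "span {a, b, c}"
  have "dim ?S \<le> card {a, b, c}"
    by (simp add: dim_le_card')
  also have "\<dots> \<le> 3"
    by (simp add: card_insert_if)
  finally have "dim ?S \<le> dim (UNIV :: (real ^ 3) set)"
    by simp
  then obtain T :: "(real ^ 3) set" where T: "subspace T" "dim T = dim ?S"
    by (rule choose_subspace_of_subspace)
  then obtain f :: "'a \<Rightarrow> real ^ 3" where "linear f" "f ` ?S = T"
      "\<And>v. v \<in> ?S \<Longrightarrow> norm (f v) = norm v"
    using isometry_subspaces[of ?S T] by auto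
  with that show thesis by blast
qed

text \<open>
  If \<open>u\<^sub>k\<close> is the preimage of \<open>v\<close> under a matrix with Hermitian part \<open>c\<^sub>k\<close>, then it lies in the ball of
  radius \<open>\<bar>v\<bar> / (2 c\<^sub>3)\<close> about \<open>v / (2 c\<^sub>3)\<close>: inside for \<open>k = 1, 2\<close>, on the sphere for \<open>k = 3\<close>.
\<close>

lemma inverse_accretive_convex:
  fixes v :: "'a::real_inner"
  assumes "v \<noteq> 0" and c: "c1 > c3" "c2 > c3" "c3 > 0" and a: "0 \<le> a" "a \<le> 1"
    and u: "u1 \<bullet> v = c1 * (u1 \<bullet> u1)" "u2 \<bullet> v = c2 * (u2 \<bullet> u2)" "u3 \<bullet> v = c3 * (u3 \<bullet> u3)"
    and nz: "u1 \<noteq> 0" "u2 \<noteq> 0"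
  shows "u3 \<noteq> (1 - a) *\<^sub>R u1 + a *\<^sub>R u2"
proof
  assume u3: "u3 = (1 - a) *\<^sub>R u1 + a *\<^sub>R u2"
  define s where "s = 1 / (2 * c3)"
  have s: "s > 0" "2 * s * c3 = 1"
    using c by (auto simp: s_def)
  have sq: "(norm (w - s *\<^sub>R v))\<^sup>2 = (1 - 2 * s * c) * (w \<bullet> w) + (s * norm v)\<^sup>2"
    if "w \<bullet> v = c * (w \<bullet> w)" for w c
  proof -
    have "(norm (w - s *\<^sub>R v))\<^sup>2 = w \<bullet> w - 2 * s * (w \<bullet> v) + s * s * (v \<bullet> v)"
      by (simp add: power2_norm_eq_inner inner_diff inner_commute algebra_simps)
    then show ?thesis
      using that by (simp add: power_mult_distrib power2_norm_eq_inner power2_eq_square[of s] algebra_simps)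
  qed
  have lt: "norm (w - s *\<^sub>R v) < s * norm v" if "w \<bullet> v = c * (w \<bullet> w)" "c > c3" "w \<noteq> 0" for w c
  proof (rule power2_less_imp_less)
    have "2 * s * c > 1"
      using that(2) s by (metis mult_less_cancel_left_pos mult_pos_pos zero_less_numeral)
    then have "(1 - 2 * s * c) * (w \<bullet> w) < 0"
      using that(3) by (intro mult_neg_pos) auto
    then show "(norm (w - s *\<^sub>R v))\<^sup>2 < (s * norm v)\<^sup>2"
      using sq[OF that(1)] by simp
  qed (use s in auto)
  have "norm (u3 - s *\<^sub>R v) = s * norm v"
    using sq[OF u(3)] s by (simp add: power2_eq_iff_nonneg)
  moreover have "u3 - s *\<^sub>R v = (1 - a) *\<^sub>R (u1 - s *\<^sub>R v) + a *\<^sub>R (u2 - s *\<^sub>R v)"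
    by (simp add: u3 algebra_simps)
  then have "norm (u3 - s *\<^sub>R v) \<le> (1 - a) * norm (u1 - s *\<^sub>R v) + a * norm (u2 - s *\<^sub>R v)"
    using a by (metis norm_triangle_ineq norm_scaleR abs_of_nonneg diff_ge_0_iff_ge)
  moreover have "(1 - a) * norm (u1 - s *\<^sub>R v) + a * norm (u2 - s *\<^sub>R v) < s * norm v"
  proof -
    define t where "t = max (norm (u1 - s *\<^sub>R v)) (norm (u2 - s *\<^sub>R v))"
    have "(1 - a) * norm (u1 - s *\<^sub>R v) + a * norm (u2 - s *\<^sub>R v) \<le> (1 - a) * t + a * t"
      using a by (intro add_mono mult_left_mono) (auto simp: t_def)
    also have "\<dots> = t" by (simp add: algebra_simps)
    also have "t < s * norm v"
      using lt[OF u(1) c(1) nz(1)] lt[OF u(2) c(2) nz(2)] by (simp add: t_def)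
    finally show ?thesis .
  qed
  ultimately show False by simp
qed

lemma singular_2x2:
  fixes m11 :: complex
  assumes "m11 * m22 - m12 * m21 = 0"
  obtains v1 v2 where "(v1, v2) \<noteq> (0, 0)" "m11 * v1 + m12 * v2 = 0" "m21 * v1 + m22 * v2 = 0"
proof (cases "m11 = 0 \<and> m12 = 0")
  case True
  show thesis
  proof (cases "m21 = 0 \<and> m22 = 0")
    case False
    with True show thesis by (intro that[of "m22" "- m21"]) (auto simp: algebra_simps)
  qed (use True in \<open>auto intro: that[of 1 0]\<close>)
next
  case False
  with assms show thesis by (intro that[of "m12" "- m11"]) (auto simp: algebra_simps)
qed

text \<open>
  The vector \<open>(\<tau>, p, q, r)\<close> is represented by the matrix \<open>\<tau> + i (p \<sigma>\<^sub>1 + q \<sigma>\<^sub>2 + r \<sigma>\<^sub>3)\<close>, whose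
  determinant is the square of the vector and whose Hermitian part is \<open>Re \<tau>\<close>.
\<close>

lemma pauli_inner:
  fixes u1 u2 \<tau> :: complex and p q r :: real
  shows "(u1, u2) \<bullet> ((\<tau> + \<i> * r) * u1 + (\<i> * p + q) * u2, (\<i> * p - q) * u1 + (\<tau> - \<i> * r) * u2)
    = Re \<tau> * ((u1, u2) \<bullet> (u1, u2))"
  by (simp add: inner_prod_def inner_complex_def algebra_simps)

text \<open>
  After division by \<open>D 1 * D 2 * D 3\<close> the difference of both sides is the determinant of
  \<open>(1 - a) A\<^sub>1\<^sup>-\<^sup>1 + a A\<^sub>2\<^sup>-\<^sup>1 - A\<^sub>3\<^sup>-\<^sup>1\<close>, where \<open>A\<^sub>k\<close> is the matrix of the \<open>k\<close>-th vector.
\<close>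

lemma cross_form_nonzero_coords:
  fixes \<tau> :: "nat \<Rightarrow> complex" and p q r :: "nat \<Rightarrow> real"
  defines "D \<equiv> \<lambda>i. (\<tau> i)\<^sup>2 + of_real ((p i)\<^sup>2 + (q i)\<^sup>2 + (r i)\<^sup>2)"
    and "E \<equiv> \<lambda>i j. (\<tau> i - \<tau> j)\<^sup>2 + of_real ((p i - p j)\<^sup>2 + (q i - q j)\<^sup>2 + (r i - r j)\<^sup>2)"
  assumes re: "Re (\<tau> 1) > Re (\<tau> 3)" "Re (\<tau> 2) > Re (\<tau> 3)" "Re (\<tau> 3) > 0" and a: "0 \<le> a" "a \<le> 1"
    and nz: "D 1 \<noteq> 0" "D 2 \<noteq> 0" "D 3 \<noteq> 0"
  shows "E 1 3 * D 2 * of_real (1 - a) + D 1 * E 2 3 * of_real a \<noteq> E 1 2 * D 3 * of_real (a * (1 - a))"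
proof
  assume eq: "E 1 3 * D 2 * of_real (1 - a) + D 1 * E 2 3 * of_real a = E 1 2 * D 3 * of_real (a * (1 - a))"
  define w :: "nat \<Rightarrow> complex" where "w i = (if i = 1 then of_real (1 - a) else if i = 2 then of_real a else - 1)" for i
  define \<alpha> \<beta> \<gamma> \<delta> where abcd: "\<alpha> = (\<lambda>i. \<tau> i + \<i> * r i)" "\<beta> = (\<lambda>i. \<i> * p i + q i)"
    "\<gamma> = (\<lambda>i. \<i> * p i - q i)" "\<delta> = (\<lambda>i. \<tau> i - \<i> * r i)"
  have D: "D i = \<alpha> i * \<delta> i - \<beta> i * \<gamma> i" for i
    by (simp add: D_def abcd algebra_simps power2_eq_square)
  have E: "D i + D j - E i j = \<alpha> i * \<delta> j + \<alpha> j * \<delta> i - \<beta> i * \<gamma> j - \<beta> j * \<gamma> i" for i j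
    by (simp add: D_def E_def abcd algebra_simps power2_eq_square)
  \<comment> \<open>The inverse of A_i is its adjugate, with rows (\<open>\<delta> i\<close>,
    \<open>- \<beta> i\<close>) and (\<open>- \<gamma> i\<close>, \<open>\<alpha> i\<close>),
    divided by \<open>D i\<close>. The weights \<open>w\<close> combine the three inverses.\<close>
  define m11 m12 m21 m22 where m:
    "m11 = w 1 * (\<delta> 1 / D 1) + w 2 * (\<delta> 2 / D 2) + w 3 * (\<delta> 3 / D 3)"
    "m12 = w 1 * (- \<beta> 1 / D 1) + w 2 * (- \<beta> 2 / D 2) + w 3 * (- \<beta> 3 / D 3)"
    "m21 = w 1 * (- \<gamma> 1 / D 1) + w 2 * (- \<gamma> 2 / D 2) + w 3 * (- \<gamma> 3 / D 3)"
    "m22 = w 1 * (\<alpha> 1 / D 1) + w 2 * (\<alpha> 2 / D 2) + w 3 * (\<alpha> 3 / D 3)"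
  have "m11 * m22 - m12 * m21
     = w 1 * w 1 * ((\<alpha> 1 * \<delta> 1 - \<beta> 1 * \<gamma> 1) / (D 1 * D 1))
     + w 2 * w 2 * ((\<alpha> 2 * \<delta> 2 - \<beta> 2 * \<gamma> 2) / (D 2 * D 2))
     + w 3 * w 3 * ((\<alpha> 3 * \<delta> 3 - \<beta> 3 * \<gamma> 3) / (D 3 * D 3))
     + w 1 * w 2 * ((\<alpha> 1 * \<delta> 2 + \<alpha> 2 * \<delta> 1 - \<beta> 1 * \<gamma> 2 - \<beta> 2 * \<gamma> 1) / (D 1 * D 2))
     + w 1 * w 3 * ((\<alpha> 1 * \<delta> 3 + \<alpha> 3 * \<delta> 1 - \<beta> 1 * \<gamma> 3 - \<beta> 3 * \<gamma> 1) / (D 1 * D 3))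
     + w 2 * w 3 * ((\<alpha> 2 * \<delta> 3 + \<alpha> 3 * \<delta> 2 - \<beta> 2 * \<gamma> 3 - \<beta> 3 * \<gamma> 2) / (D 2 * D 3))"
    by (simp add: m algebra_simps diff_divide_distrib add_divide_distrib)
  also have "\<dots> = w 1 * w 1 * (D 1 / (D 1 * D 1)) + w 2 * w 2 * (D 2 / (D 2 * D 2)) + w 3 * w 3 * (D 3 / (D 3 * D 3))
     + w 1 * w 2 * ((D 1 + D 2 - E 1 2) / (D 1 * D 2)) + w 1 * w 3 * ((D 1 + D 3 - E 1 3) / (D 1 * D 3))
     + w 2 * w 3 * ((D 2 + D 3 - E 2 3) / (D 2 * D 3))"
    by (simp only: E D[symmetric])
  also have "\<dots> = (E 1 3 * D 2 * (1 - a) + D 1 * E 2 3 * a - E 1 2 * D 3 * (a * (1 - a))) / (D 1 * D 2 * D 3)"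
    using nz by (simp add: w_def field_simps)
  also have "\<dots> = 0"
    using eq by simp
  finally obtain v1 v2 where v: "(v1, v2) \<noteq> (0, 0)" "m11 * v1 + m12 * v2 = 0" "m21 * v1 + m22 * v2 = 0"
    by (rule singular_2x2)
  \<comment> \<open>The preimages of the null vector under A_1, A_2, A_3. They satisfy the linear
    relation that \<open>inverse_accretive_convex\<close> forbids.\<close>
  define x y where xy: "x = (\<lambda>i. (\<delta> i * v1 - \<beta> i * v2) / D i)" "y = (\<lambda>i. (\<alpha> i * v2 - \<gamma> i * v1) / D i)"
  have sol: "\<alpha> i * x i + \<beta> i * y i = v1" "\<gamma> i * x i + \<delta> i * y i = v2" if "D i \<noteq> 0" for i
  proof -
    have "\<alpha> i * x i + \<beta> i * y i = (\<alpha> i * \<delta> i - \<beta> i * \<gamma> i) * v1 / D i"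
      by (simp add: xy algebra_simps diff_divide_distrib add_divide_distrib)
    then show "\<alpha> i * x i + \<beta> i * y i = v1" using that D by simp
    have "\<gamma> i * x i + \<delta> i * y i = (\<alpha> i * \<delta> i - \<beta> i * \<gamma> i) * v2 / D i"
      by (simp add: xy algebra_simps diff_divide_distrib add_divide_distrib)
    then show "\<gamma> i * x i + \<delta> i * y i = v2" using that D by simp
  qed
  have inn: "(x i, y i) \<bullet> (v1, v2) = Re (\<tau> i) * ((x i, y i) \<bullet> (x i, y i))" if "D i \<noteq> 0" for i
    using pauli_inner[of "x i" "y i" "\<tau> i" "r i" "p i" "q i"] sol[OF that]
    by (simp add: abcd)
  have un: "(x i, y i) \<noteq> 0" if "D i \<noteq> 0" for i
    using sol[OF that] v(1) by (auto simp: zero_prod_def)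
  have "w 1 * x 1 + w 2 * x 2 + w 3 * x 3 = 0" "w 1 * y 1 + w 2 * y 2 + w 3 * y 3 = 0"
    using v(2,3) by (simp_all add: m xy algebra_simps diff_divide_distrib add_divide_distrib)
  then have "(x 3, y 3) = (1 - a) *\<^sub>R (x 1, y 1) + a *\<^sub>R (x 2, y 2)"
    by (simp add: w_def scaleR_conv_of_real algebra_simps)
  moreover have "(x 3, y 3) \<noteq> (1 - a) *\<^sub>R (x 1, y 1) + a *\<^sub>R (x 2, y 2)"
    using v(1) by (intro inverse_accretive_convex[OF _ re a inn[OF nz(1)] inn[OF nz(2)] inn[OF nz(3)] un[OF nz(1)] un[OF nz(2)]])
      (simp add: zero_prod_def)
  ultimately show False by blast
qed

lemma x2_commute: "x2 C i j = x2 C j i"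
  by (simp add: x2_def power2_commute norm_minus_commute)

lemma x2_slit:
  assumes "Re (fst C $ i) \<noteq> Re (fst C $ j)"
  shows "x2 C i j \<notin> \<real>\<^sub>\<le>\<^sub>0"
proof
  assume *: "x2 C i j \<in> \<real>\<^sub>\<le>\<^sub>0"
  define t where "t = fst C $ i - fst C $ j"
  have "Re t \<noteq> 0" using assms by (simp add: t_def)
  moreover have "Im (t\<^sup>2) = 0" "Re (t\<^sup>2) + (norm (snd C $ i - snd C $ j))\<^sup>2 \<le> 0"
    using * by (auto simp: x2_def t_def complex_nonpos_Reals_iff simp del: Im_power2 Re_power2 of_real_power)
  ultimately show False
    using not_sum_power2_lt_zero by (auto simp: Im_power2 Re_power2 power2_eq_square add_nonpos_nonpos)
      (smt (verit) mult_eq_0_iff not_real_square_gt_zero zero_le_square zero_le_power2)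
qed

lemma DD_Re_neq: "C \<in> DD \<Longrightarrow> i \<noteq> j \<Longrightarrow> Re (fst C $ i) \<noteq> Re (fst C $ j)"
  using exhaust_4[of i] exhaust_4[of j] unfolding DD_def by auto

lemma DD_x2_slit: "C \<in> DD \<Longrightarrow> i \<noteq> j \<Longrightarrow> x2 C i j \<notin> \<real>\<^sub>\<le>\<^sub>0"
  by (rule x2_slit[OF DD_Re_neq])

lemma DD_x2_nonzero: "C \<in> DD \<Longrightarrow> i \<noteq> j \<Longrightarrow> x2 C i j \<noteq> 0"
  using DD_x2_slit[of C i j] by auto

text \<open>Relative to the fourth point there are only three spatial vectors. Their span embeds
  isometrically in \<open>real ^ 3\<close>, where the representation by Pauli matrices is available;
  this settles every spatial dimension at once.\<close>

lemma cross_form_nonzero: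
  assumes C: "C \<in> DD" and a: "0 \<le> a" "a \<le> 1"
  shows "x2 C 1 3 * x2 C 2 4 * of_real (1 - a) + x2 C 1 4 * x2 C 2 3 * of_real a
    \<noteq> x2 C 1 2 * x2 C 3 4 * of_real (a * (1 - a))"
proof -
  define \<iota> :: "nat \<Rightarrow> 4" where "\<iota> n = (if n = 1 then 1 else if n = 2 then 2 else 3)" for n
  define X where "X n = snd C $ \<iota> n - snd C $ 4" for n
  obtain f :: "_ \<Rightarrow> real ^ 3" where f: "linear f" "\<And>v. v \<in> span {X 1, X 2, X 3} \<Longrightarrow> norm (f v) = norm v"
    using isometry_span_three_points[of "X 1" "X 2" "X 3"] by blast
  define \<tau> where "\<tau> n = fst C $ \<iota> n - fst C $ 4" for n
  define p q r where pqr: "p = (\<lambda>n. f (X n) $ 1)" "q = (\<lambda>n. f (X n) $ 2)" "r = (\<lambda>n. f (X n) $ 3)"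
  have n3: "(norm y)\<^sup>2 = (y $ 1)\<^sup>2 + (y $ 2)\<^sup>2 + (y $ 3)\<^sup>2" for y :: "real ^ 3"
    by (simp add: norm_eq_sqrt_inner inner_vec_def sum_3 power2_eq_square)
  have inspan: "X n \<in> span {X 1, X 2, X 3}" for n
    by (rule span_base) (auto simp: X_def \<iota>_def)
  have D: "(\<tau> n)\<^sup>2 + of_real ((p n)\<^sup>2 + (q n)\<^sup>2 + (r n)\<^sup>2) = x2 C (\<iota> n) 4" for n
    using f(2)[OF inspan[of n]] n3[of "f (X n)"]
    by (simp add: x2_def \<tau>_def pqr X_def flip: of_real_power of_real_add)
  have E: "(\<tau> i - \<tau> j)\<^sup>2 + of_real ((p i - p j)\<^sup>2 + (q i - q j)\<^sup>2 + (r i - r j)\<^sup>2) = x2 C (\<iota> i) (\<iota> j)" for i j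
    using f(2)[OF span_diff[OF inspan[of i] inspan[of j]]] n3[of "f (X i - X j)"]
    by (simp add: x2_def \<tau>_def pqr X_def linear_diff[OF f(1)] flip: of_real_power of_real_add)
  have "x2 C (\<iota> 1) (\<iota> 3) * x2 C (\<iota> 2) 4 * of_real (1 - a) + x2 C (\<iota> 1) 4 * x2 C (\<iota> 2) (\<iota> 3) * of_real a
    \<noteq> x2 C (\<iota> 1) (\<iota> 2) * x2 C (\<iota> 3) 4 * of_real (a * (1 - a))"
    unfolding D[symmetric] E[symmetric]
  proof (rule cross_form_nonzero_coords)
    show "Re (\<tau> 1) > Re (\<tau> 3)" "Re (\<tau> 2) > Re (\<tau> 3)" "Re (\<tau> 3) > 0"
      using C by (auto simp: DD_def \<tau>_def \<iota>_def)
    show "(\<tau> 1)\<^sup>2 + of_real ((p 1)\<^sup>2 + (q 1)\<^sup>2 + (r 1)\<^sup>2) \<noteq> 0"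
         "(\<tau> 2)\<^sup>2 + of_real ((p 2)\<^sup>2 + (q 2)\<^sup>2 + (r 2)\<^sup>2) \<noteq> 0"
         "(\<tau> 3)\<^sup>2 + of_real ((p 3)\<^sup>2 + (q 3)\<^sup>2 + (r 3)\<^sup>2) \<noteq> 0"
      unfolding D by (simp_all add: \<iota>_def DD_x2_nonzero[OF C])
  qed (use a in auto)
  then show ?thesis by (simp add: \<iota>_def)
qed

lemma cross_roots_swap: "cross_roots C z zb \<Longrightarrow> cross_roots C zb z"
  by (simp add: cross_roots_def mult.commute)

text \<open>A root z = 1 / a with 0 < a \<le> 1 gives zb = a u, and eliminating zb leaves (1 - a) +
  a v = a (1 - a) u. Multiplied by \<open>x2 C 1 3 * x2 C 2 4\<close> this is the equality that
  \<open>cross_form_nonzero\<close> excludes.\<close>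

lemma DD_roots:
  assumes C: "C \<in> DD" and z: "cross_roots C z zb"
  shows "z \<notin> complex_of_real ` {1..}"
proof
  assume "z \<in> complex_of_real ` {1..}"
  then obtain t where t: "z = of_real t" "t \<ge> 1" by auto
  define a where "a = 1 / t"
  have a: "0 \<le> a" "a \<le> 1" "z * of_real a = 1"
    using t by (auto simp: a_def field_simps)
  note nz = DD_x2_nonzero[OF C]
  have u: "z * zb * (x2 C 1 3 * x2 C 2 4) = x2 C 1 2 * x2 C 3 4"
    and v: "(1 - z) * (1 - zb) * (x2 C 1 3 * x2 C 2 4) = x2 C 1 4 * x2 C 2 3"
    using z by (simp_all add: cross_roots_def cross_u_def cross_v_def nz)
  have zb: "zb = of_real a * (z * zb)" using a(3) by (simp add: mult.commute mult.left_commute)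
  have "(of_real a - 1) * (1 - zb) = of_real a * ((1 - z) * (1 - zb))"
    using a(3) by (simp add: algebra_simps)
  have "x2 C 1 2 * x2 C 3 4 * of_real (a * (1 - a)) = (1 - of_real a) * (of_real a * (z * zb)) * (x2 C 1 3 * x2 C 2 4)"
    unfolding u[symmetric] by simp
  also have "\<dots> = (1 - of_real a) * zb * (x2 C 1 3 * x2 C 2 4)"
    unfolding zb[symmetric] by simp
  also have "\<dots> = (of_real a * ((1 - z) * (1 - zb)) + (1 - of_real a)) * (x2 C 1 3 * x2 C 2 4)"
    unfolding \<open>(of_real a - 1) * (1 - zb) = _\<close>[symmetric] by (simp add: algebra_simps)
  also have "\<dots> = x2 C 1 3 * x2 C 2 4 * of_real (1 - a) + x2 C 1 4 * x2 C 2 3 * of_real a"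
    unfolding v[symmetric] by (simp add: algebra_simps)
  finally show False
    using cross_form_nonzero[OF C a(1,2)] by simp
qed

section \<open>Sums of exponentials and uniqueness on the antidiagonal\<close>

text \<open>Different logarithms of one number are at least 2 pi apart, so \<open>f\<close> has
  discrete range on a connected set.\<close>

lemma exp_constant_imp_constant:
  fixes f :: "'a::topological_space \<Rightarrow> complex"
  assumes X: "connected X" and cont: "continuous_on X f" and k: "\<And>x. x \<in> X \<Longrightarrow> exp (f x) = k"
    and ab: "a \<in> X" "b \<in> X"
  shows "f a = f b"
proof -
  have "f constant_on X"
  proof (rule continuous_discrete_range_constant[OF X cont])
    fix x assume x: "x \<in> X"
    have "2 * pi \<le> norm (f y - f x)" if "y \<in> X" "f y \<noteq> f x" for y
    proof -
      have "exp (f y) = exp (f x)" using k that x by simp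
      then obtain n :: int where n: "f y = f x + of_int (2 * n) * of_real pi * \<i>"
        by (auto simp: exp_eq)
      with that have "n \<noteq> 0" by auto
      then have "1 \<le> \<bar>real_of_int n\<bar>" by linarith
      then have "2 * pi * 1 \<le> 2 * pi * \<bar>real_of_int n\<bar>" by (intro mult_left_mono) auto
      also have "\<dots> = norm (f y - f x)" by (simp add: n norm_mult)
      finally show ?thesis by simp
    qed
    then show "\<exists>e>0. \<forall>y. y \<in> X \<and> f y \<noteq> f x \<longrightarrow> e \<le> norm (f y - f x)"
      by (intro exI[of _ "2 * pi"]) auto
  qed
  then show ?thesis using ab by (auto simp: constant_on_def)
qed

text \<open>A substitute for holomorphy in two variables. Identity theorems are applied along one
  complex line at a time, for which composition with pairs of holomorphic functions of one variable
  suffices; this property also passes easily through compositions.\<close>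

definition curvewise_holomorphic :: "(complex \<Rightarrow> complex \<Rightarrow> complex) \<Rightarrow> complex set \<Rightarrow> bool" where
  "curvewise_holomorphic E D \<longleftrightarrow>
    (\<forall>S f g. open S \<longrightarrow> f holomorphic_on S \<longrightarrow> g holomorphic_on S \<longrightarrow> f ` S \<subseteq> D \<longrightarrow> g ` S \<subseteq> D \<longrightarrow>
       (\<lambda>t. E (f t) (g t)) holomorphic_on S)"

lemma curvewise_holomorphicD:
  "curvewise_holomorphic E D \<Longrightarrow> open S \<Longrightarrow> f holomorphic_on S \<Longrightarrow> g holomorphic_on S
    \<Longrightarrow> f ` S \<subseteq> D \<Longrightarrow> g ` S \<subseteq> D \<Longrightarrow> (\<lambda>t. E (f t) (g t)) holomorphic_on S"
  by (simp add: curvewise_holomorphic_def)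

lemma holomorphic_zero_on_reals:
  assumes f: "f holomorphic_on ball (of_real c) r" and r: "r > 0"
    and 0: "\<And>x::real. \<bar>x - c\<bar> < r \<Longrightarrow> f (of_real x) = 0"
    and w: "w \<in> ball (complex_of_real c) r"
  shows "f w = 0"
proof (rule analytic_continuation[OF f])
  let ?U = "complex_of_real ` {c - r<..<c + r}"
  show "?U \<subseteq> ball (of_real c) r"
    by (auto simp: dist_norm abs_if simp flip: of_real_diff)
  show "complex_of_real c islimpt ?U"
    unfolding islimpt_approachable
  proof (intro allI impI)
    fix e :: real assume "e > 0"
    define x where "x = c + min e r / 2"
    have "dist (complex_of_real x) (of_real c) < e" "of_real x \<in> ?U" "x \<noteq> c"
      using \<open>e > 0\<close> r by (auto simp: x_def dist_norm simp flip: of_real_diff of_real_add)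
    then show "\<exists>x'\<in>?U. x' \<noteq> of_real c \<and> dist x' (of_real c) < e"
      by (intro bexI[of _ "of_real x"]) auto
  qed
  show "f z = 0" if "z \<in> ?U" for z
    using that 0 by (auto simp: abs_if)
qed (use w r in auto)

text \<open>
  The antidiagonal \<open>{(z, z\<^sup>*)}\<close> is a totally real surface, hence a set of uniqueness: write
  \<open>z = a + i b\<close>, \<open>w = a - i b\<close> and continue first in \<open>b\<close>, then in \<open>a\<close>.
\<close>

lemma antidiagonal_identity:
  fixes p :: real
  assumes E: "curvewise_holomorphic E D" and D: "open D" "connected D"
    and e: "e > 0" "ball (of_real p) e \<subseteq> D"
    and 0: "\<And>z. z \<in> ball (of_real p) e \<Longrightarrow> E z (cnj z) = 0"
    and zw: "z \<in> D" "w \<in> D"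
  shows "E z w = 0"
proof -
  \<comment> \<open>With radius e / 3 for both a and b the points a + i b and a - i b stay in the
    given ball.\<close>
  define r where "r = e / 3"
  have r: "r > 0" using e by (simp add: r_def)
  have nm: "norm (a + \<i> * b - of_real p) \<le> norm (a - of_real p) + norm b"
      "norm (a - \<i> * b - of_real p) \<le> norm (a - of_real p) + norm b" for a b :: complex
    using norm_triangle_ineq[of "a - of_real p" "\<i> * b"] norm_triangle_ineq4[of "a - of_real p" "\<i> * b"]
    by (simp_all add: norm_mult algebra_simps)
  have inB: "a + \<i> * b \<in> ball (of_real p) e" "a - \<i> * b \<in> ball (of_real p) e"
    if "a \<in> ball (of_real p) r" "b \<in> ball 0 r" for a b :: complex
    using nm[of a b] that r by (auto simp: dist_norm norm_minus_commute r_def)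
  have inD: "a + \<i> * b \<in> D" "a - \<i> * b \<in> D" if "a \<in> ball (of_real p) r" "b \<in> ball 0 r" for a b :: complex
    using inB[OF that] e(2) by auto
  have 1: "E (of_real a + \<i> * b) (of_real a - \<i> * b) = 0" if a: "\<bar>a - p\<bar> < r" and b: "b \<in> ball 0 r" for a :: real and b
  proof (rule holomorphic_zero_on_reals[of "\<lambda>b. E (of_real a + \<i> * b) (of_real a - \<i> * b)" 0 r])
    have a': "complex_of_real a \<in> ball (of_real p) r"
      using a by (simp add: dist_norm abs_minus_commute flip: of_real_diff)
    show "(\<lambda>b. E (of_real a + \<i> * b) (of_real a - \<i> * b)) holomorphic_on ball (of_real 0) r"
      by (rule curvewise_holomorphicD[OF E]) (auto intro!: holomorphic_intros inD a')
    fix x :: real assume "\<bar>x - 0\<bar> < r"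
    then have "E (of_real a + \<i> * of_real x) (cnj (of_real a + \<i> * of_real x)) = 0"
      by (intro 0 inB a') auto
    then show "E (of_real a + \<i> * of_real x) (of_real a - \<i> * of_real x) = 0" by simp
  qed (use b r in auto)
  have 2: "E (a + \<i> * b) (a - \<i> * b) = 0" if a: "a \<in> ball (of_real p) r" and b: "b \<in> ball 0 r" for a b
  proof (rule holomorphic_zero_on_reals[of "\<lambda>a. E (a + \<i> * b) (a - \<i> * b)" p r])
    show "(\<lambda>a. E (a + \<i> * b) (a - \<i> * b)) holomorphic_on ball (of_real p) r"
      by (rule curvewise_holomorphicD[OF E]) (auto intro!: holomorphic_intros inD b)
  qed (use a b r 1 in auto)
  have 3: "E x y = 0" if "x \<in> ball (of_real p) r" "y \<in> ball (of_real p) r" for x y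
  proof -
    \<comment> \<open>Every pair (x, y) near (p, p) arises from a = (x + y) / 2 and b = (x - y) / (2
      i).\<close>
    have "(x + y) / 2 \<in> ball (of_real p) r"
      using that convexD_alt[OF convex_ball[of "complex_of_real p" r], of x y "1/2"]
      by (simp add: scaleR_conv_of_real add_divide_distrib)
    moreover have "(x - y) / (2 * \<i>) \<in> ball 0 r"
      using that norm_triangle_ineq4[of "x - of_real p" "y - of_real p"]
      by (auto simp: dist_norm norm_minus_commute norm_divide norm_mult)
    ultimately have "E ((x + y) / 2 + \<i> * ((x - y) / (2 * \<i>))) ((x + y) / 2 - \<i> * ((x - y) / (2 * \<i>))) = 0"
      by (rule 2)
    moreover have "(x + y) / 2 + \<i> * ((x - y) / (2 * \<i>)) = x" "(x + y) / 2 - \<i> * ((x - y) / (2 * \<i>)) = y"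
      by (simp_all add: field_simps)
    ultimately show ?thesis by simp
  qed
  have pD: "complex_of_real p \<in> D" and sub: "ball (complex_of_real p) r \<subseteq> D"
    using e by (auto simp: r_def)
  have lim: "complex_of_real p islimpt ball (of_real p) r"
    using r by (simp add: islimpt_ball)
  \<comment> \<open>From the bidisc around (p, p) the vanishing spreads over \<open>D\<close> in the
    first variable, and then in the second.\<close>
  have 4: "E z y = 0" if "z \<in> D" "y \<in> ball (of_real p) r" for z y
    by (rule analytic_continuation[of "\<lambda>z. E z y" D, OF _ D sub pD lim])
      (use that 3 sub in \<open>auto intro!: curvewise_holomorphicD[OF E] holomorphic_intros D\<close>)
  show ?thesis
    by (rule analytic_continuation[of "\<lambda>w. E z w" D, OF _ D sub pD lim])
      (use zw 4 in \<open>auto intro!: curvewise_holomorphicD[OF E] holomorphic_intros D\<close>)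
qed

text \<open>The channel sum in logarithmic variables mu = log rho, nu = log rhob.
  \<open>summable\<close> is absolute convergence where both moduli equal exp K; \<open>even\<close>
  is invariance under complex conjugation of rho on the Euclidean slice.\<close>

locale state_sum =
  fixes A :: "'a set" and c h hb :: "'a \<Rightarrow> real"
  assumes weights: "\<And>a. a \<in> A \<Longrightarrow> 0 \<le> h a \<and> 0 \<le> hb a \<and> h a - hb a \<in> \<int>"
    and summable: "\<And>K. K < 0 \<Longrightarrow> (\<lambda>a. \<bar>c a\<bar> * exp ((h a + hb a) * K)) summable_on A"
    and even: "\<And>K \<theta>. K < 0 \<Longrightarrow>
      (\<Sum>\<^sub>\<infinity>a\<in>A. of_real (c a) * exp (of_real (h a) * Complex K \<theta> + of_real (hb a) * Complex K (- \<theta>)))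
      = (\<Sum>\<^sub>\<infinity>a\<in>A. of_real (c a) * exp (of_real (h a) * Complex K (- \<theta>) + of_real (hb a) * Complex K \<theta>))"
begin

definition monom :: "complex \<Rightarrow> complex \<Rightarrow> 'a \<Rightarrow> complex" where
  "monom \<mu> \<nu> a = of_real (c a) * exp (of_real (h a) * \<mu> + of_real (hb a) * \<nu>)"

definition psi :: "complex \<Rightarrow> complex \<Rightarrow> complex" where
  "psi \<mu> \<nu> = infsum (monom \<mu> \<nu>) A"

lemma norm_monom_le:
  assumes "a \<in> A" "Re \<mu> \<le> K" "Re \<nu> \<le> K"
  shows "norm (monom \<mu> \<nu> a) \<le> \<bar>c a\<bar> * exp ((h a + hb a) * K)"
proof -
  have "h a * Re \<mu> + hb a * Re \<nu> \<le> h a * K + hb a * K"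
    using weights[OF assms(1)] assms by (intro add_mono mult_left_mono) auto
  then show ?thesis
    by (simp add: monom_def norm_mult mult_left_mono algebra_simps)
qed

lemma monom_has_sum:
  assumes "Re \<mu> < 0" "Re \<nu> < 0"
  shows "(monom \<mu> \<nu> has_sum psi \<mu> \<nu>) A"
proof -
  have "(\<lambda>a. norm (monom \<mu> \<nu> a)) summable_on A"
    by (rule summable_on_comparison_test[OF summable[of "max (Re \<mu>) (Re \<nu>)"]])
      (use assms in \<open>auto intro!: norm_monom_le\<close>)
  then show ?thesis
    unfolding psi_def by (rule has_sum_infsum[OF abs_summable_summable])
qed

text \<open>If mu moves by 2 pi i n and nu by - 2 pi i n, the exponent moves by 2 pi i n (h - hb),
  and h - hb is an integer.\<close>

lemma monom_cong:
  assumes "a \<in> A" and L: "\<mu> + \<nu> = \<mu>' + \<nu>'" and e: "exp \<mu> = exp \<mu>'"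
  shows "monom \<mu> \<nu> a = monom \<mu>' \<nu>' a"
proof -
  obtain n :: int where n: "\<mu> = \<mu>' + of_int (2 * n) * of_real pi * \<i>"
    using e by (auto simp: exp_eq)
  obtain m :: int where m: "h a - hb a = of_int m"
    using weights[OF assms(1)] by (auto elim: Ints_cases)
  have \<nu>: "\<nu> = \<nu>' - of_int (2 * n) * of_real pi * \<i>"
    using L n by (simp add: algebra_simps)
  have hh: "h a = hb a + of_int m" using m by simp
  have "of_real (h a) * \<mu> + of_real (hb a) * \<nu>
      = of_real (h a) * \<mu>' + of_real (hb a) * \<nu>' + of_int (2 * (m * n)) * of_real pi * \<i>"
    unfolding n \<nu> hh by (simp add: algebra_simps)
  then have "exp (of_real (h a) * \<mu> + of_real (hb a) * \<nu>) = exp (of_real (h a) * \<mu>' + of_real (hb a) * \<nu>')"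
    by (simp only: exp_eq) (rule exI[of _ "m * n"], simp)
  then show ?thesis by (simp add: monom_def)
qed

lemma psi_cong:
  assumes "\<mu> + \<nu> = \<mu>' + \<nu>'" "exp \<mu> = exp \<mu>'"
  shows "psi \<mu> \<nu> = psi \<mu>' \<nu>'"
  unfolding psi_def by (intro infsum_cong monom_cong assms)

lemma psi_holomorphic:
  assumes S: "open S" and hol: "f holomorphic_on S" "g holomorphic_on S"
    and neg: "\<And>t. t \<in> S \<Longrightarrow> Re (f t) < 0" "\<And>t. t \<in> S \<Longrightarrow> Re (g t) < 0"
  shows "(\<lambda>t. psi (f t) (g t)) holomorphic_on S"
proof -
  have "\<exists>r>0. ball t r \<subseteq> S \<and> (\<lambda>t. psi (f t) (g t)) holomorphic_on ball t r" if t: "t \<in> S" for t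
  proof -
    \<comment> \<open>Half of a negative maximum lies strictly between it and 0: near t both real
      parts stay below K, and the series at K dominates.\<close>
    define K where "K = max (Re (f t)) (Re (g t)) / 2"
    have K: "K < 0" "Re (f t) < K" "Re (g t) < K"
      using neg[OF t] by (auto simp: K_def)
    have cont: "continuous_on S f" "continuous_on S g"
      using hol holomorphic_on_imp_continuous_on by auto
    have "open (S \<inter> (\<lambda>s. Re (f s)) -` {..<K})" "open (S \<inter> (\<lambda>s. Re (g s)) -` {..<K})"
      using cont S by (intro continuous_open_preimage continuous_intros; simp)+
    then have "open (S \<inter> (\<lambda>s. Re (f s)) -` {..<K} \<inter> (S \<inter> (\<lambda>s. Re (g s)) -` {..<K}))" by blast
    moreover have "t \<in> S \<inter> (\<lambda>s. Re (f s)) -` {..<K} \<inter> (S \<inter> (\<lambda>s. Re (g s)) -` {..<K})"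
      using t K by auto
    ultimately obtain r where r: "r > 0" "cball t r \<subseteq> S \<inter> (\<lambda>s. Re (f s)) -` {..<K} \<inter> (S \<inter> (\<lambda>s. Re (g s)) -` {..<K})"
      using open_contains_cball by blast
    have inS: "cball t r \<subseteq> S" and le: "\<And>s. s \<in> cball t r \<Longrightarrow> Re (f s) \<le> K \<and> Re (g s) \<le> K"
      using r(2) by (auto simp: less_imp_le subset_iff)
    have ul: "uniform_limit (cball t r) (\<lambda>X s. \<Sum>a\<in>X. monom (f s) (g s) a) (\<lambda>s. psi (f s) (g s)) (finite_subsets_at_top A)"
      unfolding psi_def
      by (rule Weierstrass_m_test_general[OF _ summable[OF K(1)]]) (use le norm_monom_le in auto)
    have "(\<lambda>s. \<Sum>a\<in>X. monom (f s) (g s) a) holomorphic_on S" for X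
      unfolding monom_def by (intro holomorphic_intros hol)
    then have "continuous_on (cball t r) (\<lambda>s. \<Sum>a\<in>X. monom (f s) (g s) a) \<and> (\<lambda>s. \<Sum>a\<in>X. monom (f s) (g s) a) holomorphic_on ball t r" for X
      using inS by (meson ball_subset_cball holomorphic_on_imp_continuous_on holomorphic_on_subset)
    from this have "(\<lambda>s. psi (f s) (g s)) holomorphic_on ball t r"
      by (rule holomorphic_uniform_limit[OF always_eventually[OF allI] ul finite_subsets_at_top_neq_bot])
    then show ?thesis using r(1) inS by (meson ball_subset_cball order_trans)
  qed
  then show ?thesis
    using S by (simp add: holomorphic_on_open) (meson centre_in_ball)
qed

lemma psi_commute:
  assumes "Re \<mu> < 0" "Re \<nu> < 0"
  shows "psi \<mu> \<nu> = psi \<nu> \<mu>"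
proof -
  have "psi \<mu> \<nu> - psi \<nu> \<mu> = 0"
  proof (rule antidiagonal_identity[of "\<lambda>\<mu> \<nu>. psi \<mu> \<nu> - psi \<nu> \<mu>" "{z. Re z < 0}" 1 "- 1"])
    show "curvewise_holomorphic (\<lambda>\<mu> \<nu>. psi \<mu> \<nu> - psi \<nu> \<mu>) {z. Re z < 0}"
      unfolding curvewise_holomorphic_def
      by (auto intro!: holomorphic_intros psi_holomorphic)
    show "open {z. Re z < 0}" by (rule open_halfspace_Re_lt)
    show "connected {z. Re z < 0}" by (intro convex_connected convex_halfspace_Re_lt)
    show sub: "ball (complex_of_real (- 1)) 1 \<subseteq> {z. Re z < 0}"
    proof
      fix z assume "z \<in> ball (complex_of_real (- 1)) 1"
      then show "z \<in> {z. Re z < 0}"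
        using abs_Re_le_cmod[of "z + 1"] by (auto simp: dist_norm norm_minus_commute add.commute)
    qed
    fix z assume "z \<in> ball (complex_of_real (- 1)) 1"
    then have "Re z < 0" using sub by blast
    moreover have "Complex (Re z) (Im z) = z" "Complex (Re z) (- Im z) = cnj z"
      by (simp_all add: complex_eq_iff)
    ultimately show "psi z (cnj z) - psi (cnj z) z = 0"
      using even[of "Re z" "Im z"] by (simp add: psi_def monom_def[abs_def])
  qed (use assms in auto)
  then show ?thesis by simp
qed

end

section \<open>Analyticity in the temporal variables\<close>

definition cfrechet :: "(complex ^ 'm::finite \<Rightarrow> complex) \<Rightarrow> complex ^ 'm \<Rightarrow> bool" where
  "cfrechet f p \<longleftrightarrow> (\<exists>F'. (f has_derivative F') (at p) \<and> (\<forall>c v. F' (c *s v) = c * F' v))"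

lemma cfrechet_const: "cfrechet (\<lambda>_. k) p"
  unfolding cfrechet_def by (intro exI[of _ "\<lambda>_. 0"]) auto

lemma cfrechet_nth: "cfrechet (\<lambda>x. x $ k) p"
  unfolding cfrechet_def
  by (intro exI[of _ "\<lambda>x. x $ k"]) (auto intro: bounded_linear_imp_has_derivative bounded_linear_vec_nth)

lemma cfrechet_add:
  assumes "cfrechet f p" "cfrechet g p"
  shows "cfrechet (\<lambda>x. f x + g x) p"
proof -
  obtain F G where "(f has_derivative F) (at p)" "(g has_derivative G) (at p)"
      "\<And>c v. F (c *s v) = c * F v" "\<And>c v. G (c *s v) = c * G v"
    using assms by (auto simp: cfrechet_def)
  then show ?thesis
    unfolding cfrechet_def
    by (intro exI[of _ "\<lambda>h. F h + G h"]) (auto intro!: has_derivative_add simp: algebra_simps)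
qed

lemma cfrechet_mult:
  assumes "cfrechet f p" "cfrechet g p"
  shows "cfrechet (\<lambda>x. f x * g x) p"
proof -
  obtain F G where FG: "(f has_derivative F) (at p)" "(g has_derivative G) (at p)"
      "\<And>c v. F (c *s v) = c * F v" "\<And>c v. G (c *s v) = c * G v"
    using assms by (auto simp: cfrechet_def)
  show ?thesis
    unfolding cfrechet_def
    by (rule exI, rule conjI, rule has_derivative_mult[OF FG(1,2)]) (simp add: FG algebra_simps)
qed

lemma cfrechet_compose:
  assumes f: "cfrechet f p" and g: "g field_differentiable at (f p)"
  shows "cfrechet (\<lambda>x. g (f x)) p"
proof -
  obtain F where F: "(f has_derivative F) (at p)" "\<And>c v. F (c *s v) = c * F v"
    using f by (auto simp: cfrechet_def)
  obtain d where "(g has_field_derivative d) (at (f p))"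
    using g by (auto simp: field_differentiable_def)
  then have "((\<lambda>x. g (f x)) has_derivative (\<lambda>h. d * F h)) (at p)"
    using has_derivative_compose[OF F(1), of g "(*) d"] by (simp add: has_field_derivative_def)
  then show ?thesis
    unfolding cfrechet_def using F(2) by (intro exI[of _ "\<lambda>h. d * F h"]) auto
qed

lemma cfrechet_transform:
  assumes "cfrechet f p" "open S" "p \<in> S" "\<And>x. x \<in> S \<Longrightarrow> f x = g x"
  shows "cfrechet g p"
  using assms unfolding cfrechet_def by (meson has_derivative_transform_within_open)

lemma norm_vector_smult: "norm (c *s v) = norm c * norm (v :: complex ^ 'm::finite)"
  by (simp add: norm_vec_def norm_mult L2_set_right_distrib)

text \<open>Restriction to complex lines makes the Cauchy estimates in one variable
  available.\<close>

lemma cfrechet_line: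
  fixes f :: "complex ^ 'm::finite \<Rightarrow> complex"
  assumes F: "(f has_derivative F) (at (p + t *s v))" "\<And>c v. F (c *s v) = c * F v"
  shows "((\<lambda>t. f (p + t *s v)) has_field_derivative F v) (at t)"
proof -
  have "bounded_linear (\<lambda>t::complex. t *s v)"
  proof (rule bounded_linear_intro[of _ "norm v"])
    show "(r *\<^sub>R t) *s v = r *\<^sub>R (t *s v)" for r t
      by (simp add: vector_scalar_mult_def scaleR_vec_def)
  qed (simp_all add: vector_sadd_rdistrib norm_vector_smult)
  then have "((\<lambda>t. p + t *s v) has_derivative (\<lambda>t. t *s v)) (at t)"
    by (auto intro!: derivative_eq_intros bounded_linear_imp_has_derivative)
  from has_derivative_compose[OF this F(1)] show ?thesis
    by (simp add: has_field_derivative_def F(2) mult_commute_abs)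
qed

text \<open>Cauchy's inequality on the circle of radius R / 2 bounds the n-th Taylor coefficient by
  M q^n with q = 2 / R. As R \<ge> 4 gives q \<le> 1/2, the tail from n = 2 on is at most 2 M
  q^2.\<close>

lemma second_order_Taylor_bound:
  assumes f: "f holomorphic_on ball 0 R" and R: "4 \<le> R"
    and M: "\<And>t. t \<in> ball 0 R \<Longrightarrow> norm (f t) \<le> M"
  shows "norm (f 1 - f 0 - deriv f 0) \<le> 8 * M / R\<^sup>2" and "norm (deriv f 0) \<le> 2 * M / R"
proof -
  define a where "a n = (deriv ^^ n) f 0 / fact n" for n
  have sub: "ball 0 (R/2) \<subseteq> ball (0::complex) R" "cball 0 (R/2) \<subseteq> ball (0::complex) R"
    using R by auto
  have "norm ((deriv ^^ n) f 0) \<le> fact n * M / (R/2) ^ n" for n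
    by (rule Cauchy_inequality)
      (use R sub M f in \<open>auto intro: holomorphic_on_subset holomorphic_on_imp_continuous_on\<close>)
  then have a: "norm (a n) \<le> M / (R/2) ^ n" for n
    by (simp add: a_def norm_divide field_simps)
  from a[of 1] show "norm (deriv f 0) \<le> 2 * M / R"
    by (simp add: a_def field_simps)
  have "a sums f 1"
    using holomorphic_power_series[OF f, of 1] R by (simp add: a_def[abs_def])
  then have s: "(\<lambda>n. a (n + 2)) sums (f 1 - f 0 - deriv f 0)"
    using sums_split_initial_segment[of a "f 1" 2] by (simp add: a_def numeral_2_eq_2 algebra_simps)
  have M0: "M \<ge> 0" using M[of 0] R norm_ge_zero[of "f 0"] by (simp del: norm_ge_zero)
  define q where "q = 2 / R"
  have q: "0 < q" "q \<le> 1/2" using R by (auto simp: q_def field_simps)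
  have gs: "(\<lambda>n. M * q\<^sup>2 * q ^ n) sums (M * q\<^sup>2 * (1 / (1 - q)))"
    using q by (intro sums_mult geometric_sums) auto
  have le: "norm (a (n + 2)) \<le> M * q\<^sup>2 * q ^ n" for n
    using a[of "n + 2"] R by (simp add: q_def power_divide power2_eq_square field_simps)
  have "norm (f 1 - f 0 - deriv f 0) \<le> M * q\<^sup>2 * (1 / (1 - q))"
    using sums_le[OF le] s gs norm_suminf_le[OF le sums_summable[OF gs]] by (simp add: sums_iff)
  also have "\<dots> \<le> M * q\<^sup>2 * 2"
    using q M0 by (intro mult_left_mono) (auto simp: field_simps)
  also have "\<dots> = 8 * M / R\<^sup>2" by (simp add: q_def power_divide)
  finally show "norm (f 1 - f 0 - deriv f 0) \<le> 8 * M / R\<^sup>2" .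
qed

text \<open>Termwise differentiation under a Weierstrass bound. On each complex line through
  \<open>p\<close> the bound \<open>M a\<close> controls the derivative of \<open>f a\<close> and
  its second-order remainder, linearly and quadratically in the increment; both estimates can be
  summed over \<open>a\<close>.\<close>

lemma cfrechet_infsum:
  fixes f :: "'a \<Rightarrow> complex ^ 'm::finite \<Rightarrow> complex"
  assumes r: "r > 0" and f: "\<And>a q. a \<in> A \<Longrightarrow> q \<in> ball p r \<Longrightarrow> cfrechet (f a) q"
    and M: "\<And>a q. a \<in> A \<Longrightarrow> q \<in> ball p r \<Longrightarrow> norm (f a q) \<le> M a" "M summable_on A"
  shows "cfrechet (\<lambda>q. \<Sum>\<^sub>\<infinity>a\<in>A. f a q) p"
proof -
  have "\<exists>F. (f a has_derivative F) (at p) \<and> (\<forall>c v. F (c *s v) = c * F v)" if "a \<in> A" for a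
    using f[OF that, of p] r by (simp add: cfrechet_def)
  then obtain F where F: "\<And>a. a \<in> A \<Longrightarrow> (f a has_derivative F a) (at p)"
      "\<And>a c v. a \<in> A \<Longrightarrow> F a (c *s v) = c * F a v"
    by metis
  have est: "norm (f a (p + v) - f a p - F a v) \<le> M a * (8 * (norm v)\<^sup>2 / r\<^sup>2)"
            "norm (F a v) \<le> M a * (2 * norm v / r)"
    if a: "a \<in> A" and v: "norm v \<le> r / 4" "v \<noteq> 0" for a v
  proof -
    \<comment> \<open>For norm t < R the point p + t v stays in the ball of radius r. The increment
      itself is t = 1, and norm v \<le> r / 4 gives R \<ge> 4.\<close>
    define R where "R = r / norm v"
    have R: "4 \<le> R" using v by (simp add: R_def field_simps)
    have inb: "p + t *s v \<in> ball p r" if "t \<in> ball 0 R" for t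
      using that v by (simp add: R_def dist_norm norm_vector_smult field_simps)
    have "((\<lambda>t. f a (p + t *s v)) has_field_derivative F a v) (at 0)"
      by (rule cfrechet_line) (use F a in auto)
    then have d: "deriv (\<lambda>t. f a (p + t *s v)) 0 = F a v"
      by (rule DERIV_imp_deriv)
    have hol: "(\<lambda>t. f a (p + t *s v)) holomorphic_on ball 0 R"
      unfolding holomorphic_on_open[OF open_ball]
    proof
      fix t :: complex assume "t \<in> ball 0 R"
      from f[OF a inb[OF this]] show "\<exists>f'. ((\<lambda>t. f a (p + t *s v)) has_field_derivative f') (at t)"
        unfolding cfrechet_def by (metis cfrechet_line)
    qed
    note T = second_order_Taylor_bound[OF hol R M(1)[OF a inb]]
    from T show "norm (f a (p + v) - f a p - F a v) \<le> M a * (8 * (norm v)\<^sup>2 / r\<^sup>2)"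
        "norm (F a v) \<le> M a * (2 * norm v / r)"
      by (simp_all add: d R_def power_divide mult_ac)
  qed
  have lin: "bounded_linear (F a)" if "a \<in> A" for a
    using F(1)[OF that] by (rule has_derivative_bounded_linear)
  have F0 [simp]: "F a 0 = 0" if "a \<in> A" for a
    using lin[OF that] by (simp add: linear_simps)
  have bd: "norm (F a v) \<le> M a * (2 * norm v / r)" if a: "a \<in> A" for a v
  proof (cases "v = 0")
    case False
    \<comment> \<open>The estimate is known for short vectors only; rescaling to norm r / 4 extends
      it to all, as \<open>F a\<close> is linear.\<close>
    define s where "s = r / 4 / norm v"
    have s: "s > 0" using r False by (simp add: s_def)
    have "norm (F a (s *\<^sub>R v)) \<le> M a * (2 * norm (s *\<^sub>R v) / r)"
      by (rule est[OF a]) (use False r in \<open>auto simp: s_def\<close>)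
    then have "s * norm (F a v) \<le> s * (M a * (2 * norm v / r))"
      using s by (simp add: linear_simps[OF lin[OF a]] mult_ac)
    then show ?thesis using s by (simp only: mult_le_cancel_left_pos)
  qed (use that in simp)
  have Fsum: "(\<lambda>a. F a v) summable_on A" for v
  proof (rule abs_summable_summable, rule summable_on_comparison_test)
    show "(\<lambda>a. M a * (2 * norm v / r)) summable_on A"
      by (rule summable_on_cmult_left[OF M(2)])
  qed (use bd in auto)
  have fsum: "(\<lambda>a. f a q) summable_on A" if "q \<in> ball p r" for q
    by (rule abs_summable_summable, rule summable_on_comparison_test[OF M(2)]) (use M(1) that in auto)
  define S where "S = (\<Sum>\<^sub>\<infinity>a\<in>A. M a)"
  define D where "D v = (\<Sum>\<^sub>\<infinity>a\<in>A. F a v)" for v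
  have Mhs: "((\<lambda>a. M a * k) has_sum (S * k)) A" for k
    unfolding S_def by (intro has_sum_cmult_left has_sum_infsum M)
  have Dlin: "D (c *s v) = c * D v" for c v
    unfolding D_def using F(2) by (simp add: infsum_cmult_right' cong: infsum_cong)
  have "bounded_linear D"
  proof (rule bounded_linear_intro[of _ "S * (2 / r)"])
    show "D (x + y) = D x + D y" for x y
      unfolding D_def infsum_add[OF Fsum Fsum, symmetric]
      by (intro infsum_cong) (simp add: linear_simps[OF lin])
    show "D (k *\<^sub>R x) = k *\<^sub>R D x" for k x
      using Dlin[of "of_real k" x] by (simp add: scaleR_conv_of_real vector_scalar_mult_def scaleR_vec_def)
    show "norm (D x) \<le> norm x * (S * (2 / r))" for x
      using norm_infsum_le[OF has_sum_infsum[OF Fsum[of x]] Mhs[of "2 * norm x / r"] bd]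
      by (simp add: D_def mult_ac)
  qed
  moreover have "((\<lambda>q. \<Sum>\<^sub>\<infinity>a\<in>A. f a q) has_derivative D) (at p)"
  proof (rule has_derivativeI_sandwich[of "r / 4"])
    show "0 < r / 4" "bounded_linear D" by (use r \<open>bounded_linear D\<close> in auto)
    show "((\<lambda>q. S * (8 * norm (q - p) / r\<^sup>2)) \<longlongrightarrow> 0) (at p)"
      using r by (auto intro!: tendsto_eq_intros)
    fix q assume q: "q \<noteq> p" "dist q p < r / 4"
    define v where "v = q - p"
    have v: "v \<noteq> 0" "norm v \<le> r / 4" "q = p + v"
      using q by (auto simp: v_def dist_norm)
    have inb: "q \<in> ball p r" "p \<in> ball p r"
      using q r by (auto simp: dist_commute)
    have "((\<lambda>a. f a q - f a p - F a v) has_sum ((\<Sum>\<^sub>\<infinity>a\<in>A. f a q) - (\<Sum>\<^sub>\<infinity>a\<in>A. f a p) - D v)) A"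
      using has_sum_add[OF has_sum_add[OF has_sum_infsum[OF fsum[OF inb(1)]]
            has_sum_cmult_right[OF has_sum_infsum[OF fsum[OF inb(2)]], of "- 1"]]
          has_sum_cmult_right[OF has_sum_infsum[OF Fsum[of v]], of "- 1"]]
      by (simp add: D_def)
    from norm_infsum_le[OF this Mhs[of "8 * (norm v)\<^sup>2 / r\<^sup>2"]]
    have "norm ((\<Sum>\<^sub>\<infinity>a\<in>A. f a q) - (\<Sum>\<^sub>\<infinity>a\<in>A. f a p) - D v) \<le> S * (8 * (norm v)\<^sup>2 / r\<^sup>2)"
      using est(1) v by auto
    then show "norm ((\<Sum>\<^sub>\<infinity>a\<in>A. f a q) - (\<Sum>\<^sub>\<infinity>a\<in>A. f a p) - D (q - p)) / norm (q - p)
        \<le> S * (8 * norm (q - p) / r\<^sup>2)"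
      using v r by (simp add: field_simps power2_eq_square flip: v_def)
  qed
  ultimately show ?thesis
    unfolding cfrechet_def using Dlin by blast
qed

lemma time_analytic_on_iff:
  "time_analytic_on F S \<longleftrightarrow> continuous_on S F \<and> (\<forall>\<tau> x. (\<tau>, x) \<in> S \<longrightarrow> cfrechet (\<lambda>\<tau>'. F (\<tau>', x)) \<tau>)"
  by (simp add: time_analytic_on_def cfrechet_def)

lemma time_analytic_on_const: "time_analytic_on (\<lambda>_. k) S"
  by (simp add: time_analytic_on_iff cfrechet_const)

lemma time_analytic_on_add:
  "time_analytic_on f S \<Longrightarrow> time_analytic_on g S \<Longrightarrow> time_analytic_on (\<lambda>C. f C + g C) S"
  by (auto simp: time_analytic_on_iff intro: continuous_on_add cfrechet_add)

lemma time_analytic_on_mult: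
  "time_analytic_on f S \<Longrightarrow> time_analytic_on g S \<Longrightarrow> time_analytic_on (\<lambda>C. f C * g C) S"
  by (auto simp: time_analytic_on_iff intro: continuous_on_mult cfrechet_mult)

lemma time_analytic_on_compose:
  assumes f: "time_analytic_on f S" and g: "g holomorphic_on T" "open T" "\<And>C. C \<in> S \<Longrightarrow> f C \<in> T"
  shows "time_analytic_on (\<lambda>C. g (f C)) S"
  unfolding time_analytic_on_iff
proof (intro conjI allI impI)
  show "continuous_on S (\<lambda>C. g (f C))"
    using f g by (intro continuous_on_compose2[OF holomorphic_on_imp_continuous_on[OF g(1)]])
      (auto simp: time_analytic_on_iff)
  fix \<tau> x assume "(\<tau>, x) \<in> S"
  then have *: "cfrechet (\<lambda>\<tau>'. f (\<tau>', x)) \<tau>" "f (\<tau>, x) \<in> T"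
    using f g by (auto simp: time_analytic_on_iff)
  show "cfrechet (\<lambda>\<tau>'. g (f (\<tau>', x))) \<tau>"
    by (rule cfrechet_compose[OF *(1) holomorphic_on_imp_differentiable_at[OF g(1,2) *(2)]])
qed

lemma time_analytic_on_compose_entire:
  "time_analytic_on f S \<Longrightarrow> g holomorphic_on UNIV \<Longrightarrow> time_analytic_on (\<lambda>C. g (f C)) S"
  by (rule time_analytic_on_compose) auto

lemma time_analytic_on_minus:
  assumes "time_analytic_on f S"
  shows "time_analytic_on (\<lambda>C. - f C) S"
  using time_analytic_on_compose_entire[OF assms, of uminus] by (simp add: holomorphic_on_minus)

lemma time_analytic_on_diff:
  assumes "time_analytic_on f S" "time_analytic_on g S"
  shows "time_analytic_on (\<lambda>C. f C - g C) S"
  using time_analytic_on_add[OF assms(1) time_analytic_on_minus[OF assms(2)]] by simp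

lemma time_analytic_on_divide:
  assumes "time_analytic_on f S" "time_analytic_on g S" "\<And>C. C \<in> S \<Longrightarrow> g C \<noteq> 0"
  shows "time_analytic_on (\<lambda>C. f C / g C) S"
proof -
  have "time_analytic_on (\<lambda>C. inverse (g C)) S"
    by (rule time_analytic_on_compose[OF assms(2), of inverse "- {0}"])
      (use assms in \<open>auto intro!: holomorphic_intros\<close>)
  from time_analytic_on_mult[OF assms(1) this] show ?thesis by (simp add: divide_inverse)
qed

lemma time_analytic_on_exp: "time_analytic_on f S \<Longrightarrow> time_analytic_on (\<lambda>C. exp (f C)) S"
  by (rule time_analytic_on_compose_entire) (auto intro: holomorphic_intros)

lemma open_not_nonpos_Reals: "open (- \<real>\<^sub>\<le>\<^sub>0 :: complex set)"
  by (simp add: open_Compl)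

lemma time_analytic_on_Ln:
  "time_analytic_on f S \<Longrightarrow> (\<And>C. C \<in> S \<Longrightarrow> f C \<notin> \<real>\<^sub>\<le>\<^sub>0) \<Longrightarrow> time_analytic_on (\<lambda>C. Ln (f C)) S"
  by (rule time_analytic_on_compose[of f S Ln "- \<real>\<^sub>\<le>\<^sub>0"])
    (auto intro!: holomorphic_on_Ln open_not_nonpos_Reals)

lemma time_analytic_on_csqrt:
  "time_analytic_on f S \<Longrightarrow> (\<And>C. C \<in> S \<Longrightarrow> f C \<notin> \<real>\<^sub>\<le>\<^sub>0) \<Longrightarrow> time_analytic_on (\<lambda>C. csqrt (f C)) S"
  by (rule time_analytic_on_compose[of f S csqrt "- \<real>\<^sub>\<le>\<^sub>0"])
    (auto intro!: holomorphic_on_csqrt open_not_nonpos_Reals)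

lemma time_analytic_on_subset: "time_analytic_on f S \<Longrightarrow> T \<subseteq> S \<Longrightarrow> time_analytic_on f T"
  by (auto simp: time_analytic_on_iff intro: continuous_on_subset)

lemma time_section_open: "open S \<Longrightarrow> open ((\<lambda>\<tau>. (\<tau>, x)) -` S)"
  by (intro open_vimage continuous_intros)

lemma time_analytic_on_cong:
  assumes "open S" "time_analytic_on f S" "\<And>C. C \<in> S \<Longrightarrow> f C = g C"
  shows "time_analytic_on g S"
  unfolding time_analytic_on_iff
proof (intro conjI allI impI)
  show "continuous_on S g"
    using assms(2,3) by (simp add: time_analytic_on_iff cong: continuous_on_cong)
  fix \<tau> x assume "(\<tau>, x) \<in> S"
  then show "cfrechet (\<lambda>\<tau>'. g (\<tau>', x)) \<tau>"
    using assms by (intro cfrechet_transform[of "\<lambda>\<tau>'. f (\<tau>', x)" \<tau> "(\<lambda>\<tau>. (\<tau>, x)) -` S" "\<lambda>\<tau>'. g (\<tau>', x)"])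
      (simp_all add: time_analytic_on_iff time_section_open)
qed

lemma time_analytic_on_local:
  assumes "\<And>C. C \<in> S \<Longrightarrow> \<exists>V. open V \<and> C \<in> V \<and> V \<subseteq> S \<and> time_analytic_on f V"
  shows "time_analytic_on f S"
  unfolding time_analytic_on_iff
proof (intro conjI allI impI)
  show "continuous_on S f"
    using assms by (intro continuous_at_imp_continuous_on)
      (metis continuous_on_eq_continuous_at time_analytic_on_iff)
  fix \<tau> x assume "(\<tau>, x) \<in> S"
  then show "cfrechet (\<lambda>\<tau>'. f (\<tau>', x)) \<tau>"
    using assms by (metis time_analytic_on_iff)
qed

lemma time_analytic_on_infsum:
  fixes f :: "'a \<Rightarrow> 'n::finite config \<Rightarrow> complex"
  assumes U: "open U" and f: "\<And>a. a \<in> A \<Longrightarrow> time_analytic_on (f a) U"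
    and bound: "\<And>C. C \<in> U \<Longrightarrow> \<exists>V M. open V \<and> C \<in> V \<and> V \<subseteq> U \<and> M summable_on A \<and> (\<forall>a\<in>A. \<forall>C'\<in>V. norm (f a C') \<le> M a)"
  shows "time_analytic_on (\<lambda>C. \<Sum>\<^sub>\<infinity>a\<in>A. f a C) U"
proof (rule time_analytic_on_local)
  fix C assume "C \<in> U"
  from bound[OF this] obtain V M where V: "open V" "C \<in> V" "V \<subseteq> U"
      and M: "M summable_on A" "\<forall>a\<in>A. \<forall>C'\<in>V. norm (f a C') \<le> M a"
    by (elim exE conjE)
  have fV: "time_analytic_on (f a) V" if "a \<in> A" for a
    using time_analytic_on_subset[OF f[OF that] V(3)] .
  have "continuous_on V (\<lambda>C. \<Sum>\<^sub>\<infinity>a\<in>A. f a C)"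
  proof (rule uniform_limit_theorem)
    show "uniform_limit V (\<lambda>X C. \<Sum>a\<in>X. f a C) (\<lambda>C. \<Sum>\<^sub>\<infinity>a\<in>A. f a C) (finite_subsets_at_top A)"
      by (rule Weierstrass_m_test_general[OF _ M(1)]) (use M(2) in auto)
    show "\<forall>\<^sub>F X in finite_subsets_at_top A. continuous_on V (\<lambda>C. \<Sum>a\<in>X. f a C)"
    proof (rule eventually_finite_subsets_at_top_weakI)
      fix X assume "finite X" "X \<subseteq> A"
      then show "continuous_on V (\<lambda>C. \<Sum>a\<in>X. f a C)"
        using fV by (intro continuous_on_sum) (auto simp: time_analytic_on_iff)
    qed
  qed simp
  moreover have "cfrechet (\<lambda>\<tau>'. \<Sum>\<^sub>\<infinity>a\<in>A. f a (\<tau>', x)) \<tau>" if inV: "(\<tau>, x) \<in> V" for \<tau> x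
  proof -
    have "open ((\<lambda>\<tau>. (\<tau>, x)) -` V)" "\<tau> \<in> (\<lambda>\<tau>. (\<tau>, x)) -` V"
      using V(1) inV by (auto intro: time_section_open)
    then obtain r where r: "r > 0" "ball \<tau> r \<subseteq> (\<lambda>\<tau>. (\<tau>, x)) -` V"
      by (rule openE)
    show ?thesis
      by (rule cfrechet_infsum[OF r(1) _ _ M(1)])
        (use r(2) fV M(2) in \<open>auto simp: time_analytic_on_iff subset_iff\<close>)
  qed
  ultimately show "\<exists>V. open V \<and> C \<in> V \<and> V \<subseteq> U \<and> time_analytic_on (\<lambda>C. \<Sum>\<^sub>\<infinity>a\<in>A. f a C) V"
    using V by (auto simp: time_analytic_on_iff)
qed

section \<open>Chebyshev polynomials and the symmetrised sum\<close>

fun chebyshev :: "nat \<Rightarrow> complex \<Rightarrow> complex" where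
  "chebyshev 0 x = 1"
| "chebyshev (Suc 0) x = x"
| "chebyshev (Suc (Suc n)) x = 2 * x * chebyshev (Suc n) x - chebyshev n x"

lemma chebyshev_cosh: "chebyshev n (cosh x) = cosh (of_nat n * x)"
proof (induction n rule: induct_nat_012)
  case (ge2 n)
  define y where "y = of_nat (Suc n) * x"
  have "of_nat (Suc (Suc n)) * x = y + x" "of_nat n * x = y - x"
    by (simp_all add: y_def algebra_simps)
  moreover have "chebyshev (Suc n) (cosh x) = cosh y"
    by (simp only: ge2 y_def)
  ultimately show ?case
    using ge2(1) by (simp add: cosh_add cosh_diff del: of_nat_Suc)
qed auto

lemma holomorphic_chebyshev: "chebyshev n holomorphic_on UNIV"
proof (induction n rule: induct_nat_012)
  case (ge2 n)
  then show ?case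
    by (simp cong: holomorphic_cong) (intro holomorphic_intros; simp)
qed (auto intro!: holomorphic_intros cong: holomorphic_cong)

context state_sum
begin

text \<open>A polynomial in the cosh, hence insensitive to which of the two roots is called \<open>z\<close>.\<close>

lemma monom_symmetrized:
  assumes "a \<in> A"
  shows "(monom \<mu> \<nu> a + monom \<nu> \<mu> a) / 2
    = of_real (c a) * (exp (of_real ((h a + hb a) / 2) * (\<mu> + \<nu>)) * chebyshev (nat \<bar>\<lfloor>h a - hb a\<rfloor>\<bar>) (cosh ((\<mu> - \<nu>) / 2)))"
proof -
  define x where "x = (\<mu> - \<nu>) / 2"
  define L where "L = (\<mu> + \<nu>) / 2"
  obtain m :: int where m: "h a - hb a = of_int m"
    using weights[OF assms] by (auto elim: Ints_cases)
  have "cosh (of_nat (nat \<bar>m\<bar>) * x) = cosh (of_int m * x)"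
    by (cases "m \<ge> 0") (simp_all add: cosh_minus)
  then have ch: "chebyshev (nat \<bar>m\<bar>) (cosh x) = (exp (of_int m * x) + exp (- (of_int m * x))) / 2"
    unfolding chebyshev_cosh by (simp add: cosh_def scaleR_conv_of_real)
  have \<mu>\<nu>: "\<mu> = L + x" "\<nu> = L - x" by (simp_all add: L_def x_def field_simps)
  have hh: "h a = hb a + of_int m" using m by simp
  have "of_real (h a) * \<mu> + of_real (hb a) * \<nu> = of_real (h a + hb a) * L + of_int m * x"
       "of_real (h a) * \<nu> + of_real (hb a) * \<mu> = of_real (h a + hb a) * L + - (of_int m * x)"
    unfolding \<mu>\<nu> hh by (simp_all add: algebra_simps)
  then have "monom \<mu> \<nu> a = of_real (c a) * (exp (of_real (h a + hb a) * L) * exp (of_int m * x))"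
    "monom \<nu> \<mu> a = of_real (c a) * (exp (of_real (h a + hb a) * L) * exp (- (of_int m * x)))"
    by (simp_all only: monom_def exp_add)
  moreover have "of_real ((h a + hb a) / 2) * (\<mu> + \<nu>) = of_real (h a + hb a) * L"
    by (simp add: L_def)
  ultimately show ?thesis
    using m by (simp only: ch x_def[symmetric] floor_of_int) (simp add: algebra_simps)
qed

text \<open>Nothing is asked of mu and nu as functions of the configuration, not even continuity. By
  \<open>psi_commute\<close> the sum equals its symmetrisation, whose terms depend on mu and nu only
  through \<open>L\<close> and \<open>k\<close> (\<open>monom_symmetrized\<close>), and these are
  analytic. The continuous negative bound \<open>M\<close> gives locally uniform
  convergence.\<close>

lemma psi_time_analytic:
  fixes G L k :: "'n::finite config \<Rightarrow> complex" and M :: "'n config \<Rightarrow> real"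
  assumes U: "open U" and L: "time_analytic_on L U" and k: "time_analytic_on k U"
    and M: "continuous_on U M" "\<And>C. C \<in> U \<Longrightarrow> M C < 0"
    and G: "\<And>C. C \<in> U \<Longrightarrow> \<exists>\<mu> \<nu>. L C = \<mu> + \<nu> \<and> k C = cosh ((\<mu> - \<nu>) / 2) \<and> Re \<mu> \<le> M C \<and> Re \<nu> \<le> M C \<and> G C = psi \<mu> \<nu>"
  shows "time_analytic_on G U"
proof -
  define f where "f a C = of_real (c a) * (exp (of_real ((h a + hb a) / 2) * L C) * chebyshev (nat \<bar>\<lfloor>h a - hb a\<rfloor>\<bar>) (k C))" for a C
  have f: "f a C = (monom \<mu> \<nu> a + monom \<nu> \<mu> a) / 2"
    if "a \<in> A" "L C = \<mu> + \<nu>" "k C = cosh ((\<mu> - \<nu>) / 2)" for a C \<mu> \<nu>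
    using monom_symmetrized[OF that(1), of \<mu> \<nu>] that by (simp add: f_def)
  have "time_analytic_on (\<lambda>C. \<Sum>\<^sub>\<infinity>a\<in>A. f a C) U"
  proof (rule time_analytic_on_infsum[OF U])
    show "time_analytic_on (f a) U" for a
      unfolding f_def
      by (intro time_analytic_on_mult time_analytic_on_const time_analytic_on_exp L
          time_analytic_on_compose_entire[OF k holomorphic_chebyshev])
    fix C assume C: "C \<in> U"
    define K where "K = M C / 2"
    have K: "K < 0" "M C < K" using M(2)[OF C] by (auto simp: K_def)
    have "norm (f a C') \<le> \<bar>c a\<bar> * exp ((h a + hb a) * K)" if a: "a \<in> A" and C': "C' \<in> U \<inter> M -` {..<K}" for a C'
    proof -
      obtain \<mu> \<nu> where *: "L C' = \<mu> + \<nu>" "k C' = cosh ((\<mu> - \<nu>) / 2)" "Re \<mu> \<le> M C'" "Re \<nu> \<le> M C'"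
        using G C' by blast
      have "norm (f a C') \<le> (norm (monom \<mu> \<nu> a) + norm (monom \<nu> \<mu> a)) / 2"
        unfolding f[OF a *(1,2)] by (simp add: norm_divide norm_triangle_ineq)
      also have "\<dots> \<le> \<bar>c a\<bar> * exp ((h a + hb a) * K)"
        using norm_monom_le[OF a, of \<mu> K \<nu>] norm_monom_le[OF a, of \<nu> K \<mu>] * C' by auto
      finally show ?thesis .
    qed
    moreover have "open (U \<inter> M -` {..<K})"
      by (rule continuous_open_preimage[OF M(1) U]) simp
    ultimately show "\<exists>V N. open V \<and> C \<in> V \<and> V \<subseteq> U \<and> N summable_on A \<and> (\<forall>a\<in>A. \<forall>C'\<in>V. norm (f a C') \<le> N a)"
      using C K summable[OF K(1)] by (intro exI[of _ "U \<inter> M -` {..<K}"] exI[of _ "\<lambda>a. \<bar>c a\<bar> * exp ((h a + hb a) * K)"]) auto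
  qed
  then show ?thesis
  proof (rule time_analytic_on_cong[OF U])
    fix C assume C: "C \<in> U"
    obtain \<mu> \<nu> where *: "L C = \<mu> + \<nu>" "k C = cosh ((\<mu> - \<nu>) / 2)" "Re \<mu> \<le> M C" "Re \<nu> \<le> M C" "G C = psi \<mu> \<nu>"
      using G C by blast
    have neg: "Re \<mu> < 0" "Re \<nu> < 0" using * M(2)[OF C] by auto
    have "((\<lambda>a. (monom \<mu> \<nu> a + monom \<nu> \<mu> a) / 2) has_sum ((psi \<mu> \<nu> + psi \<nu> \<mu>) / 2)) A"
      by (intro has_sum_divide_const has_sum_add monom_has_sum neg)
    also have "?this \<longleftrightarrow> ((\<lambda>a. f a C) has_sum ((psi \<mu> \<nu> + psi \<nu> \<mu>) / 2)) A"
      by (intro has_sum_cong) (simp add: f[OF _ *(1,2)])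
    finally show "(\<Sum>\<^sub>\<infinity>a\<in>A. f a C) = G C"
      using psi_commute[OF neg] by (simp add: *(5) infsumI)
  qed
qed

end

section \<open>Symmetric functions of the roots\<close>

lemma cross_roots_iff:
  "cross_roots C z zb \<longleftrightarrow> z + zb = 1 + cross_u C - cross_v C \<and> z * zb = cross_u C"
  unfolding cross_roots_def by (auto simp: algebra_simps)

lemma quadratic_roots_exist:
  fixes s p :: complex
  obtains z w where "z + w = s" "z * w = p"
proof
  define d where "d = csqrt (s\<^sup>2 - 4 * p)"
  have "d\<^sup>2 = s\<^sup>2 - 4 * p" by (simp add: d_def)
  then show "(s + d) / 2 + (s - d) / 2 = s" "(s + d) / 2 * ((s - d) / 2) = p"
    by (simp_all add: field_simps power2_eq_square)
qed

lemma cross_roots_exist: obtains z zb where "cross_roots C z zb"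
  unfolding cross_roots_iff by (metis quadratic_roots_exist)

lemma cross_roots_unique:
  assumes "cross_roots C z zb" "cross_roots C w wb"
  shows "(w, wb) = (z, zb) \<or> (w, wb) = (zb, z)"
proof -
  have "w + wb = z + zb" and p: "w * wb = z * zb"
    using assms by (simp_all add: cross_roots_iff)
  then have s: "wb = z + zb - w" by (simp add: eq_diff_eq add.commute)
  have "(w - z) * (w - zb) = 0"
    using p unfolding s by (simp add: algebra_simps)
  then show ?thesis using s by auto
qed

text \<open>The product (z - z0)(z - w0) equals the error of s times z, minus the error of p. The
  roots being bounded, it becomes small, so one factor is small; the second root then follows from
  the sum. Which factor is small is undetermined, hence the disjunction.\<close>

lemma eventually_roots_close:
  fixes s p :: "'a \<Rightarrow> complex"
  assumes s: "(s \<longlongrightarrow> z0 + w0) F" and p: "(p \<longlongrightarrow> z0 * w0) F" and e: "e > 0"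
  shows "\<forall>\<^sub>F c in F. \<forall>z w. z + w = s c \<and> z * w = p c \<longrightarrow>
    (dist z z0 < e \<and> dist w w0 < e) \<or> (dist z w0 < e \<and> dist w z0 < e)"
proof -
  \<comment> \<open>A root of modulus above 1 has modulus at most norm s + norm p, which is
    eventually below B - 1. So B bounds all roots near the limit.\<close>
  define B where "B = norm (z0 + w0) + norm (z0 * w0) + 2"
  have "((\<lambda>c. norm (s c) + norm (p c)) \<longlongrightarrow> norm (z0 + w0) + norm (z0 * w0)) F"
    by (intro tendsto_intros s p)
  then have 1: "\<forall>\<^sub>F c in F. norm (s c) + norm (p c) < B - 1"
    by (rule order_tendstoD) (simp add: B_def)
  have "((\<lambda>c. norm (s c - (z0 + w0)) * B + norm (p c - z0 * w0)) \<longlongrightarrow> 0) F"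
    by (auto intro!: tendsto_eq_intros s p)
  then have 2: "\<forall>\<^sub>F c in F. norm (s c - (z0 + w0)) * B + norm (p c - z0 * w0) < (e/2) * (e/2)"
    by (rule order_tendstoD) (use e in simp)
  have "((\<lambda>c. norm (s c - (z0 + w0))) \<longlongrightarrow> 0) F"
    by (auto intro!: tendsto_eq_intros s)
  then have 3: "\<forall>\<^sub>F c in F. norm (s c - (z0 + w0)) < e/2"
    by (rule order_tendstoD) (use e in simp)
  show ?thesis
    using 1 2 3
  proof (eventually_elim, intro allI impI)
    fix c z w
    assume 1: "norm (s c) + norm (p c) < B - 1"
      and 2: "norm (s c - (z0 + w0)) * B + norm (p c - z0 * w0) < (e/2) * (e/2)"
      and 3: "norm (s c - (z0 + w0)) < e/2" and zw: "z + w = s c \<and> z * w = p c"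
    have zB: "norm z \<le> B"
    proof (cases "norm z \<le> 1")
      case False
      have "z * z = s c * z - p c" using zw by (simp add: algebra_simps flip: zw[THEN conjunct1] zw[THEN conjunct2])
      then have "norm z * norm z \<le> norm (s c) * norm z + norm (p c)"
        by (metis norm_mult norm_triangle_ineq4)
      also have "\<dots> \<le> (norm (s c) + norm (p c)) * norm z"
        using False mult_left_mono[of 1 "norm z" "norm (p c)"] by (simp add: algebra_simps)
      finally have "norm z \<le> norm (s c) + norm (p c)"
        using False by (auto simp: mult_le_cancel_right)
      then show ?thesis using 1 by simp
    qed (simp add: B_def add_increasing)
    have eq: "(z - z0) * (z - w0) = (s c - (z0 + w0)) * z - (p c - z0 * w0)"
      using zw by (simp add: algebra_simps flip: zw[THEN conjunct1] zw[THEN conjunct2])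
    have "norm (z - z0) * norm (z - w0) \<le> norm (s c - (z0 + w0)) * norm z + norm (p c - z0 * w0)"
      unfolding norm_mult[symmetric] eq by (metis norm_triangle_ineq4)
    also have "\<dots> \<le> norm (s c - (z0 + w0)) * B + norm (p c - z0 * w0)"
      using zB by (intro add_mono mult_left_mono) auto
    finally have "norm (z - z0) * norm (z - w0) < (e/2) * (e/2)"
      using 2 by simp
    then consider "norm (z - z0) < e/2" | "norm (z - w0) < e/2"
      by (meson e half_gt_zero less_imp_le linorder_not_less mult_mono norm_ge_zero)
    then show "(dist z z0 < e \<and> dist w w0 < e) \<or> (dist z w0 < e \<and> dist w z0 < e)"
    proof cases
      case 1
      have "w - w0 = (s c - (z0 + w0)) - (z - z0)" using zw by (auto simp: algebra_simps)
      then have "norm (w - w0) \<le> norm (s c - (z0 + w0)) + norm (z - z0)"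
        by (metis norm_triangle_ineq4)
      then have "norm (w - w0) < e"
        using 1 3 by simp
      then show ?thesis using 1 e by (simp add: dist_norm)
    next
      case 2
      have "w - z0 = (s c - (z0 + w0)) - (z - w0)" using zw by (auto simp: algebra_simps)
      then have "norm (w - z0) \<le> norm (s c - (z0 + w0)) + norm (z - w0)"
        by (metis norm_triangle_ineq4)
      then have "norm (w - z0) < e"
        using 2 3 by simp
      then show ?thesis using 2 e by (simp add: dist_norm)
    qed
  qed
qed

text \<open>The roots themselves are only continuous as an unordered pair.\<close>

lemma continuous_on_symmetric_roots:
  fixes g :: "'n::finite config \<Rightarrow> 'b::metric_space"
  assumes uv: "continuous_on X cross_u" "continuous_on X cross_v"
    and f: "continuous_on (D \<times> D) (\<lambda>(z, w). f z w)"
    and g: "\<And>C z w. C \<in> X \<Longrightarrow> cross_roots C z w \<Longrightarrow> z \<in> D \<and> w \<in> D \<and> g C = f z w"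
  shows "continuous_on X g"
  unfolding continuous_on_def
proof (intro ballI tendstoI)
  fix C and e :: real assume C: "C \<in> X" and e: "e > 0"
  obtain z0 w0 where r: "cross_roots C z0 w0" by (rule cross_roots_exist)
  note g0 = g[OF C r] g[OF C cross_roots_swap[OF r]]
  have "\<exists>d>0. \<forall>y\<in>D \<times> D. dist y (z0, w0) < d \<longrightarrow> dist (f (fst y) (snd y)) (g C) < e"
    using f g0 e unfolding continuous_on_iff case_prod_beta by (metis fst_conv mem_Sigma_iff snd_conv)
  then obtain d1 where d1: "d1 > 0" "\<And>z w. z \<in> D \<Longrightarrow> w \<in> D \<Longrightarrow> dist (z, w) (z0, w0) < d1 \<Longrightarrow> dist (f z w) (g C) < e"
    by fastforce
  have "\<exists>d>0. \<forall>y\<in>D \<times> D. dist y (w0, z0) < d \<longrightarrow> dist (f (fst y) (snd y)) (g C) < e"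
    using f g0 e unfolding continuous_on_iff case_prod_beta by (metis fst_conv mem_Sigma_iff snd_conv)
  then obtain d2 where d2: "d2 > 0" "\<And>z w. z \<in> D \<Longrightarrow> w \<in> D \<Longrightarrow> dist (z, w) (w0, z0) < d2 \<Longrightarrow> dist (f z w) (g C) < e"
    by fastforce
  define d where "d = min d1 d2 / 2"
  have d: "d > 0" using d1 d2 by (simp add: d_def)
  have close: "dist (z, w) (a, b) < min d1 d2" if "dist z a < d" "dist w b < d" for z w a b :: complex
    using norm_Pair_le[of "z - a" "w - b"] that by (simp add: dist_norm d_def)
  have "(cross_u \<longlongrightarrow> z0 * w0) (at C within X)"
    using uv(1) C r unfolding continuous_on_def by (metis cross_roots_iff)
  moreover have "((\<lambda>C. 1 + cross_u C - cross_v C) \<longlongrightarrow> 1 + cross_u C - cross_v C) (at C within X)"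
    using uv C unfolding continuous_on_def by (intro tendsto_intros) auto
  then have "((\<lambda>C. 1 + cross_u C - cross_v C) \<longlongrightarrow> z0 + w0) (at C within X)"
    using r by (simp add: cross_roots_iff)
  ultimately have "\<forall>\<^sub>F C' in at C within X. \<forall>z w. z + w = 1 + cross_u C' - cross_v C' \<and> z * w = cross_u C' \<longrightarrow>
    (dist z z0 < d \<and> dist w w0 < d) \<or> (dist z w0 < d \<and> dist w z0 < d)"
    using d by (intro eventually_roots_close)
  moreover have "\<forall>\<^sub>F C' in at C within X. C' \<in> X"
    by (simp add: eventually_at_topological) blast
  ultimately show "\<forall>\<^sub>F C' in at C within X. dist (g C') (g C) < e"
  proof eventually_elim
    case (elim C')
    obtain z w where r': "cross_roots C' z w" by (rule cross_roots_exist)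
    from elim(1)[rule_format, of z w] r'
    have "dist (z, w) (z0, w0) < min d1 d2 \<or> dist (z, w) (w0, z0) < min d1 d2"
      using close by (auto simp: cross_roots_iff)
    then show ?case
      using d1(2)[of z w] d2(2)[of z w] g[OF elim(2) r'] by auto
  qed
qed

lemma eventually_roots_in:
  fixes C0 :: "'n::finite config"
  assumes uv: "isCont cross_u C0" "isCont cross_v C0"
    and D: "open D" and r: "\<And>z w. cross_roots C0 z w \<Longrightarrow> z \<in> D"
  shows "\<forall>\<^sub>F C in nhds C0. \<forall>z w. cross_roots C z w \<longrightarrow> z \<in> D"
proof -
  obtain z0 w0 where r0: "cross_roots C0 z0 w0" by (rule cross_roots_exist)
  have "z0 \<in> D" "w0 \<in> D" using r[OF r0] r[OF cross_roots_swap[OF r0]] by auto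
  then obtain e1 e2 where e: "e1 > 0" "ball z0 e1 \<subseteq> D" "e2 > 0" "ball w0 e2 \<subseteq> D"
    using D by (meson openE)
  have t: "(cross_u \<longlongrightarrow> cross_u C0) (nhds C0)" "(cross_v \<longlongrightarrow> cross_v C0) (nhds C0)"
    using uv by (auto simp: isCont_def tendsto_nhds_iff)
  have "\<forall>\<^sub>F C in nhds C0. \<forall>z w. z + w = 1 + cross_u C - cross_v C \<and> z * w = cross_u C \<longrightarrow>
    (dist z z0 < min e1 e2 \<and> dist w w0 < min e1 e2) \<or> (dist z w0 < min e1 e2 \<and> dist w z0 < min e1 e2)"
    by (rule eventually_roots_close)
      (use t e r0 in \<open>auto intro!: tendsto_intros simp: cross_roots_iff\<close>)
  then show ?thesis
  proof eventually_elim
    case (elim C)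
    then show ?case
      using e(2,4) unfolding cross_roots_iff by (auto simp: subset_iff dist_commute)
  qed
qed

lemma x2_time_analytic:
  fixes S :: "'n::finite config set"
  shows "time_analytic_on (\<lambda>C. x2 C i j) S"
  unfolding time_analytic_on_iff
proof (intro conjI allI impI)
  show "continuous_on S (\<lambda>C. x2 C i j)"
    unfolding x2_def by (intro continuous_intros)
  fix \<tau> :: "complex ^ 4" and x :: "(real ^ 'n) ^ 4"
  have "cfrechet (\<lambda>\<tau>'. (\<tau>' $ i + - 1 * \<tau>' $ j) * (\<tau>' $ i + - 1 * \<tau>' $ j) + of_real ((norm (x $ i - x $ j))\<^sup>2)) \<tau>"
    by (intro cfrechet_add cfrechet_mult cfrechet_nth cfrechet_const)
  then show "cfrechet (\<lambda>\<tau>'. x2 (\<tau>', x) i j) \<tau>"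
    by (simp add: x2_def power2_eq_square)
qed

lemma continuous_on_x2: "continuous_on S (\<lambda>C. x2 C i j)"
  using x2_time_analytic time_analytic_on_iff by blast

lemma cross_ratios_time_analytic:
  assumes "\<And>C. C \<in> S \<Longrightarrow> x2 C 1 3 \<noteq> 0" "\<And>C. C \<in> S \<Longrightarrow> x2 C 2 4 \<noteq> 0"
  shows "time_analytic_on cross_u S" "time_analytic_on cross_v S"
  unfolding cross_u_def[abs_def] cross_v_def[abs_def]
  by (intro time_analytic_on_divide time_analytic_on_mult x2_time_analytic; use assms in simp)+

lemma isCont_cross_ratios:
  assumes "x2 C 1 3 \<noteq> 0" "x2 C 2 4 \<noteq> 0"
  shows "isCont cross_u C" "isCont cross_v C"
proof -
  define Q where "Q = ((\<lambda>C. x2 C 1 3) -` (- {0}) \<inter> (\<lambda>C. x2 C 2 4) -` (- {0 :: complex}) :: 'a config set)"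
  have "open Q"
    unfolding Q_def by (intro open_Int open_vimage continuous_on_x2) auto
  moreover have "C \<in> Q" using assms by (simp add: Q_def)
  moreover have "continuous_on Q cross_u" "continuous_on Q cross_v"
    using cross_ratios_time_analytic[of Q] by (auto simp: Q_def time_analytic_on_iff)
  ultimately show "isCont cross_u C" "isCont cross_v C"
    by (auto simp: continuous_on_eq_continuous_at)
qed

section \<open>The map rho off the cut\<close>

lemma nonpos_Reals_square: "w\<^sup>2 \<in> \<real>\<^sub>\<le>\<^sub>0 \<Longrightarrow> Re w = 0"
  by (auto simp: complex_nonpos_Reals_iff Re_power2 Im_power2)

lemma slit_iff: "z \<notin> complex_of_real ` {1..} \<longleftrightarrow> 1 - z \<notin> \<real>\<^sub>\<le>\<^sub>0"
  by (auto simp: complex_slot_right_eq complex_nonpos_Reals_iff)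

lemma Re_csqrt_pos:
  assumes "w \<notin> \<real>\<^sub>\<le>\<^sub>0"
  shows "0 < Re (csqrt w)"
proof -
  have "Re (csqrt w) \<noteq> 0"
  proof
    assume "Re (csqrt w) = 0"
    then have "(csqrt w)\<^sup>2 \<in> \<real>\<^sub>\<le>\<^sub>0"
      unfolding complex_nonpos_Reals_iff Re_power2 Im_power2 by simp
    then show False using assms by (simp only: power2_csqrt)
  qed
  then show ?thesis using csqrt_principal[of w] by linarith
qed

lemma one_plus_csqrt_slit: "1 + csqrt w \<notin> \<real>\<^sub>\<le>\<^sub>0"
proof -
  have "0 \<le> Re y" if "y = csqrt w" for y using csqrt_principal[of w] that by auto
  then have "1 + y \<notin> \<real>\<^sub>\<le>\<^sub>0" if "y = csqrt w" for y
    using that by (fastforce simp: complex_nonpos_Reals_iff simp del: csqrt.sel)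
  then show ?thesis by blast
qed

lemma one_plus_csqrt_nonzero: "1 + csqrt w \<noteq> 0"
  using one_plus_csqrt_slit[of w] by auto

text \<open>With y = csqrt (1 - z) one has z = (1 - y)(1 + y). The new denominator never vanishes,
  so continuity at 0 and a logarithm of rho can be read off.\<close>

lemma rho_eq: "rho z = z / (1 + csqrt (1 - z))\<^sup>2"
proof -
  define y where "y = csqrt (1 - z)"
  have z: "z = (1 - y) * (1 + y)" by (simp add: y_def algebra_simps flip: power2_eq_square)
  have y: "1 + y \<noteq> 0" unfolding y_def by (rule one_plus_csqrt_nonzero)
  show ?thesis
  proof (cases "z = 0")
    case False
    have "(1 - y)\<^sup>2 * (1 + y)\<^sup>2 = z * z" by (simp add: z power2_eq_square algebra_simps)
    then show ?thesis
      using False y unfolding rho_def y_def[symmetric] by (simp add: frac_eq_eq)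
  qed (simp add: rho_def)
qed

lemma rho_eq': "rho z = (1 - csqrt (1 - z)) / (1 + csqrt (1 - z))"
proof -
  define y where "y = csqrt (1 - z)"
  have z: "z = (1 - y) * (1 + y)" by (simp add: y_def algebra_simps flip: power2_eq_square)
  have "1 + y \<noteq> 0" unfolding y_def by (rule one_plus_csqrt_nonzero)
  then show ?thesis
    unfolding rho_eq y_def[symmetric] by (simp add: z power2_eq_square)
qed

text \<open>In terms of y = csqrt (1 - z), rho is the Cayley transform (1 - y) / (1 + y), which maps
  Re y > 0 into the unit disc.\<close>

lemma norm_rho_less_1:
  assumes "z \<notin> complex_of_real ` {1..}"
  shows "norm (rho z) < 1"
proof -
  define y where "y = csqrt (1 - z)"
  have "Re y > 0" using assms Re_csqrt_pos[of "1 - z"] by (simp add: slit_iff y_def)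
  then have "(norm (1 - y))\<^sup>2 < (norm (1 + y))\<^sup>2"
    unfolding cmod_power2 by (simp add: power2_eq_square algebra_simps)
  then have "norm (1 - y) < norm (1 + y)" by (rule power2_less_imp_less) simp
  then show ?thesis
    unfolding rho_eq' y_def[symmetric] by (simp add: norm_divide divide_less_eq)
qed

lemma rho_nonzero: "z \<noteq> 0 \<Longrightarrow> rho z \<noteq> 0"
  by (simp add: rho_eq one_plus_csqrt_nonzero)

lemma continuous_on_csqrt_slit: "continuous_on (- complex_of_real ` {1..}) (\<lambda>z. csqrt (1 - z))"
  by (rule continuous_on_compose2[OF continuous_on_csqrt]) (auto intro!: continuous_intros simp: slit_iff)

lemma continuous_on_rho: "continuous_on (- complex_of_real ` {1..}) rho"
  unfolding rho_eq[abs_def]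
  by (intro continuous_intros continuous_on_csqrt_slit) (simp add: one_plus_csqrt_nonzero)

lemma open_slit: "open (- complex_of_real ` {1..})"
  by (intro open_Compl closed_injective_linear_image) (auto intro: linear_of_real inj_of_real)

lemma exp_log_rho_rhob:
  assumes l: "exp (l 1 2) = x2 C 1 2" "exp (l 3 4) = x2 C 3 4" "exp (l 1 3) = x2 C 1 3" "exp (l 2 4) = x2 C 2 4"
    and r: "cross_roots C z zb"
  shows "exp (log_rho_rhob l z zb) = rho z * rho zb"
proof -
  define A where "A = l 1 2 + l 3 4 - l 1 3 - l 2 4"
  have "exp A = cross_u C"
    by (simp add: A_def exp_diff exp_add l cross_u_def)
  also have "\<dots> = z * zb" using r by (simp add: cross_roots_def)
  finally have u: "exp A = z * zb" .
  have e: "exp (2 * Ln (1 + csqrt w)) = (1 + csqrt w)\<^sup>2" for w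
    unfolding exp_double by (simp add: one_plus_csqrt_nonzero)
  show ?thesis
    unfolding log_rho_rhob_def A_def[symmetric] by (simp only: exp_diff u e rho_eq) simp
qed

lemma log_rho_rhob_swap: "log_rho_rhob l z zb = log_rho_rhob l zb z"
  by (simp add: log_rho_rhob_def)

lemma Ln_add_of_Re_pos:
  assumes "Re a > 0" "Re b > 0"
  shows "Ln a + Ln b = Ln (a * b)"
proof -
  have "\<bar>Im (Ln a)\<bar> < pi / 2" "\<bar>Im (Ln b)\<bar> < pi / 2"
    using assms Re_Ln_pos_lt_imp by auto
  then have "Im (Ln a + Ln b) < pi" "- pi < Im (Ln a + Ln b)" by auto
  then show ?thesis
    using assms by (subst Ln_times) auto
qed

text \<open>The logarithms \<open>l\<close> need not be principal. The same argument thus serves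
  \<open>DD\<close>, where they are, and full neighbourhoods of Lorentzian configurations, where
  they continue the principal ones.\<close>

locale channel_region =
  fixes U :: "'n::finite config set" and l :: "4 \<Rightarrow> 4 \<Rightarrow> 'n config \<Rightarrow> complex"
  assumes open_U: "open U"
    and exp_l: "\<And>C i j. C \<in> U \<Longrightarrow> i \<noteq> j \<Longrightarrow> exp (l i j C) = x2 C i j"
    and l_analytic: "\<And>i j. i \<noteq> j \<Longrightarrow> time_analytic_on (l i j) U"
    and slit: "\<And>C z zb. C \<in> U \<Longrightarrow> cross_roots C z zb \<Longrightarrow> z \<notin> complex_of_real ` {1..}"
begin

lemma x2_nz: "C \<in> U \<Longrightarrow> i \<noteq> j \<Longrightarrow> x2 C i j \<noteq> 0"
  using exp_l by (metis exp_not_eq_zero)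

lemma roots_nz:
  assumes "C \<in> U" "cross_roots C z zb" shows "z \<noteq> 0"
  using assms x2_nz[OF assms(1)] by (auto simp: cross_roots_def cross_u_def)

lemma u_analytic: "time_analytic_on cross_u U" and v_analytic: "time_analytic_on cross_v U"
  by (rule cross_ratios_time_analytic; simp add: x2_nz)+

text \<open>An arbitrary labelling of the roots, with no continuity claimed. Every function proved
  analytic in this locale has a value that does not depend on the labelling.\<close>

definition z1 :: "'n config \<Rightarrow> complex" where "z1 C = fst (SOME p. cross_roots C (fst p) (snd p))"
definition z2 :: "'n config \<Rightarrow> complex" where "z2 C = snd (SOME p. cross_roots C (fst p) (snd p))"

lemma z12: "cross_roots C (z1 C) (z2 C)"
  unfolding z1_def z2_def
  by (rule someI_ex[of "\<lambda>p. cross_roots C (fst p) (snd p)"]) (metis cross_roots_exist fst_conv snd_conv)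

lemma symmetric_continuous:
  fixes f :: "complex \<Rightarrow> complex \<Rightarrow> 'b::metric_space"
  assumes f: "continuous_on ((- complex_of_real ` {1..} - {0}) \<times> (- complex_of_real ` {1..} - {0})) (\<lambda>(z, w). f z w)"
    and sym: "\<And>z w. f z w = f w z"
  shows "continuous_on U (\<lambda>C. f (z1 C) (z2 C))"
proof (rule continuous_on_symmetric_roots[OF _ _ f])
  show "continuous_on U cross_u" "continuous_on U cross_v"
    using u_analytic v_analytic by (auto simp: time_analytic_on_iff)
  fix C z w assume C: "C \<in> U" and r: "cross_roots C z w"
  show "z \<in> - complex_of_real ` {1..} - {0} \<and> w \<in> - complex_of_real ` {1..} - {0} \<and> f (z1 C) (z2 C) = f z w"
    using slit[OF C r] slit[OF C cross_roots_swap[OF r]] roots_nz[OF C r] roots_nz[OF C cross_roots_swap[OF r]]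
      cross_roots_unique[OF z12 r] sym by auto
qed

definition y1 :: "'n config \<Rightarrow> complex" where "y1 C = csqrt (1 - z1 C)"
definition y2 :: "'n config \<Rightarrow> complex" where "y2 C = csqrt (1 - z2 C)"

lemma Re_y: "C \<in> U \<Longrightarrow> Re (y1 C) > 0" "C \<in> U \<Longrightarrow> Re (y2 C) > 0"
  unfolding y1_def y2_def
  by (rule Re_csqrt_pos, rule slit_iff[THEN iffD1], erule slit, rule z12)
    (rule Re_csqrt_pos, rule slit_iff[THEN iffD1], erule slit, rule cross_roots_swap[OF z12])

lemma y_product_square: "(y1 C * y2 C)\<^sup>2 = cross_v C"
  using z12[of C] by (simp add: y1_def y2_def power_mult_distrib cross_roots_def)

text \<open>
  The single square roots branch where \<open>z = zb\<close>.  Their product and their sum do not: they are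
  continuous, and their squares are analytic and nonvanishing.
\<close>

lemma y_product_analytic: "time_analytic_on (\<lambda>C. y1 C * y2 C) U"
proof (rule time_analytic_on_local)
  fix C0 assume C0: "C0 \<in> U"
  define c where "c = y1 C0 * y2 C0"
  have c: "c \<noteq> 0" using Re_y[OF C0] by (auto simp: c_def)
  have "continuous_on U (\<lambda>C. csqrt (1 - z1 C) * csqrt (1 - z2 C))"
    by (rule symmetric_continuous[of "\<lambda>z w. csqrt (1 - z) * csqrt (1 - w)"])
      (auto simp: case_prod_beta slit_iff mult.commute intro!: continuous_intros
         continuous_on_compose2[OF continuous_on_csqrt_slit])
  then have cont: "continuous_on U (\<lambda>C. y1 C * y2 C)" by (simp add: y1_def y2_def)
  \<comment> \<open>On V the quotient of the product by its value c at C0 has positive real part, so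
    it is the principal square root of its own square, which is analytic.\<close>
  define V where "V = U \<inter> (\<lambda>C. Re (y1 C * y2 C / c)) -` {0<..}"
  have V: "open V" "C0 \<in> V" "V \<subseteq> U"
    unfolding V_def using cont c C0
    by (auto intro!: continuous_open_preimage open_U continuous_intros simp flip: c_def)
  have sq: "(y1 C * y2 C / c)\<^sup>2 = cross_v C / c\<^sup>2" for C
    by (simp add: power_divide y_product_square)
  have pos: "Re (y1 C * y2 C / c) > 0" if "C \<in> V" for C
    using that by (simp add: V_def)
  have "time_analytic_on (\<lambda>C. csqrt (cross_v C / c\<^sup>2)) V"
  proof (rule time_analytic_on_csqrt)
    show "time_analytic_on (\<lambda>C. cross_v C / c\<^sup>2) V"
      by (intro time_analytic_on_divide time_analytic_on_const time_analytic_on_subset[OF v_analytic V(3)]) (simp add: c)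
    show "cross_v C / c\<^sup>2 \<notin> \<real>\<^sub>\<le>\<^sub>0" if "C \<in> V" for C
      using pos[OF that] nonpos_Reals_square[of "y1 C * y2 C / c"] sq by auto
  qed
  then have "time_analytic_on (\<lambda>C. c * csqrt (cross_v C / c\<^sup>2)) V"
    by (intro time_analytic_on_mult time_analytic_on_const)
  then have "time_analytic_on (\<lambda>C. y1 C * y2 C) V"
  proof (rule time_analytic_on_cong[OF V(1)])
    fix C assume "C \<in> V"
    then have "csqrt (cross_v C / c\<^sup>2) = y1 C * y2 C / c"
      unfolding sq[symmetric] by (intro csqrt_square) (auto dest: pos)
    then show "c * csqrt (cross_v C / c\<^sup>2) = y1 C * y2 C" using c by simp
  qed
  then show "\<exists>V. open V \<and> C0 \<in> V \<and> V \<subseteq> U \<and> time_analytic_on (\<lambda>C. y1 C * y2 C) V"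
    using V by blast
qed

lemma y_sum_analytic: "time_analytic_on (\<lambda>C. y1 C + y2 C) U"
proof -
  have sq: "(y1 C + y2 C)\<^sup>2 = 1 - cross_u C + cross_v C + 2 * (y1 C * y2 C)" for C
  proof -
    have "(y1 C + y2 C)\<^sup>2 = (y1 C)\<^sup>2 + (y2 C)\<^sup>2 + 2 * (y1 C * y2 C)"
      by (simp add: power2_sum)
    also have "(y1 C)\<^sup>2 + (y2 C)\<^sup>2 = 1 - cross_u C + cross_v C"
      using z12[of C] by (simp add: y1_def y2_def cross_roots_iff algebra_simps)
    finally show ?thesis .
  qed
  \<comment> \<open>Unlike the product, the sum has positive real part on all of U, so no
    localisation is required.\<close>
  have "time_analytic_on (\<lambda>C. csqrt (1 - cross_u C + cross_v C + 2 * (y1 C * y2 C))) U"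
    by (intro time_analytic_on_csqrt time_analytic_on_add time_analytic_on_diff time_analytic_on_mult[of "\<lambda>_. 2"]
        time_analytic_on_const u_analytic v_analytic y_product_analytic)
      (use nonpos_Reals_square Re_y in \<open>fastforce simp flip: sq\<close>)
  then show ?thesis
    by (rule time_analytic_on_cong[OF open_U])
      (use Re_y in \<open>auto simp flip: sq intro!: csqrt_square add_pos_pos\<close>)
qed

definition L :: "'n config \<Rightarrow> complex" where
  "L C = log_rho_rhob (\<lambda>i j. l i j C) (z1 C) (z2 C)"

lemma one_plus_y: "(1 + y1 C) * (1 + y2 C) = 1 + (y1 C + y2 C) + y1 C * y2 C"
  by (simp add: algebra_simps)

text \<open>Two numbers with positive real part have arguments below pi / 2 in modulus, so their
  principal logarithms add up to that of the product, and the product (1 + y1)(1 + y2) involves only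
  the sum and the product of the square roots.\<close>

lemma L_eq:
  assumes "C \<in> U"
  shows "L C = (l 1 2 C + l 3 4 C - l 1 3 C - l 2 4 C) - 2 * Ln (1 + (y1 C + y2 C) + y1 C * y2 C)"
proof -
  have "Ln (1 + y1 C) + Ln (1 + y2 C) = Ln (1 + (y1 C + y2 C) + y1 C * y2 C)"
    unfolding one_plus_y[symmetric]
    by (rule Ln_add_of_Re_pos) (use Re_y[OF assms] in auto)
  then show ?thesis
    unfolding L_def log_rho_rhob_def y1_def[symmetric] y2_def[symmetric]
    by (simp add: algebra_simps flip: distrib_left)
qed

lemma one_plus_y_slit:
  assumes "C \<in> U"
  shows "1 + (y1 C + y2 C) + y1 C * y2 C \<notin> \<real>\<^sub>\<le>\<^sub>0"
proof
  assume *: "1 + (y1 C + y2 C) + y1 C * y2 C \<in> \<real>\<^sub>\<le>\<^sub>0"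
  have r: "Re (1 + y1 C) > 0" "Re (1 + y2 C) > 0" using Re_y[OF assms] by auto
  have "\<bar>Im (Ln (1 + y1 C))\<bar> < pi / 2" "\<bar>Im (Ln (1 + y2 C))\<bar> < pi / 2"
    using r Re_Ln_pos_lt_imp by auto
  then have "Im (Ln ((1 + y1 C) * (1 + y2 C))) < pi"
    unfolding Ln_add_of_Re_pos[OF r, symmetric] by auto
  moreover have "(1 + y1 C) * (1 + y2 C) \<noteq> 0"
    using r by (metis mult_eq_0_iff less_irrefl zero_complex.sel(1))
  ultimately show False
    using * unfolding one_plus_y[symmetric] by (metis Im_Ln_eq_pi complex_nonpos_Reals_iff less_irrefl
      complex_eq_iff zero_complex.sel order_le_less)
qed

lemma L_analytic: "time_analytic_on L U"
proof (rule time_analytic_on_cong[OF open_U])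
  show "time_analytic_on (\<lambda>C. (l 1 2 C + l 3 4 C - l 1 3 C - l 2 4 C) - 2 * Ln (1 + (y1 C + y2 C) + y1 C * y2 C)) U"
    by (intro time_analytic_on_diff time_analytic_on_add time_analytic_on_mult[of "\<lambda>_. 2"] time_analytic_on_const
        time_analytic_on_Ln l_analytic y_sum_analytic y_product_analytic one_plus_y_slit; simp)
qed (simp add: L_eq)

lemma exp_L: "C \<in> U \<Longrightarrow> exp (L C) = rho (z1 C) * rho (z2 C)"
  unfolding L_def by (intro exp_log_rho_rhob[OF _ _ _ _ z12] exp_l) auto

text \<open>This is cosh ((mu - nu) / 2) = (exp mu + exp nu) / 2 * exp (- (mu + nu) / 2) with exp
  mu, exp nu the two values of rho. Their half sum has been rewritten through y1 + y2 and y1 y2, so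
  analyticity is visible.\<close>

definition kap :: "'n config \<Rightarrow> complex" where
  "kap C = (1 - y1 C * y2 C) / (1 + (y1 C + y2 C) + y1 C * y2 C) * exp (- L C / 2)"

lemma kap_analytic: "time_analytic_on kap U"
  unfolding kap_def[abs_def]
  by (intro time_analytic_on_mult time_analytic_on_divide time_analytic_on_diff time_analytic_on_add time_analytic_on_exp
      time_analytic_on_minus time_analytic_on_const L_analytic y_sum_analytic y_product_analytic)
    (use one_plus_y_slit in fastforce)+

lemma kap_eq:
  assumes C: "C \<in> U"
  shows "kap C = (rho (z1 C) + rho (z2 C)) / 2 * exp (- L C / 2)"
proof -
  define a b where ab: "a = 1 + y1 C" "b = 1 + y2 C"
  have "a \<noteq> 0" "b \<noteq> 0" and y: "y1 C = a - 1" "y2 C = b - 1"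
    by (simp_all add: ab y1_def y2_def one_plus_csqrt_nonzero)
  then have "(rho (z1 C) + rho (z2 C)) / 2 = (1 - y1 C * y2 C) / ((1 + y1 C) * (1 + y2 C))"
    unfolding rho_eq' y1_def[symmetric] y2_def[symmetric]
    unfolding y by (simp add: field_simps)
  then show ?thesis unfolding kap_def one_plus_y by (simp only:)
qed

definition M :: "'n config \<Rightarrow> real" where
  "M C = max (ln (norm (rho (z1 C)))) (ln (norm (rho (z2 C))))"

lemma M_continuous: "continuous_on U M"
  unfolding M_def[abs_def]
proof (rule symmetric_continuous[of "\<lambda>z w. max (ln (norm (rho z))) (ln (norm (rho w)))"])
  have "continuous_on (- complex_of_real ` {1..} - {0}) (\<lambda>z. ln (norm (rho z)))"
    by (intro continuous_intros continuous_on_subset[OF continuous_on_rho]) (auto simp: rho_nonzero)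
  then show "continuous_on ((- complex_of_real ` {1..} - {0}) \<times> (- complex_of_real ` {1..} - {0}))
     (\<lambda>(z, w). max (ln (norm (rho z))) (ln (norm (rho w))))"
    unfolding case_prod_beta
    by (intro continuous_on_max; rule continuous_on_compose2[where f = fst] continuous_on_compose2[where f = snd];
        (auto intro!: continuous_intros)?)
qed (simp add: max.commute)

lemma rho_facts:
  assumes C: "C \<in> U"
  shows "rho (z1 C) \<noteq> 0" "rho (z2 C) \<noteq> 0" "norm (rho (z1 C)) < 1" "norm (rho (z2 C)) < 1"
  using roots_nz[OF C z12] roots_nz[OF C cross_roots_swap[OF z12]]
    slit[OF C z12] slit[OF C cross_roots_swap[OF z12]]
  by (auto simp: rho_nonzero norm_rho_less_1)

lemma M_neg: "C \<in> U \<Longrightarrow> M C < 0"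
  using rho_facts by (simp add: M_def ln_less_zero_iff)

lemma series_analytic:
  assumes "state_sum A c h hb"
    and G: "\<And>C. C \<in> U \<Longrightarrow> G C = state_sum.psi A c h hb (Ln (rho (z1 C))) (L C - Ln (rho (z1 C)))"
  shows "time_analytic_on G U"
proof -
  interpret state_sum A c h hb by fact
  show ?thesis
  proof (rule psi_time_analytic[OF open_U L_analytic kap_analytic M_continuous M_neg])
    fix C assume C: "C \<in> U"
    define \<mu> \<nu> where "\<mu> = Ln (rho (z1 C))" and "\<nu> = L C - \<mu>"
    note \<rho> = rho_facts[OF C]
    have e: "exp \<mu> = rho (z1 C)" "exp \<nu> = rho (z2 C)"
      using \<rho> by (auto simp: \<mu>_def \<nu>_def exp_diff exp_L[OF C])
    have "(\<mu> - \<nu>) / 2 = \<mu> + - L C / 2" "- ((\<mu> - \<nu>) / 2) = \<nu> + - L C / 2"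
      by (simp_all add: \<nu>_def field_simps)
    then have "cosh ((\<mu> - \<nu>) / 2) = (exp (\<mu> + - L C / 2) + exp (\<nu> + - L C / 2)) / 2"
      by (simp only: cosh_def scaleR_conv_of_real) simp
    also have "\<dots> = kap C"
      unfolding kap_eq[OF C] exp_add e by (simp add: algebra_simps)
    finally have "kap C = cosh ((\<mu> - \<nu>) / 2)" by simp
    moreover have "Re \<mu> = ln (norm (rho (z1 C)))" "Re \<nu> = ln (norm (rho (z2 C)))"
      by (metis e norm_exp_eq_Re ln_exp)+
    then have "Re \<mu> \<le> M C" "Re \<nu> \<le> M C" by (auto simp: M_def)
    moreover have "L C = \<mu> + \<nu>" by (simp add: \<nu>_def)
    ultimately show "\<exists>\<mu> \<nu>. L C = \<mu> + \<nu> \<and> kap C = cosh ((\<mu> - \<nu>) / 2) \<and> Re \<mu> \<le> M C \<and> Re \<nu> \<le> M C \<and> G C = psi \<mu> \<nu>"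
      using G[OF C] \<mu>_def \<nu>_def by blast
  qed
qed

end

section \<open>Euclidean configurations and channel values\<close>

lemma real_quadratic_conjugate_roots:
  fixes z w :: complex
  assumes "z + w = of_real s" "z * w = of_real t" "s\<^sup>2 \<le> 4 * t"
  shows "w = cnj z"
proof -
  have "(z - w)\<^sup>2 = (z + w)\<^sup>2 - 4 * (z * w)" by (simp add: power2_eq_square algebra_simps)
  also have "\<dots> = of_real (s\<^sup>2 - 4 * t)" by (simp add: assms)
  finally have "(z - w)\<^sup>2 \<in> \<real>\<^sub>\<le>\<^sub>0"
    using assms(3) by (simp only: nonpos_Reals_of_real_iff diff_le_0_iff_le)
  then have "Re (z - w) = 0" by (rule nonpos_Reals_square)
  moreover have "Im (z + w) = 0" by (simp add: assms(1))
  ultimately show ?thesis by (simp add: complex_eq_iff)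
qed

lemma norm_inversion_diff:
  fixes a b :: "'a::real_inner"
  assumes "a \<noteq> 0" "b \<noteq> 0"
  shows "(norm (a /\<^sub>R (norm a)\<^sup>2 - b /\<^sub>R (norm b)\<^sup>2))\<^sup>2 = (norm (a - b))\<^sup>2 / ((norm a)\<^sup>2 * (norm b)\<^sup>2)"
proof -
  have nz: "a \<bullet> a \<noteq> 0" "b \<bullet> b \<noteq> 0" using assms by auto
  show ?thesis
    unfolding power2_norm_eq_inner using nz
    by (simp add: inner_diff inner_commute[of b a] field_simps)
qed

definition euclid_point :: "'n::finite config \<Rightarrow> 4 \<Rightarrow> real \<times> (real ^ 'n)" where
  "euclid_point C i = (Re (fst C $ i), snd C $ i)"

lemma euclid_x2:
  assumes "C \<in> euclidean_configs"
  shows "x2 C i j = of_real ((norm (euclid_point C i - euclid_point C j))\<^sup>2)"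
proof -
  have "fst C $ i - fst C $ j = of_real (Re (fst C $ i) - Re (fst C $ j))"
    using assms by (simp add: euclidean_configs_def complex_eq_iff)
  then show ?thesis
    by (simp add: x2_def euclid_point_def norm_prod_def)
qed

lemma euclid_x2_pos:
  assumes "C \<in> euclidean_configs" "i \<noteq> j"
  obtains d where "d > 0" "x2 C i j = of_real d"
proof (rule that[OF _ euclid_x2[OF assms(1)]])
  have "x2 C i j \<noteq> 0" using assms by (simp add: euclidean_configs_def)
  then show "0 < (norm (euclid_point C i - euclid_point C j))\<^sup>2"
    using euclid_x2[OF assms(1), of i j] by auto
qed

text \<open>Inverting at the fourth point turns the claim into the Cauchy-Schwarz inequality.\<close>

lemma euclid_roots_conjugate:
  assumes C: "C \<in> euclidean_configs" and r: "cross_roots C z zb"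
  shows "zb = cnj z"
proof -
  define y where "y i = euclid_point C i - euclid_point C 4" for i
  \<comment> \<open>After the inversion the fourth point is at infinity and the cross-ratios are u =
    |p|^2 / |q|^2 and v = |q - p|^2 / |q|^2.\<close>
  define b where "b i = y i /\<^sub>R (norm (y i))\<^sup>2" for i
  define p q where "p = b 1 - b 2" and "q = b 1 - b 3"
  have ne: "euclid_point C i \<noteq> euclid_point C j" if "i \<noteq> j" for i j
    using that C euclid_x2[OF C, of i j] by (auto simp: euclidean_configs_def)
  have y0: "y 1 \<noteq> 0" "y 2 \<noteq> 0" "y 3 \<noteq> 0"
    using ne[of 1 4] ne[of 2 4] ne[of 3 4] by (auto simp: y_def)
  have dy: "euclid_point C i - euclid_point C j = y i - y j" for i j by (simp add: y_def)
  have x4: "x2 C i 4 = of_real ((norm (y i))\<^sup>2)" for i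
    by (simp add: euclid_x2[OF C] y_def)
  have x: "x2 C i j = of_real ((norm (b i - b j))\<^sup>2 * ((norm (y i))\<^sup>2 * (norm (y j))\<^sup>2))"
    if "y i \<noteq> 0" "y j \<noteq> 0" for i j
    using that by (simp add: euclid_x2[OF C] dy b_def norm_inversion_diff)
  have q0: "q \<bullet> q \<noteq> 0"
    using x[OF y0(1,3)] C by (auto simp: euclidean_configs_def q_def)
  have u: "cross_u C = of_real (p \<bullet> p / (q \<bullet> q))"
    unfolding cross_u_def x4 x[OF y0(1,2)] x[OF y0(1,3)] p_def[symmetric] q_def[symmetric] power2_norm_eq_inner
    using y0 q0 by (simp add: divide_simps flip: of_real_mult of_real_divide)
  have "b 2 - b 3 = q - p" by (simp add: p_def q_def)
  then have v: "cross_v C = of_real ((q - p) \<bullet> (q - p) / (q \<bullet> q))"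
    unfolding cross_v_def x4 x[OF y0(2,3)] x[OF y0(1,3)] q_def[symmetric] power2_norm_eq_inner
    using y0 q0 by (simp add: divide_simps flip: of_real_mult of_real_divide)
  have "(q - p) \<bullet> (q - p) = q \<bullet> q - 2 * (p \<bullet> q) + p \<bullet> p"
    by (simp add: inner_diff inner_commute[of q p])
  then have "1 + p \<bullet> p / (q \<bullet> q) - (q - p) \<bullet> (q - p) / (q \<bullet> q) = 2 * (p \<bullet> q) / (q \<bullet> q)"
    using q0 by (simp add: add_divide_distrib diff_divide_distrib)
  then have "z + zb = of_real (2 * (p \<bullet> q) / (q \<bullet> q))"
    using r unfolding cross_roots_iff u v by (metis of_real_1 of_real_add of_real_diff)
  moreover have "z * zb = of_real (p \<bullet> p / (q \<bullet> q))"
    using r by (simp add: cross_roots_iff u)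
  moreover have "(2 * (p \<bullet> q) / (q \<bullet> q))\<^sup>2 \<le> 4 * (p \<bullet> p / (q \<bullet> q))"
    using Cauchy_Schwarz_ineq[of p q] q0
    by (simp add: power_divide power_mult_distrib divide_simps power2_eq_square)
  ultimately show ?thesis by (rule real_quadratic_conjugate_roots)
qed

text \<open>The points lie in the plane spanned by time and one spatial axis, identified with the
  complex numbers. The cross-ratios u and v are then squared moduli of complex cross-ratios, so the
  roots are z and its conjugate as soon as the complex cross-ratio is z. The points are distinct but
  in general not ordered in time.\<close>

lemma euclid_config_with_roots:
  fixes z :: complex
  assumes "z \<noteq> 0" "z \<noteq> 1" "z \<noteq> 2"
  obtains C :: "'n::finite config" where "C \<in> euclidean_configs" "cross_roots C z (cnj z)"
proof
  \<comment> \<open>With the points 0, 1, - 1 in places 1, 3, 4, the second point is solved for from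
    cross-ratio = z; z = 2 would send it to infinity.\<close>
  define w :: "4 \<Rightarrow> complex" where
    "w k = (if k = 1 then 0 else if k = 2 then z / (2 - z) else if k = 3 then 1 else - 1)" for k
  define C :: "'n config" where
    "C = (\<chi> k. of_real (Re (w k)), \<chi> k. axis undefined (Im (w k)))"
  have "norm (axis undefined a - axis undefined b :: real ^ 'n) = \<bar>a - b\<bar>" for a b
  proof -
    have "axis undefined a - axis undefined b = (axis undefined (a - b) :: real ^ 'n)"
      by (simp add: vec_eq_iff axis_def)
    then show ?thesis by (simp add: norm_eq_sqrt_inner inner_axis_axis)
  qed
  then have "x2 C i j = of_real ((norm (w i - w j))\<^sup>2)" for i j
    unfolding cmod_power2 by (simp add: x2_def C_def)
  then have x: "x2 C i j = (w i - w j) * cnj (w i - w j)" for i j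
    by (simp only: complex_norm_square)
  have [simp]: "w 1 = 0" "w 2 = z / (2 - z)" "w 3 = 1" "w 4 = - 1" by (simp_all add: w_def)
  have z2: "2 - z \<noteq> 0" "2 - cnj z \<noteq> 0" using assms(3)
    by (auto simp: complex_eq_iff)
  have w2: "z / (2 - z) + 1 = 2 / (2 - z)" "z / (2 - z) - 1 = 2 * (z - 1) / (2 - z)"
    using z2 by (simp_all add: field_simps)
  have wne: "w i \<noteq> w j" if "i \<noteq> j" for i j
    using that exhaust_4[of i] exhaust_4[of j] assms z2
    by (auto simp: divide_simps add_eq_0_iff)
  show "C \<in> euclidean_configs"
    using wne by (auto simp: euclidean_configs_def x) (simp add: C_def)
  have pr: "a * cnj a * (b * cnj b) / (c * cnj c * (d * cnj d)) = a * b / (c * d) * cnj (a * b / (c * d))"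
    for a b c d :: complex
    unfolding complex_cnj_mult complex_cnj_divide times_divide_times_eq
    by (rule arg_cong2[of _ _ _ _ "(/)"]; algebra)
  have "(w 1 - w 2) * (w 3 - w 4) / ((w 1 - w 3) * (w 2 - w 4)) = z"
    using z2 by (simp add: w2)
  then have u: "cross_u C = z * cnj z"
    unfolding cross_u_def x pr by (simp only:)
  have "(w 1 - w 4) * (w 2 - w 3) / ((w 1 - w 3) * (w 2 - w 4)) = - ((2 * z - 2) / 2)"
    using z2 by (simp add: w2)
  also have "\<dots> = 1 - z" by (simp add: diff_divide_distrib)
  finally have "cross_v C = (1 - z) * cnj (1 - z)"
    unfolding cross_v_def x pr by (simp only:)
  then show "cross_roots C z (cnj z)"
    by (simp add: cross_roots_def u)
qed

lemma rho_cnj: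
  assumes "z \<notin> complex_of_real ` {1..}"
  shows "rho (cnj z) = cnj (rho z)"
  using assms cnj_csqrt[of "1 - z"] by (simp add: rho_eq slit_iff)

section \<open>The channel sums of the theory as state sums\<close>

definition state_coef :: "('op, 'p, 's, 'n::finite) cft \<Rightarrow> (4 \<Rightarrow> 'op) \<Rightarrow> 'p \<times> 's \<Rightarrow> real" where
  "state_coef T q = (\<lambda>(P, \<psi>). coef T (q 1) (q 2) (q 3) (q 4) P \<psi>)"

abbreviation state_h :: "('op, 'p, 's, 'n::finite) cft \<Rightarrow> 'p \<times> 's \<Rightarrow> real" where
  "state_h T \<equiv> (\<lambda>(P, \<psi>). hwt T \<psi>)"

abbreviation state_hb :: "('op, 'p, 's, 'n::finite) cft \<Rightarrow> 'p \<times> 's \<Rightarrow> real" where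
  "state_hb T \<equiv> (\<lambda>(P, \<psi>). hbwt T \<psi>)"

definition cft_psi :: "('op, 'p, 's, 'n::finite) cft \<Rightarrow> (4 \<Rightarrow> 'op) \<Rightarrow> complex \<Rightarrow> complex \<Rightarrow> complex" where
  "cft_psi T q = state_sum.psi (states T) (state_coef T q) (state_h T) (state_hb T)"

lemma rpow_exp: "rpow (exp K) d = exp (d * K)"
  by (simp add: rpow_def powr_def)

lemma exp_weights_polar:
  "exp (of_real h * Complex K \<theta> + of_real hb * Complex K (- \<theta>)) = of_real (exp ((h + hb) * K)) * cis ((h - hb) * \<theta>)"
proof -
  have "of_real h * Complex K \<theta> + of_real hb * Complex K (- \<theta>) = Complex ((h + hb) * K) ((h - hb) * \<theta>)"
    by (simp add: complex_eq_iff algebra_simps)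
  then show ?thesis by (simp add: exp_eq_polar exp_of_real)
qed

context unitary_cft
begin

lemma gfun_has_sum:
  assumes "K < 0"
  shows "((\<lambda>a. of_real (state_coef T q a) * exp (of_real (state_h T a) * Complex K \<theta> + of_real (state_hb T a) * Complex K (- \<theta>)))
    has_sum gfun T (q 1) (q 2) (q 3) (q 4) (rcis (exp K) \<theta>) (rcis (exp K) (- \<theta>))) (states T)"
  using rho_expansion[of "exp K" "q 1" "q 2" "q 3" "q 4" \<theta>] assms
  by (simp add: exp_weights_polar case_prod_beta' state_coef_def rpow_exp mult.assoc)

text \<open>The Gegenbauer expansion sees the angle only through its cosine.\<close>

lemma gfun_even:
  assumes "K < 0"
  shows "gfun T i j k l (rcis (exp K) \<theta>) (rcis (exp K) (- \<theta>)) = gfun T i j k l (rcis (exp K) (- \<theta>)) (rcis (exp K) \<theta>)"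
proof -
  obtain c where c: "\<And>r \<theta>. 0 \<le> r \<and> r < 1 \<Longrightarrow>
       ((\<lambda>(\<delta>, m). of_real (c \<delta> m * rpow r \<delta> * gegenbauer_dim (CARD('n) + 1) m (cos \<theta>)))
         has_sum gfun T i j k l (rcis r \<theta>) (rcis r (- \<theta>))) ({0..} \<times> UNIV)"
    using gegenbauer_expansion[of i j k l] by blast
  show ?thesis
    using has_sum_unique[OF c[of "exp K" \<theta>] c[of "exp K" "- \<theta>", simplified cos_minus minus_minus]] assms by simp
qed

lemma state_sum: "state_sum (states T) (state_coef T q) (state_h T) (state_hb T)"
proof
  fix a assume "a \<in> states T"
  then show "0 \<le> state_h T a \<and> 0 \<le> state_hb T a \<and> state_h T a - state_hb T a \<in> \<int>"
    using weights_nonneg[of "fst a" "snd a"] integer_spin[of "fst a" "snd a"] by (auto simp: case_prod_beta)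
next
  fix K :: real assume K: "K < 0"
  have r: "0 \<le> exp K" "exp K < 1" using K by auto
  let ?a = "\<lambda>(P, \<psi>). (ope T (q 1) (q 2) P)\<^sup>2 * (acoef T (q 1) (q 2) \<psi>)\<^sup>2 * rpow (exp K) (hwt T \<psi> + hbwt T \<psi>)"
  let ?b = "\<lambda>(P, \<psi>). (ope T (q 3) (q 4) P)\<^sup>2 * (bcoef T (q 3) (q 4) \<psi>)\<^sup>2 * rpow (exp K) (hwt T \<psi> + hbwt T \<psi>)"
  have "?a summable_on states T" "?b summable_on states T"
    using a_bound[OF r] b_bound[OF r] by blast+
  then have s: "(\<lambda>a. ?a a + ?b a) summable_on states T" by (rule summable_on_add)
  show "(\<lambda>a. \<bar>state_coef T q a\<bar> * exp ((state_h T a + state_hb T a) * K)) summable_on states T"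
  proof (rule summable_on_comparison_test[OF s])
    fix a :: "'p \<times> 's"
    obtain P \<psi> where a: "a = (P, \<psi>)" by fastforce
    define x y where "x = ope T (q 1) (q 2) P * acoef T (q 1) (q 2) \<psi>" and "y = ope T (q 3) (q 4) P * bcoef T (q 3) (q 4) \<psi>"
    have "coef T (q 1) (q 2) (q 3) (q 4) P \<psi> = x * y"
      by (simp add: coef_def x_def y_def)
    \<comment> \<open>Cauchy-Schwarz in its termwise form: the squares of x and y are summable with
      weights by \<open>a_bound\<close> and \<open>b_bound\<close> at the same radius exp K.\<close>
    moreover have "\<bar>x * y\<bar> \<le> x\<^sup>2 + y\<^sup>2"
    proof -
      have "0 \<le> (\<bar>x\<bar> - \<bar>y\<bar>)\<^sup>2" by simp
      then have "2 * \<bar>x * y\<bar> \<le> x\<^sup>2 + y\<^sup>2" by (simp add: power2_diff abs_mult)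
      then show ?thesis by simp
    qed
    ultimately have "\<bar>coef T (q 1) (q 2) (q 3) (q 4) P \<psi>\<bar> * exp ((hwt T \<psi> + hbwt T \<psi>) * K)
        \<le> (x\<^sup>2 + y\<^sup>2) * exp ((hwt T \<psi> + hbwt T \<psi>) * K)"
      by (simp add: mult_right_mono)
    then show "\<bar>state_coef T q a\<bar> * exp ((state_h T a + state_hb T a) * K) \<le> ?a a + ?b a"
      by (simp add: a state_coef_def rpow_exp x_def y_def power_mult_distrib algebra_simps)
  qed simp
next
  fix K \<theta> :: real assume K: "K < 0"
  show "(\<Sum>\<^sub>\<infinity>a\<in>states T. of_real (state_coef T q a) * exp (of_real (state_h T a) * Complex K \<theta> + of_real (state_hb T a) * Complex K (- \<theta>)))
      = (\<Sum>\<^sub>\<infinity>a\<in>states T. of_real (state_coef T q a) * exp (of_real (state_h T a) * Complex K (- \<theta>) + of_real (state_hb T a) * Complex K \<theta>))"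
    using infsumI[OF gfun_has_sum[OF K, of q \<theta>]] infsumI[OF gfun_has_sum[OF K, of q "- \<theta>"]] gfun_even[OF K]
    by simp
qed

lemma cft_psi_polar:
  assumes "K < 0"
  shows "cft_psi T q (Complex K \<theta>) (Complex K (- \<theta>)) = gfun T (q 1) (q 2) (q 3) (q 4) (rcis (exp K) \<theta>) (rcis (exp K) (- \<theta>))"
  unfolding cft_psi_def state_sum.psi_def[OF state_sum] state_sum.monom_def[OF state_sum, abs_def]
  using infsumI[OF gfun_has_sum[OF assms]] by simp

text \<open>Any logarithm of rho may serve as mu: since mu + nu is real and twice Re mu, nu is the
  conjugate of mu, which is the Euclidean slice.\<close>

lemma cft_psi_gfun:
  assumes z: "z \<notin> complex_of_real ` {1..}" "z \<noteq> 0"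
    and mn: "exp \<mu> = rho z" "\<mu> + \<nu> = of_real (2 * ln (norm (rho z)))"
  shows "cft_psi T q \<mu> \<nu> = gfun T (q 1) (q 2) (q 3) (q 4) (rho z) (rho (cnj z))"
proof -
  define K \<theta> where "K = ln (norm (rho z))" and "\<theta> = Im \<mu>"
  have \<rho>: "0 < norm (rho z)" "norm (rho z) < 1"
    using z by (simp_all add: rho_nonzero norm_rho_less_1)
  then have K: "K < 0" by (simp add: K_def)
  have "Re \<mu> = K" unfolding K_def mn(1)[symmetric] by simp
  then have \<mu>: "\<mu> = Complex K \<theta>" by (simp add: \<theta>_def complex_eq_iff)
  have \<nu>: "\<nu> = Complex K (- \<theta>)"
    using mn(2) unfolding \<mu> K_def[symmetric] by (simp add: complex_eq_iff)
  have "rho z = rcis (exp K) \<theta>"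
    unfolding mn(1)[symmetric] \<mu> by (simp add: exp_eq_polar rcis_def exp_of_real)
  moreover from this have "rho (cnj z) = rcis (exp K) (- \<theta>)"
    unfolding rho_cnj[OF z(1)] by (simp add: rcis_def cis_cnj)
  ultimately show ?thesis
    unfolding \<mu> \<nu> cft_psi_polar[OF K] by simp
qed

end

definition cft_prefactor :: "('op, 'p, 's, 'n::finite) cft \<Rightarrow> (4 \<Rightarrow> 'op) \<Rightarrow> (4 \<Rightarrow> 4 \<Rightarrow> complex) \<Rightarrow> complex" where
  "cft_prefactor T q = prefactor (sdim T (q 1)) (sdim T (q 2)) (sdim T (q 3)) (sdim T (q 4))"

text \<open>A choice of the roots and the principal logarithm of rho make this a function of the
  configuration; \<open>channel_value_eq\<close> removes the dependence on both.\<close>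

definition channel_value ::
  "('op, 'p, 's, 'n::finite) cft \<Rightarrow> (4 \<Rightarrow> 'op) \<Rightarrow> (4 \<Rightarrow> 4 \<Rightarrow> complex) \<Rightarrow> 'n config \<Rightarrow> complex" where
  "channel_value T q lg C = (let p = SOME p. cross_roots C (fst p) (snd p) in
     cft_prefactor T q lg * cft_psi T q (Ln (rho (fst p))) (log_rho_rhob lg (fst p) (snd p) - Ln (rho (fst p))))"

context unitary_cft
begin

lemma Re_log_rho_neg:
  assumes "exp \<mu> = rho z" "z \<notin> complex_of_real ` {1..}"
  shows "Re \<mu> < 0"
  using norm_rho_less_1[OF assms(2)] unfolding assms(1)[symmetric] by simp

text \<open>Another logarithm of rho is absorbed by \<open>psi_cong\<close>, the exchange of the
  roots by \<open>psi_commute\<close>. All dependence on a branch sits in \<open>lg\<close>.\<close>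

lemma channel_value_eq:
  assumes lg: "\<And>m n. m \<noteq> n \<Longrightarrow> exp (lg m n) = x2 C m n"
    and slit: "\<And>z zb. cross_roots C z zb \<Longrightarrow> z \<notin> complex_of_real ` {1..}"
    and r: "cross_roots C z zb" and mn: "exp \<mu> = rho z" "\<mu> + \<nu> = log_rho_rhob lg z zb"
  shows "channel_value T q lg C = cft_prefactor T q lg * cft_psi T q \<mu> \<nu>"
    and "Re \<mu> < 0" "Re \<nu> < 0"
proof -
  interpret S: state_sum "states T" "state_coef T q" "state_h T" "state_hb T" by (rule state_sum)
  have eL: "exp (log_rho_rhob lg z zb) = rho z * rho zb"
    using lg r by (intro exp_log_rho_rhob) auto
  have x: "x2 C m n \<noteq> 0" if "m \<noteq> n" for m n using lg[OF that] by (metis exp_not_eq_zero)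
  have z: "z \<noteq> 0" "zb \<noteq> 0" using r x by (auto simp: cross_roots_def cross_u_def)
  have \<rho>: "rho z \<noteq> 0" "rho zb \<noteq> 0" using z by (auto simp: rho_nonzero)
  have en: "exp \<nu> = rho zb"
  proof -
    have "\<nu> = log_rho_rhob lg z zb - \<mu>" using mn(2) by (simp add: algebra_simps)
    then show ?thesis using eL mn(1) \<rho> by (simp add: exp_diff)
  qed
  show neg: "Re \<mu> < 0" "Re \<nu> < 0"
    using Re_log_rho_neg[OF mn(1) slit[OF r]] Re_log_rho_neg[OF en slit[OF cross_roots_swap[OF r]]] by auto
  define p where "p = (SOME p. cross_roots C (fst p) (snd p))"
  have "cross_roots C (fst p) (snd p)"
    unfolding p_def by (rule someI_ex[of "\<lambda>p. cross_roots C (fst p) (snd p)"]) (metis r fst_conv snd_conv)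
  from cross_roots_unique[OF r this]
  have "S.psi (Ln (rho (fst p))) (log_rho_rhob lg (fst p) (snd p) - Ln (rho (fst p))) = S.psi \<mu> \<nu>"
  proof
    assume p: "(fst p, snd p) = (z, zb)"
    show ?thesis
      by (rule S.psi_cong) (use p mn \<rho> in auto)
  next
    assume p: "(fst p, snd p) = (zb, z)"
    have "S.psi (Ln (rho (fst p))) (log_rho_rhob lg (fst p) (snd p) - Ln (rho (fst p))) = S.psi \<nu> \<mu>"
      by (rule S.psi_cong) (use p mn \<rho> en in \<open>auto simp: log_rho_rhob_swap[of lg zb z] add.commute\<close>)
    then show ?thesis using S.psi_commute[OF neg] by simp
  qed
  then show "channel_value T q lg C = cft_prefactor T q lg * cft_psi T q \<mu> \<nu>"
    unfolding channel_value_def Let_def p_def[symmetric] cft_psi_def by simp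
qed

lemma channel_value_has_sum:
  assumes lg: "\<And>m n. m \<noteq> n \<Longrightarrow> exp (lg m n) = x2 C m n"
    and slit: "\<And>z zb. cross_roots C z zb \<Longrightarrow> z \<notin> complex_of_real ` {1..}"
    and r: "cross_roots C z zb"
  obtains S where "((\<lambda>(P, \<psi>). of_real (coef T (q 1) (q 2) (q 3) (q 4) P \<psi>)
       * rho_monomial (log_rho_rhob lg z zb) (rho z) (hwt T \<psi>) (hbwt T \<psi>)) has_sum S) (states T)"
    "channel_value T q lg C = prefactor (sdim T (q 1)) (sdim T (q 2)) (sdim T (q 3)) (sdim T (q 4)) lg * S"
proof -
  interpret S: state_sum "states T" "state_coef T q" "state_h T" "state_hb T" by (rule state_sum)
  have x: "x2 C m n \<noteq> 0" if "m \<noteq> n" for m n using lg[OF that] by (metis exp_not_eq_zero)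
  have "z \<noteq> 0" using r x by (auto simp: cross_roots_def cross_u_def)
  then have e: "exp (Ln (rho z)) = rho z" by (simp add: rho_nonzero)
  define \<nu> where "\<nu> = log_rho_rhob lg z zb - Ln (rho z)"
  have s: "Ln (rho z) + \<nu> = log_rho_rhob lg z zb" by (simp add: \<nu>_def)
  note v = channel_value_eq[OF lg slit r e s]
  from S.monom_has_sum[OF v(2,3)]
  have "((\<lambda>(P, \<psi>). of_real (coef T (q 1) (q 2) (q 3) (q 4) P \<psi>)
       * rho_monomial (log_rho_rhob lg z zb) (rho z) (hwt T \<psi>) (hbwt T \<psi>)) has_sum cft_psi T q (Ln (rho z)) \<nu>) (states T)"
    unfolding cft_psi_def S.monom_def[abs_def]
    by (simp add: state_coef_def rho_monomial_def \<nu>_def case_prod_beta')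
  from that[OF this] v(1) show thesis by (simp add: cft_prefactor_def)
qed

lemma channel_value_analytic:
  assumes "channel_region U l"
  shows "time_analytic_on (\<lambda>C. channel_value T q (\<lambda>i j. l i j C) C) U"
proof -
  interpret channel_region U l by fact
  have "time_analytic_on (\<lambda>C. cft_prefactor T q (\<lambda>i j. l i j C)) U"
    unfolding cft_prefactor_def prefactor_def
    by (intro time_analytic_on_mult time_analytic_on_divide time_analytic_on_exp time_analytic_on_add
        time_analytic_on_diff time_analytic_on_const l_analytic; simp)
  moreover have "time_analytic_on (\<lambda>C. cft_psi T q (Ln (rho (z1 C))) (L C - Ln (rho (z1 C)))) U"
    by (rule series_analytic[OF state_sum]) (simp add: cft_psi_def)
  ultimately have "time_analytic_on (\<lambda>C. cft_prefactor T q (\<lambda>i j. l i j C) * cft_psi T q (Ln (rho (z1 C))) (L C - Ln (rho (z1 C)))) U"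
    by (rule time_analytic_on_mult)
  then show ?thesis
  proof (rule time_analytic_on_cong[OF open_U])
    fix C assume C: "C \<in> U"
    show "cft_prefactor T q (\<lambda>i j. l i j C) * cft_psi T q (Ln (rho (z1 C))) (L C - Ln (rho (z1 C)))
      = channel_value T q (\<lambda>i j. l i j C) C"
      by (rule channel_value_eq(1)[OF exp_l[OF C] slit[OF C] z12, symmetric])
        (use rho_facts[OF C] in \<open>auto simp: L_def\<close>)
  qed
qed

lemma euclid_log_real:
  assumes "C \<in> euclidean_configs" "m \<noteq> n"
  obtains t :: real where "Ln (x2 C m n) = of_real t"
  using euclid_x2_pos[OF assms] by (metis Ln_of_real)

text \<open>The logarithms of the squared distances are real and the two remaining logarithms are
  conjugate, so the whole is the real logarithm of |rho|^2.\<close>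

lemma euclid_log_rho_rhob:
  assumes C: "C \<in> euclidean_configs" and r: "cross_roots C z zb" and z: "z \<notin> complex_of_real ` {1..}"
  shows "log_rho_rhob (\<lambda>m n. Ln (x2 C m n)) z zb = of_real (2 * ln (norm (rho z)))"
proof -
  have zb: "zb = cnj z" by (rule euclid_roots_conjugate[OF C r])
  have x: "x2 C m n \<noteq> 0" if "m \<noteq> n" for m n using C that by (auto simp: euclidean_configs_def)
  have z0: "z \<noteq> 0" using r x by (auto simp: cross_roots_def cross_u_def)
  define s where "s = log_rho_rhob (\<lambda>m n. Ln (x2 C m n)) z zb"
  note ne = one_plus_csqrt_slit[of "1 - z"]
  have c: "Ln (1 + csqrt (1 - zb)) = cnj (Ln (1 + csqrt (1 - z)))"
    using cnj_csqrt[of "1 - z"] cnj_Ln[OF ne] z by (simp add: zb slit_iff)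
  have "Im (Ln (x2 C m n)) = 0" if "m \<noteq> n" for m n
    using euclid_log_real[OF C that] by (metis Im_complex_of_real)
  then have "Im s = 0" by (simp add: s_def log_rho_rhob_def c)
  then have s: "s = of_real (Re s)" by (simp add: complex_eq_iff)
  have "exp s = rho z * cnj (rho z)"
    unfolding s_def using exp_log_rho_rhob[OF _ _ _ _ r, of "\<lambda>m n. Ln (x2 C m n)"] x
    by (simp add: zb rho_cnj[OF z])
  then have "exp (Re s) = (norm (rho z))\<^sup>2"
    using s by (metis complex_norm_square exp_of_real of_real_eq_iff of_real_power)
  also have "\<dots> = exp (2 * ln (norm (rho z)))"
    using z0 by (simp add: exp_double rho_nonzero)
  finally show ?thesis using s by (simp add: s_def)
qed

lemma corr_eq_channel_value:
  assumes C: "C \<in> euclidean_configs" and r: "cross_roots C z zb" and z: "z \<notin> complex_of_real ` {1..}"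
    and mn: "exp \<mu> = rho z" "\<mu> + \<nu> = log_rho_rhob (\<lambda>m n. Ln (x2 C m n)) z zb"
  shows "corr T (q 1) (q 2) (q 3) (q 4) C = cft_prefactor T q (\<lambda>m n. Ln (x2 C m n)) * cft_psi T q \<mu> \<nu>"
proof -
  have zb: "zb = cnj z" by (rule euclid_roots_conjugate[OF C r])
  have "z \<noteq> 0" using r C by (auto simp: cross_roots_def cross_u_def euclidean_configs_def)
  then have "cft_psi T q \<mu> \<nu> = gfun T (q 1) (q 2) (q 3) (q 4) (rho z) (rho (cnj z))"
    using z mn euclid_log_rho_rhob[OF C r z] by (intro cft_psi_gfun) auto
  then show ?thesis
    using conformal_covariance[OF C] r z by (simp add: zb cft_prefactor_def)
qed

end

section \<open>Extension to Lorentzian configurations\<close>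

lemma x2_permute: "x2 (permute_points \<sigma> C) i j = x2 C (\<sigma> i) (\<sigma> j)"
  by (simp add: x2_def permute_points_def)

lemma permute_points_involution:
  assumes "\<And>k. \<sigma> (\<sigma> k) = k"
  shows "permute_points \<sigma> (permute_points \<sigma> C) = C"
  by (simp add: permute_points_def assms)

lemma continuous_on_permute_points: "continuous_on S (permute_points \<sigma>)"
  unfolding permute_points_def[abs_def] by (intro continuous_intros)

lemma cfrechet_permute:
  fixes f :: "complex ^ 'm::finite \<Rightarrow> complex" and \<sigma> :: "'m \<Rightarrow> 'm"
  assumes "cfrechet f (\<chi> k. \<tau> $ \<sigma> k)"
  shows "cfrechet (\<lambda>\<tau>. f (\<chi> k. \<tau> $ \<sigma> k)) \<tau>"
proof -
  obtain F where F: "(f has_derivative F) (at (\<chi> k. \<tau> $ \<sigma> k))" "\<And>c v. F (c *s v) = c * F v"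
    using assms by (auto simp: cfrechet_def)
  have "linear (\<lambda>\<tau> :: complex ^ 'm. \<chi> k. \<tau> $ \<sigma> k)"
    by (rule linearI) (simp_all add: vec_eq_iff)
  then have "((\<lambda>\<tau> :: complex ^ 'm. \<chi> k. \<tau> $ \<sigma> k) has_derivative (\<lambda>\<tau>. \<chi> k. \<tau> $ \<sigma> k)) (at \<tau>)"
    by (intro bounded_linear_imp_has_derivative) (simp add: linear_conv_bounded_linear)
  from has_derivative_compose[OF this F(1)]
  have "((\<lambda>\<tau>. f (\<chi> k. \<tau> $ \<sigma> k)) has_derivative (\<lambda>v. F (\<chi> k. v $ \<sigma> k))) (at \<tau>)" .
  moreover have "F (\<chi> k. (c *s v) $ \<sigma> k) = c * F (\<chi> k. v $ \<sigma> k)" for c v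
    unfolding F(2)[symmetric] by (rule arg_cong[of _ _ F]) (simp add: vec_eq_iff)
  ultimately show ?thesis unfolding cfrechet_def by blast
qed

lemma time_analytic_on_permute:
  assumes f: "time_analytic_on f S" and S: "\<And>C. C \<in> S' \<Longrightarrow> permute_points \<sigma> C \<in> S"
  shows "time_analytic_on (\<lambda>C. f (permute_points \<sigma> C)) S'"
  unfolding time_analytic_on_iff
proof (intro conjI allI impI)
  show "continuous_on S' (\<lambda>C. f (permute_points \<sigma> C))"
    using f S by (intro continuous_on_compose2[OF _ continuous_on_permute_points]) (auto simp: time_analytic_on_iff)
  fix \<tau> x assume "(\<tau>, x) \<in> S'"
  from S[OF this] have "cfrechet (\<lambda>\<tau>'. f (\<tau>', \<chi> k. x $ \<sigma> k)) (\<chi> k. \<tau> $ \<sigma> k)"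
    using f by (simp add: time_analytic_on_iff permute_points_def)
  from cfrechet_permute[OF this] show "cfrechet (\<lambda>\<tau>'. f (permute_points \<sigma> (\<tau>', x))) \<tau>"
    by (simp add: permute_points_def)
qed

text \<open>\<open>channel_region\<close> is applied to the pull-back of \<open>U\<close> and
  \<open>l\<close> along the exchange of points; as \<sigma> is an involution, pulling back once
  more returns to \<open>U\<close>.\<close>

lemma (in unitary_cft) permuted_channel_analytic:
  assumes U: "open U" and \<sigma>: "\<And>k. \<sigma> (\<sigma> k) = k"
    and l: "\<And>m n. m \<noteq> n \<Longrightarrow> time_analytic_on (l m n) U" "\<And>m n C. m \<noteq> n \<Longrightarrow> C \<in> U \<Longrightarrow> exp (l m n C) = x2 C m n"
    and slit: "\<And>C z zb. C \<in> U \<Longrightarrow> cross_roots (permute_points \<sigma> C) z zb \<Longrightarrow> z \<notin> complex_of_real ` {1..}"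
  shows "time_analytic_on (\<lambda>C. channel_value T q (\<lambda>i j. l (\<sigma> i) (\<sigma> j) C) (permute_points \<sigma> C)) U"
proof -
  note inv = permute_points_involution[of \<sigma>, OF \<sigma>]
  have ne: "\<sigma> i \<noteq> \<sigma> j" if "i \<noteq> j" for i j using that \<sigma> by metis
  have "channel_region (permute_points \<sigma> -` U) (\<lambda>i j C. l (\<sigma> i) (\<sigma> j) (permute_points \<sigma> C))"
  proof
    show "open (permute_points \<sigma> -` U)"
      by (rule open_vimage[OF U continuous_on_permute_points])
    show "exp (l (\<sigma> i) (\<sigma> j) (permute_points \<sigma> C)) = x2 C i j" if "C \<in> permute_points \<sigma> -` U" "i \<noteq> j" for C i j
      using that l(2)[OF ne] by (simp add: x2_permute \<sigma>)
    show "time_analytic_on (\<lambda>C. l (\<sigma> i) (\<sigma> j) (permute_points \<sigma> C)) (permute_points \<sigma> -` U)" if "i \<noteq> j" for i j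
      by (rule time_analytic_on_permute[OF l(1)[OF ne[OF that]]]) simp
    show "z \<notin> complex_of_real ` {1..}" if "C \<in> permute_points \<sigma> -` U" "cross_roots C z zb" for C z zb
      using slit[of "permute_points \<sigma> C" z zb] that by (simp add: inv)
  qed
  from time_analytic_on_permute[OF channel_value_analytic[OF this, of q], of U \<sigma>]
  show ?thesis by (simp add: inv)
qed

section \<open>Branches of the logarithms at the Lorentzian boundary\<close>

lemma convex_DD: "convex (DD :: 'n::finite config set)"
proof -
  have DD: "(DD :: 'n config set) = {C. Re (fst C $ 2) < Re (fst C $ 1)} \<inter> {C. Re (fst C $ 3) < Re (fst C $ 2)}
     \<inter> {C. Re (fst C $ 4) < Re (fst C $ 3)}"
    by (auto simp: DD_def)
  have "convex {C :: 'n config. Re (fst C $ i) < Re (fst C $ j)}" for i j :: 4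
  proof (rule convexI)
    fix C C' :: "'n config" and u v :: real
    assume "C \<in> {C. Re (fst C $ i) < Re (fst C $ j)}" "C' \<in> {C. Re (fst C $ i) < Re (fst C $ j)}"
      and uv: "0 \<le> u" "0 \<le> v" "u + v = 1"
    then have "u * (Re (fst C $ i) - Re (fst C $ j)) + v * (Re (fst C' $ i) - Re (fst C' $ j)) < 0"
      by (intro convex_bound_lt) auto
    then show "u *\<^sub>R C + v *\<^sub>R C' \<in> {C. Re (fst C $ i) < Re (fst C $ j)}"
      by (simp add: algebra_simps)
  qed
  then show ?thesis unfolding DD by (intro convex_Int)
qed

lemma open_DD: "open DD"
  unfolding DD_def by (intro open_Collect_conj open_Collect_less continuous_intros)

definition time_shift :: "real ^ 4 \<Rightarrow> 'n::finite config \<Rightarrow> 'n config" where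
  "time_shift \<epsilon> C = (\<chi> k. of_real (\<epsilon> $ k) + fst C $ k, snd C)"

lemma time_shift_tendsto: "((\<lambda>\<epsilon>. time_shift \<epsilon> C) \<longlongrightarrow> C) (at 0 within S)"
proof -
  have "continuous_on UNIV (\<lambda>\<epsilon>. time_shift \<epsilon> C)"
    unfolding time_shift_def by (intro continuous_intros)
  then have "((\<lambda>\<epsilon>. time_shift \<epsilon> C) \<longlongrightarrow> time_shift 0 C) (at 0)"
    unfolding continuous_on_eq_continuous_at[OF open_UNIV] isCont_def by blast
  then have "((\<lambda>\<epsilon>. time_shift \<epsilon> C) \<longlongrightarrow> time_shift 0 C) (at 0 within S)"
    by (rule tendsto_within_subset) simp
  moreover have "time_shift 0 C = C" by (simp add: time_shift_def vec_eq_iff prod_eq_iff)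
  ultimately show ?thesis by simp
qed

text \<open>Needed to evaluate the \<open>Lim\<close> in \<open>log_x2\<close>, which determines a
  value only along a nontrivial filter.\<close>

lemma DL_limit_point_of_DD:
  assumes "C \<in> DL"
  shows "at C within DD \<noteq> bot"
proof -
  have "C islimpt DD"
    unfolding islimpt_approachable
  proof (intro allI impI)
    fix e :: real assume e: "e > 0"
    \<comment> \<open>A strictly decreasing vector: shifting all Lorentzian times along it by any t
      > 0 enters \<open>DD\<close>.\<close>
    define v :: "real ^ 4" where "v = (\<chi> k. if k = 1 then 3 else if k = 2 then 2 else if k = 3 then 1 else 0)"
    have lim: "((\<lambda>t. time_shift (t *\<^sub>R v) C) \<longlongrightarrow> C) (at_right 0)"
    proof -
      have "continuous_on UNIV (\<lambda>t. time_shift (t *\<^sub>R v) C)"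
        unfolding time_shift_def by (intro continuous_intros)
      then have "((\<lambda>t. time_shift (t *\<^sub>R v) C) \<longlongrightarrow> time_shift (0 *\<^sub>R v) C) (at 0)"
        unfolding continuous_on_eq_continuous_at[OF open_UNIV] isCont_def by blast
      then have "((\<lambda>t. time_shift (t *\<^sub>R v) C) \<longlongrightarrow> time_shift (0 *\<^sub>R v) C) (at_right 0)"
        by (rule tendsto_within_subset) simp
      then show ?thesis by (simp add: time_shift_def vec_eq_iff prod_eq_iff)
    qed
    have "\<forall>\<^sub>F t in at_right 0. dist (time_shift (t *\<^sub>R v) C) C < e \<and> (t::real) > 0"
      using tendstoD[OF lim e] eventually_at_right_less by (rule eventually_conj)
    then obtain t :: real where t: "t > 0" "dist (time_shift (t *\<^sub>R v) C) C < e"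
      using eventually_happens'[OF trivial_limit_at_right_real] by blast
    have "time_shift (t *\<^sub>R v) C \<in> DD"
      using assms t(1) by (simp add: DD_def DL_def time_shift_def v_def)
    moreover have "C \<notin> DD" using assms by (simp add: DD_def DL_def)
    ultimately show "\<exists>C'\<in>DD. C' \<noteq> C \<and> dist C' C < e" using t(2) by metis
  qed
  then show ?thesis by (simp add: trivial_limit_within)
qed

text \<open>Near C0 the ratio of a squared distance to its value at C0 lies in the right half-plane,
  so its principal logarithm is analytic. The additive constant is adjusted at one point of
  \<open>DD\<close>; agreement with \<open>Ln\<close> then holds on all of ball and
  \<open>DD\<close>, whose intersection is convex.\<close>

lemma DL_log_branches:
  fixes C0 :: "'n::finite config"
  assumes C0: "C0 \<in> DL"
  obtains r l where "r > 0"
    "\<And>m n. m \<noteq> n \<Longrightarrow> time_analytic_on (l m n) (ball C0 r)"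
    "\<And>m n C. m \<noteq> n \<Longrightarrow> C \<in> ball C0 r \<Longrightarrow> exp (l m n C) = x2 C m n"
    "\<And>m n C. m \<noteq> n \<Longrightarrow> C \<in> ball C0 r \<inter> DD \<Longrightarrow> l m n C = Ln (x2 C m n)"
    "\<And>m n. m \<noteq> n \<Longrightarrow> log_x2 C0 m n = l m n C0"
proof -
  have q: "x2 C0 m n \<noteq> 0" if "m \<noteq> n" for m n using C0 that by (simp add: DL_def)
  note cont = continuous_on_x2[of UNIV]
  have "\<forall>\<^sub>F C in nhds C0. \<forall>m n. m \<noteq> n \<longrightarrow> Re (x2 C m n / x2 C0 m n) > 0"
  proof (intro eventually_all_finite)
    fix m n :: 4
    show "\<forall>\<^sub>F C in nhds C0. m \<noteq> n \<longrightarrow> Re (x2 C m n / x2 C0 m n) > 0"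
    proof (cases "m = n")
      case False
      have "((\<lambda>C. x2 C m n) \<longlongrightarrow> x2 C0 m n) (nhds C0)"
        using cont[of m n] unfolding continuous_on_eq_continuous_at[OF open_UNIV] isCont_def tendsto_nhds_iff by blast
      then have "((\<lambda>C. Re (x2 C m n / x2 C0 m n)) \<longlongrightarrow> Re (x2 C0 m n / x2 C0 m n)) (nhds C0)"
        using q[OF False] by (intro tendsto_intros)
      then have "((\<lambda>C. Re (x2 C m n / x2 C0 m n)) \<longlongrightarrow> 1) (nhds C0)"
        using q[OF False] by simp
      then have "\<forall>\<^sub>F C in nhds C0. 0 < Re (x2 C m n / x2 C0 m n)"
        by (rule order_tendstoD) simp
      then show ?thesis by (simp add: False)
    qed simp
  qed
  then obtain r where r: "r > 0" "\<And>C m n. C \<in> ball C0 r \<Longrightarrow> m \<noteq> n \<Longrightarrow> Re (x2 C m n / x2 C0 m n) > 0"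
    unfolding eventually_nhds_metric by (auto simp: dist_commute)
  have slit: "x2 C m n / x2 C0 m n \<notin> \<real>\<^sub>\<le>\<^sub>0" if "C \<in> ball C0 r" "m \<noteq> n" for C m n
    using r(2)[OF that] by (auto simp: complex_nonpos_Reals_iff)
  have "C0 islimpt DD" using DL_limit_point_of_DD[OF C0] by (simp add: trivial_limit_within)
  then obtain C1 where C1: "C1 \<in> ball C0 r \<inter> DD"
    using r(1) unfolding islimpt_approachable by (auto simp: dist_commute)
  \<comment> \<open>This constant is a logarithm of \<open>x2 C0 m n\<close>, namely the one reached
    from inside \<open>DD\<close>.\<close>
  define k where "k m n = Ln (x2 C1 m n) - Ln (x2 C1 m n / x2 C0 m n)" for m n
  define l where "l m n C = Ln (x2 C m n / x2 C0 m n) + k m n" for m n and C :: "'n config"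
  have an: "time_analytic_on (l m n) (ball C0 r)" if "m \<noteq> n" for m n
    unfolding l_def using q[OF that] slit[OF _ that]
    by (intro time_analytic_on_add time_analytic_on_Ln time_analytic_on_divide x2_time_analytic time_analytic_on_const) auto
  have xnz: "x2 C m n \<noteq> 0" if "C \<in> ball C0 r" "m \<noteq> n" for C m n
    using r(2)[OF that] by auto
  have ex: "exp (l m n C) = x2 C m n" if "m \<noteq> n" "C \<in> ball C0 r" for m n C
    using xnz[OF that(2,1)] xnz[OF _ that(1), of C1] C1 q[OF that(1)]
    by (simp add: l_def k_def exp_add exp_diff)
  have eq: "l m n C = Ln (x2 C m n)" if mn: "m \<noteq> n" and C: "C \<in> ball C0 r \<inter> DD" for m n C
  proof -
    have "Ln (x2 C m n) - Ln (x2 C m n / x2 C0 m n) = Ln (x2 C1 m n) - Ln (x2 C1 m n / x2 C0 m n)"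
    proof (rule exp_constant_imp_constant[OF _ _ _ C C1])
      show "connected (ball C0 r \<inter> DD)"
        by (intro convex_connected convex_Int convex_ball convex_DD)
      show "continuous_on (ball C0 r \<inter> DD) (\<lambda>C. Ln (x2 C m n) - Ln (x2 C m n / x2 C0 m n))"
        using slit[OF _ mn] DD_x2_slit[OF _ mn] q[OF mn]
        by (intro continuous_intros continuous_on_subset[OF cont]) auto
      show "exp (Ln (x2 C m n) - Ln (x2 C m n / x2 C0 m n)) = x2 C0 m n" if "C \<in> ball C0 r \<inter> DD" for C
        using xnz[OF _ mn, of C] that q[OF mn] by (simp add: exp_diff)
    qed
    then show ?thesis by (simp add: l_def k_def algebra_simps)
  qed
  have "log_x2 C0 m n = l m n C0" if mn: "m \<noteq> n" for m n
    unfolding log_x2_def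
  proof (rule tendsto_Lim[OF DL_limit_point_of_DD[OF C0]])
    have "isCont (l m n) C0"
      using an[OF mn] r(1) by (simp add: time_analytic_on_iff continuous_on_eq_continuous_at)
    then have lim: "(l m n \<longlongrightarrow> l m n C0) (at C0 within DD)"
      unfolding isCont_def by (rule tendsto_within_subset) simp
    have "\<forall>\<^sub>F C in at C0 within DD. C \<in> ball C0 r \<inter> DD"
      unfolding eventually_at using r(1) by (auto simp: dist_commute)
    then have "\<forall>\<^sub>F C in at C0 within DD. l m n C = Ln (x2 C m n)"
      by eventually_elim (rule eq[OF mn])
    with lim show "((\<lambda>C. Ln (x2 C m n)) \<longlongrightarrow> l m n C0) (at C0 within DD)"
      by (rule Lim_transform_eventually)
  qed
  with that[OF r(1) an ex eq] show thesis by blast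
qed

text \<open>Common to the three channels: once F is the value in channel \<sigma> on the part of a
  ball inside \<open>DD\<close>, replacing the principal logarithms by the branches of
  \<open>DL_log_branches\<close> continues it across the boundary.\<close>

lemma (in unitary_cft) extension_at:
  fixes \<O> :: "4 \<Rightarrow> 'op"
  assumes C0: "C0 \<in> DL" and \<sigma>: "\<And>k. \<sigma> (\<sigma> k) = k"
    and slit0: "\<And>z zb. cross_roots (permute_points \<sigma> C0) z zb \<Longrightarrow> z \<notin> complex_of_real ` {1..}"
    and F: "r0 > 0" "\<And>C. C \<in> ball C0 r0 \<inter> DD \<Longrightarrow>
      F C = channel_value T (\<O> \<circ> \<sigma>) (\<lambda>m n. Ln (x2 C (\<sigma> m) (\<sigma> n))) (permute_points \<sigma> C)"
  shows "\<exists>w. analytic_at_with_value F C0 w \<and> given_by_channel T \<O> \<sigma> C0 w"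
proof -
  have ne: "\<sigma> i \<noteq> \<sigma> j" if "i \<noteq> j" for i j using that \<sigma> by metis
  obtain r1 l where r1: "r1 > 0"
    and l: "\<And>m n. m \<noteq> n \<Longrightarrow> time_analytic_on (l m n) (ball C0 r1)"
      "\<And>m n C. m \<noteq> n \<Longrightarrow> C \<in> ball C0 r1 \<Longrightarrow> exp (l m n C) = x2 C m n"
      "\<And>m n C. m \<noteq> n \<Longrightarrow> C \<in> ball C0 r1 \<inter> DD \<Longrightarrow> l m n C = Ln (x2 C m n)"
      "\<And>m n. m \<noteq> n \<Longrightarrow> log_x2 C0 m n = l m n C0"
    using DL_log_branches[OF C0] by blast
  have "isCont cross_u (permute_points \<sigma> C0)" "isCont cross_v (permute_points \<sigma> C0)"
    using C0 ne by (auto intro!: isCont_cross_ratios simp: x2_permute DL_def)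
  then have "\<forall>\<^sub>F C in nhds (permute_points \<sigma> C0). \<forall>z w. cross_roots C z w \<longrightarrow> z \<in> - complex_of_real ` {1..}"
    by (rule eventually_roots_in[OF _ _ open_slit]) (use slit0 in blast)
  then have "\<forall>\<^sub>F C in nhds C0. \<forall>z w. cross_roots (permute_points \<sigma> C) z w \<longrightarrow> z \<in> - complex_of_real ` {1..}"
    by (rule eventually_compose_filterlim)
      (metis continuous_on_permute_points continuous_on_eq_continuous_at isCont_def open_UNIV UNIV_I tendsto_nhds_iff)
  then obtain r2 where r2: "r2 > 0"
      "\<And>C z w. C \<in> ball C0 r2 \<Longrightarrow> cross_roots (permute_points \<sigma> C) z w \<Longrightarrow> z \<notin> complex_of_real ` {1..}"
    unfolding eventually_nhds_metric by (force simp: dist_commute)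
  define U where "U = ball C0 (min r0 (min r1 r2))"
  have U: "open U" "C0 \<in> U" "U \<subseteq> ball C0 r0" "U \<subseteq> ball C0 r1" "U \<subseteq> ball C0 r2"
    using F(1) r1 r2(1) by (auto simp: U_def)
  define H where "H C = channel_value T (\<O> \<circ> \<sigma>) (\<lambda>i j. l (\<sigma> i) (\<sigma> j) C) (permute_points \<sigma> C)" for C
  \<comment> \<open>The branches are controlled only for distinct points, and a channel value
    contains no others.\<close>
  have cong: "channel_value T (\<O> \<circ> \<sigma>) lg C = channel_value T (\<O> \<circ> \<sigma>) lg' C"
    if "\<And>m n. m \<noteq> n \<Longrightarrow> lg m n = lg' m n" for lg lg' C
    using that by (simp add: channel_value_def cft_prefactor_def prefactor_def log_rho_rhob_def)
  have H: "time_analytic_on H U"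
    unfolding H_def using U
    by (intro permuted_channel_analytic[OF U(1) \<sigma> time_analytic_on_subset[OF l(1) U(4)] l(2) r2(2)]) auto
  have HF: "H C = F C" if "C \<in> U \<inter> DD" for C
    unfolding H_def using F(2)[of C] that U
    by (subst F(2)) (auto intro!: cong l(3) ne)
  have "((\<lambda>\<epsilon>. F (time_shift \<epsilon> C0)) \<longlongrightarrow> H C0)
      (at 0 within {\<epsilon>. \<epsilon> $ 1 > \<epsilon> $ 2 \<and> \<epsilon> $ 2 > \<epsilon> $ 3 \<and> \<epsilon> $ 3 > \<epsilon> $ 4})" (is "(_ \<longlongrightarrow> _) (at 0 within ?E)")
  proof (rule Lim_transform_eventually)
    have "isCont H C0"
      using H U(1,2) by (simp add: time_analytic_on_iff continuous_on_eq_continuous_at)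
    then show "((\<lambda>\<epsilon>. H (time_shift \<epsilon> C0)) \<longlongrightarrow> H C0) (at 0 within ?E)"
      by (rule isCont_tendsto_compose[OF _ time_shift_tendsto])
    have "\<forall>\<^sub>F \<epsilon> in at 0 within ?E. time_shift \<epsilon> C0 \<in> U"
      using time_shift_tendsto U(1,2) by (rule topological_tendstoD)
    moreover have "\<forall>\<^sub>F \<epsilon> in at 0 within ?E. \<epsilon> \<in> ?E"
      by (simp add: eventually_at_filter)
    ultimately show "\<forall>\<^sub>F \<epsilon> in at 0 within ?E. H (time_shift \<epsilon> C0) = F (time_shift \<epsilon> C0)"
    proof eventually_elim
      case (elim \<epsilon>)
      moreover have "time_shift \<epsilon> C0 \<in> DD"
        using elim(2) C0 by (simp add: time_shift_def DD_def DL_def)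
      ultimately show ?case by (intro HF) auto
    qed
  qed
  then have "analytic_at_with_value F C0 (H C0)"
    unfolding analytic_at_with_value_def time_shift_def using U H HF by blast
  moreover have "given_by_channel T \<O> \<sigma> C0 (H C0)"
    unfolding given_by_channel_def Let_def
  proof (intro allI impI)
    fix z zb assume r: "cross_roots (permute_points \<sigma> C0) z zb"
    define lg where "lg m n = log_x2 C0 (\<sigma> m) (\<sigma> n)" for m n
    have lg: "exp (lg m n) = x2 (permute_points \<sigma> C0) m n" if "m \<noteq> n" for m n
      using l(2,4)[OF ne[OF that]] r1 by (simp add: lg_def x2_permute)
    have "H C0 = channel_value T (\<O> \<circ> \<sigma>) lg (permute_points \<sigma> C0)"
      unfolding H_def by (intro cong) (simp add: lg_def l(4) ne)
    moreover obtain S where "((\<lambda>(P, \<psi>). of_real (coef T ((\<O> \<circ> \<sigma>) 1) ((\<O> \<circ> \<sigma>) 2) ((\<O> \<circ> \<sigma>) 3) ((\<O> \<circ> \<sigma>) 4) P \<psi>)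
         * rho_monomial (log_rho_rhob lg z zb) (rho z) (hwt T \<psi>) (hbwt T \<psi>)) has_sum S) (states T)"
      "channel_value T (\<O> \<circ> \<sigma>) lg (permute_points \<sigma> C0) = prefactor (sdim T ((\<O> \<circ> \<sigma>) 1)) (sdim T ((\<O> \<circ> \<sigma>) 2))
         (sdim T ((\<O> \<circ> \<sigma>) 3)) (sdim T ((\<O> \<circ> \<sigma>) 4)) lg * S"
      by (rule channel_value_has_sum[where q = "\<O> \<circ> \<sigma>", OF lg _ r]) (use slit0 in blast)+
    ultimately show "\<exists>S. ((\<lambda>(P, \<psi>). of_real (coef T (\<O> (\<sigma> 1)) (\<O> (\<sigma> 2)) (\<O> (\<sigma> 3)) (\<O> (\<sigma> 4)) P \<psi>)
           * rho_monomial (log_rho_rhob (\<lambda>m n. log_x2 C0 (\<sigma> m) (\<sigma> n)) z zb) (rho z) (hwt T \<psi>) (hbwt T \<psi>)) has_sum S) (states T) \<and>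
        H C0 = prefactor (sdim T (\<O> (\<sigma> 1))) (sdim T (\<O> (\<sigma> 2))) (sdim T (\<O> (\<sigma> 3))) (sdim T (\<O> (\<sigma> 4)))
           (\<lambda>m n. log_x2 C0 (\<sigma> m) (\<sigma> n)) * S"
      by (auto simp: lg_def[abs_def])
  qed
  ultimately show ?thesis by blast
qed

section \<open>Crossing numbers and logarithms\<close>

text \<open>Isolates the jump at the negative axis, across which Ln (- w) is continuous.\<close>

lemma Ln_of_negative_Re:
  assumes "Re w < 0" "Im w \<noteq> 0"
  shows "Ln w = Ln (- w) + \<i> * of_real (pi * sgn (Im w))"
  using assms Ln_minus[of "- w"] by (auto simp: sgn_real_def complex_eq_iff)

lemma crosses_eventually_iff:
  assumes d: "d > 0" and L: "\<And>x. x \<in> {t - d<..<t} \<Longrightarrow> sgn (Im (f x)) = sL"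
    and R: "\<And>x. x \<in> {t<..<t + d} \<Longrightarrow> sgn (Im (f x)) = sR" and s: "sL \<in> {1, - 1}" "sR \<in> {1, - 1}"
    and ft: "f t \<in> complex_of_real ` I"
  shows "crosses_from_above f I t \<longleftrightarrow> sL = 1 \<and> sR = - 1" "crosses_from_below f I t \<longleftrightarrow> sL = - 1 \<and> sR = 1"
proof -
  have eL: "\<forall>\<^sub>F x in at_left t. sgn (Im (f x)) = sL"
    unfolding eventually_at_left_field using d L by (intro exI[of _ "t - d"]) auto
  have eR: "\<forall>\<^sub>F x in at_right t. sgn (Im (f x)) = sR"
    unfolding eventually_at_right_field using d R by (intro exI[of _ "t + d"]) auto
  have L': "(\<forall>\<^sub>F x in at_left t. Im (f x) > 0) \<longleftrightarrow> sL = 1" "(\<forall>\<^sub>F x in at_left t. Im (f x) < 0) \<longleftrightarrow> sL = - 1"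
  proof -
    have "\<not> (\<forall>\<^sub>F x in at_left t. Im (f x) > 0 \<and> Im (f x) < 0)"
      by (auto dest!: eventually_happens'[OF trivial_limit_at_left_real])
    moreover have "sL = 1 \<Longrightarrow> \<forall>\<^sub>F x in at_left t. Im (f x) > 0" "sL = - 1 \<Longrightarrow> \<forall>\<^sub>F x in at_left t. Im (f x) < 0"
      using eL by (auto elim!: eventually_mono simp: sgn_1_pos sgn_1_neg)
    ultimately show "(\<forall>\<^sub>F x in at_left t. Im (f x) > 0) \<longleftrightarrow> sL = 1" "(\<forall>\<^sub>F x in at_left t. Im (f x) < 0) \<longleftrightarrow> sL = - 1"
      using s eventually_conj by fastforce+
  qed
  have R': "(\<forall>\<^sub>F x in at_right t. Im (f x) > 0) \<longleftrightarrow> sR = 1" "(\<forall>\<^sub>F x in at_right t. Im (f x) < 0) \<longleftrightarrow> sR = - 1"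
  proof -
    have "\<not> (\<forall>\<^sub>F x in at_right t. Im (f x) > 0 \<and> Im (f x) < 0)"
      by (auto dest!: eventually_happens'[OF trivial_limit_at_right_real])
    moreover have "sR = 1 \<Longrightarrow> \<forall>\<^sub>F x in at_right t. Im (f x) > 0" "sR = - 1 \<Longrightarrow> \<forall>\<^sub>F x in at_right t. Im (f x) < 0"
      using eR by (auto elim!: eventually_mono simp: sgn_1_pos sgn_1_neg)
    ultimately show "(\<forall>\<^sub>F x in at_right t. Im (f x) > 0) \<longleftrightarrow> sR = 1" "(\<forall>\<^sub>F x in at_right t. Im (f x) < 0) \<longleftrightarrow> sR = - 1"
      using s eventually_conj by fastforce+
  qed
  show "crosses_from_above f I t \<longleftrightarrow> sL = 1 \<and> sR = - 1" "crosses_from_below f I t \<longleftrightarrow> sL = - 1 \<and> sR = 1"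
    using ft by (auto simp: crosses_from_above_def crosses_from_below_def L' R')
qed

lemma sgn_Im_constant:
  fixes f :: "real \<Rightarrow> complex"
  assumes X: "connected X" and f: "continuous_on X f" and nz: "\<And>x. x \<in> X \<Longrightarrow> Im (f x) \<noteq> 0"
  obtains s where "s \<in> {1, - 1}" "\<And>x. x \<in> X \<Longrightarrow> sgn (Im (f x)) = s"
proof -
  have "connected ((\<lambda>x. Im (f x)) ` X)"
    by (intro connected_continuous_image continuous_intros f X)
  then have "is_interval ((\<lambda>x. Im (f x)) ` X)" by (simp add: is_interval_connected_1)
  then have between: "\<And>a b x. a \<in> (\<lambda>x. Im (f x)) ` X \<Longrightarrow> b \<in> (\<lambda>x. Im (f x)) ` X \<Longrightarrow> a \<le> x \<Longrightarrow> x \<le> b \<Longrightarrow> x \<in> (\<lambda>x. Im (f x)) ` X"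
    unfolding is_interval_1 by blast
  have "\<not> (Im (f x) < 0 \<and> Im (f y) > 0)" if "x \<in> X" "y \<in> X" for x y
    using between[of "Im (f x)" "Im (f y)" 0] that nz by fastforce
  then consider "\<And>x. x \<in> X \<Longrightarrow> Im (f x) > 0" | "\<And>x. x \<in> X \<Longrightarrow> Im (f x) < 0"
    using nz by (meson linorder_neqE_linordered_idom)
  then show thesis
    by cases (auto intro: that[of 1] that[of "- 1"])
qed

text \<open>
  The continuous logarithm \<open>g\<close> and the principal one differ by \<open>2 \<pi> i\<close> times the number of signed
  crossings of the cut so far: this difference stays constant when passing any single time.
\<close>

lemma continuous_log_crossings:
  fixes f g :: "real \<Rightarrow> complex"
  assumes a: "0 \<le> a" and f: "continuous_on {0..a} f" and g: "continuous_on {0..a} g"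
    and fg: "\<And>s. s \<in> {0..a} \<Longrightarrow> exp (g s) = f s"
    and fin: "finite {s \<in> {0..a}. f s \<in> complex_of_real ` {..<0}}"
    and ends: "f 0 \<notin> complex_of_real ` {..<0}" "f a \<notin> complex_of_real ` {..<0}"
    and g0: "g 0 = Ln (f 0)"
  shows "g a = Ln (f a) + 2 * of_real pi * \<i> * of_int
    (int (card {s \<in> {0<..<a}. crosses_from_above f {..<0} s}) - int (card {s \<in> {0<..<a}. crosses_from_below f {..<0} s}))"
proof -
  define H where "H = {s \<in> {0..a}. f s \<in> complex_of_real ` {..<0}}"
  define P where "P t = {s \<in> {0<..<t}. crosses_from_above f {..<0} s}" for t
  define Q where "Q t = {s \<in> {0<..<t}. crosses_from_below f {..<0} s}" for t
  define V where "V t = g t - Ln (f t) - 2 * of_real pi * \<i> * of_int (int (card (P t)) - int (card (Q t)))" for t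
  have crossH: "s \<in> H" if "crosses_from_above f {..<0} s \<or> crosses_from_below f {..<0} s" "s \<in> {0..a}" for s
    using that by (auto simp: H_def crosses_from_above_def crosses_from_below_def)
  have PH: "P t \<subseteq> H" "Q t \<subseteq> H" if "t \<le> a" for t
    using that by (auto simp: P_def Q_def intro!: crossH)
  have finP: "finite (P t)" "finite (Q t)" if "t \<le> a" for t
    using PH[OF that] fin unfolding H_def by (auto intro: finite_subset)
  have fnz: "f s \<noteq> 0" if "s \<in> {0..a}" for s using fg[OF that] by (metis exp_not_eq_zero)
  have neg: "w \<in> complex_of_real ` {..<0} \<longleftrightarrow> Im w = 0 \<and> Re w < 0" for w
    by (auto simp: complex_eq_iff image_iff)
  have "V 0 = V a"
  \<comment> \<open>V is compared only at times off the cut. These are dense, as H is finite, so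
    local constancy among them yields V 0 = V a.\<close>
  proof (rule connected_equivalence_relation_gen[of "{0..a}" 0 a "\<lambda>x. x \<notin> H" "\<lambda>x y. V x = V y"])
    show "connected {0..a}" "0 \<in> {0..a}" "a \<in> {0..a}" "0 \<notin> H" "a \<notin> H"
      using a ends by (auto simp: H_def)
    show "V x = V z" if "V x = V y" "V y = V z" for x y z using that by simp
    show "\<exists>z. z \<in> T \<and> z \<notin> H" if T: "openin (top_of_set {0..a}) T" "t \<in> T" for T t
    proof (cases "a = 0")
      case True
      then have "t = 0" using openin_imp_subset[OF T(1)] T(2) by auto
      then show ?thesis using T ends by (auto simp: H_def)
    next
      case False
      have tS: "t \<in> {0..a}" using openin_imp_subset[OF T(1)] T(2) by auto
      obtain e where e: "e > 0" "ball t e \<inter> {0..a} \<subseteq> T"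
        using T unfolding openin_contains_ball by blast
      have "infinite {max 0 (t - e)<..<min a (t + e)}"
        using e(1) tS False a by (intro infinite_Ioo) auto
      then obtain z where "z \<in> {max 0 (t - e)<..<min a (t + e)}" "z \<notin> H"
        using fin unfolding H_def[symmetric] by (meson finite_subset subsetI)
      then show ?thesis using e(2) by (intro exI[of _ z]) (auto simp: dist_real_def)
    qed
    show "\<exists>T. openin (top_of_set {0..a}) T \<and> t \<in> T \<and> (\<forall>x\<in>T. \<forall>y\<in>T. x \<notin> H \<and> y \<notin> H \<longrightarrow> V x = V y)"
      if t: "t \<in> {0..a}" for t
    proof (cases "t \<in> H")
      case False
      have slit: "f s \<notin> \<real>\<^sub>\<le>\<^sub>0" if "s \<in> {0..a}" "s \<notin> H" for s
        using that fnz[OF that(1)] by (auto simp: H_def neg complex_nonpos_Reals_iff complex_eq_iff)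
      have "open (- H)" using fin by (simp add: H_def finite_imp_closed open_Compl)
      then obtain d where d: "d > 0" "ball t d \<subseteq> - H" using False by (meson ComplI openE)
      define T where "T = {0..a} \<inter> ball t d"
      have TH: "s \<notin> H" if "s \<in> T" for s using that d(2) by (auto simp: T_def)
      have conv: "convex T" unfolding T_def by (intro convex_Int convex_ball) simp
      have const: "g x - Ln (f x) = g y - Ln (f y)" if "x \<in> T" "y \<in> T" for x y
      proof (rule exp_constant_imp_constant[OF convex_connected[OF conv] _ _ that])
        show "continuous_on T (\<lambda>x. g x - Ln (f x))"
          by (intro continuous_intros continuous_on_subset[OF f] continuous_on_subset[OF g])
            (use slit TH in \<open>auto simp: T_def\<close>)
        show "exp (g x - Ln (f x)) = 1" if "x \<in> T" for x
          using that fg fnz by (simp add: T_def exp_diff)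
      qed
      have PQ: "P x = P y \<and> Q x = Q y" if xy: "x \<in> T" "y \<in> T" "x \<le> y" for x y
      proof -
        have "s < x" if "s \<in> {0<..<y}" "crosses_from_above f {..<0} s \<or> crosses_from_below f {..<0} s" for s
        proof (rule ccontr)
          assume "\<not> s < x"
          then have "s \<in> closed_segment x y" using that(1) by (simp add: closed_segment_eq_real_ivl)
          then have "s \<in> T" using conv xy by (meson convex_contains_segment subsetD)
          then show False using TH crossH[OF that(2)] by (auto simp: T_def)
        qed
        then show ?thesis using xy(3) by (auto simp: P_def Q_def)
      qed
      have "V x = V y" if xy: "x \<in> T" "y \<in> T" for x y
        using PQ[OF xy] PQ[OF xy(2,1)] const[OF xy] unfolding V_def by (metis linear)
      moreover have "openin (top_of_set {0..a}) T" "t \<in> T"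
        unfolding T_def using t d(1) by (auto intro: openin_open_Int)
      ultimately show ?thesis by blast
    next
      case True
      have ft: "Im (f t) = 0" "Re (f t) < 0" using True by (auto simp: H_def neg)
      have ta: "0 < t" "t < a"
        using True t ends by (auto simp: H_def order.order_iff_strict)
      have "continuous_on {0<..<a} f" by (rule continuous_on_subset[OF f]) auto
      then have "open ({0<..<a} \<inter> (\<lambda>s. Re (f s)) -` {..<0})"
        by (intro continuous_open_preimage continuous_intros) auto
      moreover have "finite (H - {t})" using fin by (simp add: H_def)
      then have "open (- (H - {t}))" by (intro open_Compl finite_imp_closed)
      ultimately have "open ({0<..<a} \<inter> (\<lambda>s. Re (f s)) -` {..<0} \<inter> - (H - {t}))" by blast
      then obtain d where d: "d > 0" "ball t d \<subseteq> {0<..<a} \<inter> (\<lambda>s. Re (f s)) -` {..<0} \<inter> - (H - {t})"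
        using ta ft by (force elim: openE)
      define T where "T = {t - d<..<t + d}"
      have T: "T = ball t d" by (auto simp: T_def dist_real_def)
      have Tin: "s \<in> {0<..<a}" "Re (f s) < 0" "s \<noteq> t \<Longrightarrow> s \<notin> H" if "s \<in> T" for s
        using that d(2) unfolding T by auto
      have Im: "Im (f s) \<noteq> 0" if "s \<in> T" "s \<noteq> t" for s
        using Tin[OF that(1)] that(2) by (auto simp: H_def neg)
      have fT: "continuous_on T f" "continuous_on T g"
        using Tin by (auto intro!: continuous_on_subset[OF f] continuous_on_subset[OF g] simp: less_imp_le)
      obtain sL where sL: "sL \<in> {1, - 1}" "\<And>x. x \<in> {t - d<..<t} \<Longrightarrow> sgn (Im (f x)) = sL"
      proof (rule sgn_Im_constant[of "{t - d<..<t}" f])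
        show "continuous_on {t - d<..<t} f"
          by (rule continuous_on_subset[OF fT(1)]) (use d(1) in \<open>auto simp: T_def\<close>)
        show "Im (f x) \<noteq> 0" if "x \<in> {t - d<..<t}" for x
          using Im[of x] that d(1) by (auto simp: T_def)
      qed auto
      obtain sR where sR: "sR \<in> {1, - 1}" "\<And>x. x \<in> {t<..<t + d} \<Longrightarrow> sgn (Im (f x)) = sR"
      proof (rule sgn_Im_constant[of "{t<..<t + d}" f])
        show "continuous_on {t<..<t + d} f"
          by (rule continuous_on_subset[OF fT(1)]) (use d(1) in \<open>auto simp: T_def\<close>)
        show "Im (f x) \<noteq> 0" if "x \<in> {t<..<t + d}" for x
          using Im[of x] that d(1) by (auto simp: T_def)
      qed auto
      have ftI: "f t \<in> complex_of_real ` {..<0}" using ft by (simp add: neg)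
      note cr = crosses_eventually_iff[where f = f and t = t and I = "{..<0}", OF d(1) sL(2) sR(2) sL(1) sR(1) ftI]
      have only: "s = t" if "s \<in> T" "crosses_from_above f {..<0} s \<or> crosses_from_below f {..<0} s" for s
        using that Tin crossH[of s] by (meson atLeastAtMost_iff greaterThanLessThan_iff less_imp_le)
      have PQl: "P x = P t" "Q x = Q t" if "x \<in> {t - d<..<t}" for x
      proof -
        have "s < x" if "s \<in> {0<..<t}" "crosses_from_above f {..<0} s \<or> crosses_from_below f {..<0} s" for s
          using only[OF _ that(2)] that(1) \<open>x \<in> _\<close> d(1) by (force simp: T_def)
        then show "P x = P t" "Q x = Q t" using that by (auto simp: P_def Q_def)
      qed
      have PQr: "P x = (if sL = 1 \<and> sR = - 1 then insert t (P t) else P t)"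
          "Q x = (if sL = - 1 \<and> sR = 1 then insert t (Q t) else Q t)" if x: "x \<in> {t<..<t + d}" for x
      proof -
        have le: "s \<le> t" if "s \<in> {0<..<x}" "crosses_from_above f {..<0} s \<or> crosses_from_below f {..<0} s" for s
        proof (rule ccontr)
          assume "\<not> s \<le> t"
          then have "s \<in> T" using that(1) x d(1) by (auto simp: T_def)
          then show False using only[OF _ that(2)] \<open>\<not> s \<le> t\<close> by auto
        qed
        have "s \<in> P x \<longleftrightarrow> s \<in> P t \<or> s = t \<and> crosses_from_above f {..<0} t" for s
          using x ta le[of s] unfolding P_def by (cases s t rule: linorder_cases) auto
        then show "P x = (if sL = 1 \<and> sR = - 1 then insert t (P t) else P t)"
          using cr by auto
        have "s \<in> Q x \<longleftrightarrow> s \<in> Q t \<or> s = t \<and> crosses_from_below f {..<0} t" for s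
          using x ta le[of s] unfolding Q_def by (cases s t rule: linorder_cases) auto
        then show "Q x = (if sL = - 1 \<and> sR = 1 then insert t (Q t) else Q t)"
          using cr by auto
      qed
      have "t \<notin> P t" "t \<notin> Q t" by (auto simp: P_def Q_def)
      \<comment> \<open>The increment is (sL - sR) / 2. In V it cancels the change i pi (sR - sL) of
        Ln f; touching the cut without changing sides has sL = sR and counts nothing.\<close>
      then have jump: "int (card (P x)) - int (card (Q x)) = int (card (P t)) - int (card (Q t))
          + (if sL = 1 \<and> sR = - 1 then 1 else if sL = - 1 \<and> sR = 1 then - 1 else 0)"
        if "x \<in> {t<..<t + d}" for x
        unfolding PQr[OF that] using finP[of t] ta by auto
      define k where "k = g t - Ln (- f t)"
      have k: "g x - Ln (- f x) = k" if "x \<in> T" for x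
        unfolding k_def
      proof (rule exp_constant_imp_constant[of T "\<lambda>x. g x - Ln (- f x)"])
        show "connected T" by (simp add: T_def)
        show "continuous_on T (\<lambda>x. g x - Ln (- f x))"
          by (intro continuous_intros fT) (use Tin(2) in \<open>fastforce simp: complex_nonpos_Reals_iff\<close>)
        show "exp (g x - Ln (- f x)) = - 1" if "x \<in> T" for x
          using Tin(1)[OF that] fg[of x] fnz[of x] by (simp add: exp_diff)
      qed (use that d(1) in \<open>auto simp: T_def\<close>)
      define K where "K = k - \<i> * of_real (pi * sL) - 2 * of_real pi * \<i> * of_int (int (card (P t)) - int (card (Q t)))"
      have "V x = K" if xT: "x \<in> T" and xH: "x \<notin> H" for x
      proof -
        have "x \<noteq> t" using xH True by auto
        then have Ln: "g x - Ln (f x) = k - \<i> * of_real (pi * sgn (Im (f x)))"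
          using Ln_of_negative_Re[OF Tin(2)[OF xT] Im[OF xT]] k[OF xT] by (simp add: algebra_simps)
        consider "x \<in> {t - d<..<t}" | "x \<in> {t<..<t + d}"
          using \<open>x \<noteq> t\<close> xT by (force simp: T_def)
        then show ?thesis
        proof cases
          case 1
          then show ?thesis using Ln sL(2)[OF 1] PQl[OF 1] by (simp add: V_def K_def)
        next
          case 2
          then show ?thesis
            unfolding V_def K_def jump[OF 2] Ln sR(2)[OF 2] using sL(1) sR(1)
            by (auto simp: algebra_simps)
        qed
      qed
      moreover have "openin (top_of_set {0..a}) T"
      proof (rule open_subset)
        show "T \<subseteq> {0..a}" using Tin(1) by fastforce
      qed (simp add: T_def)
      moreover have "t \<in> T" using d(1) by (simp add: T_def)
      ultimately show ?thesis by (intro exI[of _ T]) simp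
    qed
  qed
  moreover have "V 0 = 0" by (simp add: V_def g0 P_def Q_def)
  ultimately show ?thesis by (simp add: V_def P_def Q_def algebra_simps)
qed

section \<open>Crossing symmetry\<close>

definition log_u :: "(4 \<Rightarrow> 4 \<Rightarrow> complex) \<Rightarrow> complex" where
  "log_u l = l 1 2 + l 3 4 - l 1 3 - l 2 4"

definition log_v :: "(4 \<Rightarrow> 4 \<Rightarrow> complex) \<Rightarrow> complex" where
  "log_v l = l 1 4 + l 2 3 - l 1 3 - l 2 4"

abbreviation ln_x2 :: "'n::finite config \<Rightarrow> 4 \<Rightarrow> 4 \<Rightarrow> complex" where
  "ln_x2 C m n \<equiv> Ln (x2 C m n)"

lemma ln_x2_commute: "ln_x2 C m n = ln_x2 C n m"
  by (simp add: x2_commute)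

lemma exp_log_u_v:
  assumes x: "\<And>m n. m \<noteq> n \<Longrightarrow> x2 C m n \<noteq> 0" and r: "cross_roots C z zb"
  shows "exp (log_u (ln_x2 C)) = z * zb" "exp (log_v (ln_x2 C)) = (1 - z) * (1 - zb)"
  using r by (simp_all add: log_u_def log_v_def exp_add exp_diff x cross_roots_def cross_u_def cross_v_def)

text \<open>On Euclidean configurations log u and log v are real while the roots are conjugate. So
  any logarithm k of a root, on whatever branch, must be paired with its conjugate for the other
  root.\<close>

lemma euclid_log_u_v:
  assumes C: "C \<in> euclidean_configs" and r: "cross_roots C z zb"
  shows "exp k = z \<Longrightarrow> log_u (ln_x2 C) = k + cnj k" "exp k = 1 - z \<Longrightarrow> log_v (ln_x2 C) = k + cnj k"
proof -
  have x: "x2 C m n \<noteq> 0" if "m \<noteq> n" for m n using C that by (auto simp: euclidean_configs_def)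
  have "Im (ln_x2 C m n) = 0" if "m \<noteq> n" for m n
    using euclid_x2_pos[OF C that] by (metis Im_complex_of_real Ln_of_real)
  then have im: "Im (log_u (ln_x2 C)) = 0" "Im (log_v (ln_x2 C)) = 0"
    by (simp_all add: log_u_def log_v_def)
  have real: "s = k + cnj k" if "Im s = 0" "exp s = exp k * cnj (exp k)" for s k :: complex
  proof -
    have "exp s = exp (k + cnj k)" using that(2) by (simp add: exp_add exp_cnj)
    then have "norm (exp s) = norm (exp (k + cnj k))" by simp
    then show ?thesis using that(1) by (simp add: complex_eq_iff)
  qed
  show "exp k = z \<Longrightarrow> log_u (ln_x2 C) = k + cnj k" "exp k = 1 - z \<Longrightarrow> log_v (ln_x2 C) = k + cnj k"
    using im real exp_log_u_v[OF x r] euclid_roots_conjugate[OF C r] by auto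
qed

lemma log_rho_rhob_eq:
  "log_rho_rhob l z zb = log_u l - 2 * Ln (1 + csqrt (1 - z)) - 2 * Ln (1 + csqrt (1 - zb))"
  by (simp add: log_rho_rhob_def log_u_def)

text \<open>Turns a logarithm k of z into one of rho z, by rho z = z / (1 + csqrt (1 -
  z))^2.\<close>

definition log_rho :: "complex \<Rightarrow> complex \<Rightarrow> complex" where
  "log_rho k z = k - 2 * Ln (1 + csqrt (1 - z))"

lemma exp_log_rho: "exp k = z \<Longrightarrow> exp (log_rho k z) = rho z"
  unfolding log_rho_def exp_diff exp_double rho_eq by (simp add: one_plus_csqrt_nonzero)

lemma log_rho_add: "log_u l = k + k' \<Longrightarrow> log_rho k z + log_rho k' zb = log_rho_rhob l z zb"
  by (simp add: log_rho_def log_rho_rhob_eq)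

lemma holomorphic_log_rho:
  assumes "k holomorphic_on S" "f holomorphic_on S" "\<And>z. z \<in> S \<Longrightarrow> f z \<notin> complex_of_real ` {1..}"
  shows "(\<lambda>z. log_rho (k z) (f z)) holomorphic_on S"
proof -
  have c: "(\<lambda>z. csqrt (1 - f z)) holomorphic_on S"
    by (intro holomorphic_on_csqrt' holomorphic_intros assms(2)) (use assms(3) in \<open>simp add: slit_iff\<close>)
  have "(\<lambda>z. Ln (1 + csqrt (1 - f z))) holomorphic_on S"
    by (intro holomorphic_on_Ln' holomorphic_intros c one_plus_csqrt_slit)
  then show ?thesis
    unfolding log_rho_def by (intro holomorphic_on_diff holomorphic_on_mult holomorphic_on_const assms(1))
qed

text \<open>
  \<open>lam1\<close> and \<open>lam2\<close> are the logarithms used for the first and the second root; they differ in the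
  u-channel, where the arguments are taken in \<open>(0, 2 \<pi>)\<close> and \<open>(-2 \<pi>, 0)\<close>, as is forced by conjugate roots
  with real \<open>log u\<close>.  \<open>zet\<close> maps a root to the root of the other channel, with logarithms \<open>kap1\<close>, \<open>kap2\<close>.
\<close>

locale crossing_domain =
  fixes D :: "complex set" and lam1 lam2 kap1 kap2 zet :: "complex \<Rightarrow> complex" and p :: real
  assumes D: "open D" "connected D" "of_real p \<in> D"
    and slit: "\<And>z. z \<in> D \<Longrightarrow> z \<notin> complex_of_real ` {1..}" "\<And>z. z \<in> D \<Longrightarrow> zet z \<notin> complex_of_real ` {1..}"
    and hol: "lam1 holomorphic_on D" "lam2 holomorphic_on D" "kap1 holomorphic_on D" "kap2 holomorphic_on D" "zet holomorphic_on D"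
    and logs: "\<And>z. z \<in> D \<Longrightarrow> exp (lam1 z) = z" "\<And>z. z \<in> D \<Longrightarrow> exp (lam2 z) = z"
      "\<And>z. z \<in> D \<Longrightarrow> exp (kap1 z) = zet z" "\<And>z. z \<in> D \<Longrightarrow> exp (kap2 z) = zet z"
    and conj: "\<And>z. z \<in> D \<Longrightarrow> lam2 (cnj z) = cnj (lam1 z)" "\<And>z. z \<in> D \<Longrightarrow> kap2 (cnj z) = cnj (kap1 z)"
      "\<And>z. z \<in> D \<Longrightarrow> zet (cnj z) = cnj (zet z)" "\<And>z. z \<in> D \<Longrightarrow> cnj z \<in> D"
    and lam_sym: "\<And>z w. lam1 z + lam2 w = lam1 w + lam2 z"

text \<open>\<alpha> and \<beta> are the exponents of u and v in the ratio of the two kinematic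
  prefactors. \<open>log_u_\<sigma>\<close> covers two mechanisms: the exchange of points turns log
  u into log v in the t-channel and into - log u in the u-channel.\<close>

locale crossing = unitary_cft T + crossing_domain D lam1 lam2 kap1 kap2 zet p
  for T :: "('op, 'p, 's, 'n::finite) cft" and D lam1 lam2 kap1 kap2 zet p +
  fixes \<sigma> :: "4 \<Rightarrow> 4" and q :: "4 \<Rightarrow> 'op" and \<alpha> \<beta> :: real
  assumes \<sigma>: "\<And>k. \<sigma> (\<sigma> k) = k"
    and roots: "\<And>(C :: 'n config) z zb. (\<And>m n. m \<noteq> n \<Longrightarrow> x2 C m n \<noteq> 0) \<Longrightarrow> cross_roots C z zb
      \<Longrightarrow> cross_roots (permute_points \<sigma> C) (zet z) (zet zb)"
    and prefactors: "\<And>l. (\<And>m n. l m n = l n m) \<Longrightarrow>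
      cft_prefactor T q l = cft_prefactor T (q \<circ> \<sigma>) (\<lambda>m n. l (\<sigma> m) (\<sigma> n)) * exp (of_real \<alpha> * log_u l + of_real \<beta> * log_v l)"
    and log_u_\<sigma>: "\<And>l z zb. (\<And>m n. l m n = l n m) \<Longrightarrow> log_u l = lam1 z + lam2 zb \<Longrightarrow> log_v l = Ln (1 - z) + Ln (1 - zb)
      \<Longrightarrow> log_u (\<lambda>m n. l (\<sigma> m) (\<sigma> n)) = kap1 z + kap2 zb"
begin

text \<open>Each z in D is a root of some Euclidean configuration. There both channel sums converge
  to the same correlator, by order independence, and the nonzero prefactor of the second channel
  cancels.\<close>

lemma crossing_on_antidiagonal:
  assumes z: "z \<in> D"
  shows "exp (of_real \<alpha> * (lam1 z + lam2 (cnj z)) + of_real \<beta> * (Ln (1 - z) + Ln (1 - cnj z)))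
      * cft_psi T q (log_rho (lam1 z) z) (log_rho (lam2 (cnj z)) (cnj z))
    = cft_psi T (q \<circ> \<sigma>) (log_rho (kap1 z) (zet z)) (log_rho (kap2 (cnj z)) (zet (cnj z)))"
proof -
  \<comment> \<open>0 is not an exponential; 1 and 2 lie on the cut.\<close>
  have z012: "z \<noteq> 0" "z \<noteq> 1" "z \<noteq> 2"
    using logs(1)[OF z] slit(1)[OF z] by (auto simp: complex_slot_right_eq)
  obtain C :: "'n config" where C: "C \<in> euclidean_configs" and r: "cross_roots C z (cnj z)"
    using euclid_config_with_roots[OF z012] .
  have x: "x2 C m n \<noteq> 0" if "m \<noteq> n" for m n using C that by (auto simp: euclidean_configs_def)
  have ne: "\<sigma> i \<noteq> \<sigma> j" if "i \<noteq> j" for i j using that \<sigma> by metis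
  have C': "permute_points \<sigma> C \<in> euclidean_configs"
    using C ne unfolding euclidean_configs_def by (auto simp: x2_permute) (simp add: permute_points_def)
  have r': "cross_roots (permute_points \<sigma> C) (zet z) (zet (cnj z))"
    by (rule roots[OF x r])
  have lu: "log_u (ln_x2 C) = lam1 z + lam2 (cnj z)"
    using euclid_log_u_v(1)[OF C r logs(1)[OF z]] conj(1)[OF z] by simp
  have "cnj (Ln (1 - z)) = Ln (1 - cnj z)"
    using cnj_Ln[of "1 - z"] slit(1)[OF z] by (simp add: slit_iff)
  then have lv: "log_v (ln_x2 C) = Ln (1 - z) + Ln (1 - cnj z)"
    using euclid_log_u_v(2)[OF C r, of "Ln (1 - z)"] z012 by simp
  have lu': "log_u (ln_x2 (permute_points \<sigma> C)) = kap1 z + kap2 (cnj z)"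
    using log_u_\<sigma>[OF ln_x2_commute lu lv] by (simp add: x2_permute log_u_def)
  have s: "corr T (q 1) (q 2) (q 3) (q 4) C = cft_prefactor T q (ln_x2 C)
      * cft_psi T q (log_rho (lam1 z) z) (log_rho (lam2 (cnj z)) (cnj z))"
    by (rule corr_eq_channel_value[OF C r slit(1)[OF z] exp_log_rho[OF logs(1)[OF z]] log_rho_add[OF lu]])
  have "corr T ((q \<circ> \<sigma>) 1) ((q \<circ> \<sigma>) 2) ((q \<circ> \<sigma>) 3) ((q \<circ> \<sigma>) 4) (permute_points \<sigma> C)
      = cft_prefactor T (q \<circ> \<sigma>) (ln_x2 (permute_points \<sigma> C))
      * cft_psi T (q \<circ> \<sigma>) (log_rho (kap1 z) (zet z)) (log_rho (kap2 (cnj z)) (zet (cnj z)))"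
    by (rule corr_eq_channel_value[OF C' r' slit(2)[OF z] exp_log_rho[OF logs(3)[OF z]] log_rho_add[OF lu']])
  moreover have "bij \<sigma>" using \<sigma> by (intro o_bij[of \<sigma>]) (auto simp: fun_eq_iff)
  then have "corr T ((q \<circ> \<sigma>) 1) ((q \<circ> \<sigma>) 2) ((q \<circ> \<sigma>) 3) ((q \<circ> \<sigma>) 4) (permute_points \<sigma> C) = corr T (q 1) (q 2) (q 3) (q 4) C"
    using order_independence[OF C, of \<sigma> q] by simp
  ultimately have "cft_prefactor T q (ln_x2 C) * cft_psi T q (log_rho (lam1 z) z) (log_rho (lam2 (cnj z)) (cnj z))
      = cft_prefactor T (q \<circ> \<sigma>) (ln_x2 (permute_points \<sigma> C))
      * cft_psi T (q \<circ> \<sigma>) (log_rho (kap1 z) (zet z)) (log_rho (kap2 (cnj z)) (zet (cnj z)))"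
    using s by simp
  moreover have "cft_prefactor T q (ln_x2 C) = cft_prefactor T (q \<circ> \<sigma>) (ln_x2 (permute_points \<sigma> C))
      * exp (of_real \<alpha> * (lam1 z + lam2 (cnj z)) + of_real \<beta> * (Ln (1 - z) + Ln (1 - cnj z)))"
    using prefactors[of "ln_x2 C", OF ln_x2_commute] unfolding lu lv by (simp add: x2_permute)
  moreover have "cft_prefactor T (q \<circ> \<sigma>) (ln_x2 (permute_points \<sigma> C)) \<noteq> 0"
    by (simp add: cft_prefactor_def prefactor_def)
  ultimately show ?thesis by simp
qed

lemma Re_neg:
  assumes "z \<in> D"
  shows "Re (log_rho (lam1 z) z) < 0" "Re (log_rho (lam2 z) z) < 0"
    "Re (log_rho (kap1 z) (zet z)) < 0" "Re (log_rho (kap2 z) (zet z)) < 0"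
  using Re_log_rho_neg exp_log_rho logs[OF assms] slit[OF assms] by blast+

lemma crossing_identity:
  assumes "z \<in> D" "w \<in> D"
  shows "exp (of_real \<alpha> * (lam1 z + lam2 w) + of_real \<beta> * (Ln (1 - z) + Ln (1 - w)))
      * cft_psi T q (log_rho (lam1 z) z) (log_rho (lam2 w) w)
    = cft_psi T (q \<circ> \<sigma>) (log_rho (kap1 z) (zet z)) (log_rho (kap2 w) (zet w))"
proof -
  define E where "E z w = exp (of_real \<alpha> * (lam1 z + lam2 w) + of_real \<beta> * (Ln (1 - z) + Ln (1 - w)))
      * cft_psi T q (log_rho (lam1 z) z) (log_rho (lam2 w) w)
    - cft_psi T (q \<circ> \<sigma>) (log_rho (kap1 z) (zet z)) (log_rho (kap2 w) (zet w))" for z w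
  obtain e where e: "e > 0" "ball (of_real p) e \<subseteq> D" using D by (meson openE)
  have "E z w = 0"
  proof (rule antidiagonal_identity[OF _ D(1,2) e _ assms])
    show "curvewise_holomorphic E D"
      unfolding curvewise_holomorphic_def
    proof (intro allI impI)
      fix S f g assume S: "open S" and fg: "f holomorphic_on S" "g holomorphic_on S" and sub: "f ` S \<subseteq> D" "g ` S \<subseteq> D"
      have comp: "(\<lambda>t. k (f t)) holomorphic_on S" "(\<lambda>t. k (g t)) holomorphic_on S" if "k holomorphic_on D" for k
        using holomorphic_on_compose_gen[OF fg(1) that sub(1)] holomorphic_on_compose_gen[OF fg(2) that sub(2)]
        by (simp_all add: o_def)
      have D_in: "f t \<in> D" "g t \<in> D" if "t \<in> S" for t using that sub by auto
      have "(\<lambda>z. Ln (1 - z)) holomorphic_on D"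
        by (intro holomorphic_on_Ln' holomorphic_intros) (use slit(1) in \<open>simp add: slit_iff\<close>)
      note Ln = comp[OF this]
      have lr: "(\<lambda>z. log_rho (lam1 z) z) holomorphic_on D" "(\<lambda>z. log_rho (lam2 z) z) holomorphic_on D"
        "(\<lambda>z. log_rho (kap1 z) (zet z)) holomorphic_on D" "(\<lambda>z. log_rho (kap2 z) (zet z)) holomorphic_on D"
        using slit by (auto intro!: holomorphic_log_rho hol holomorphic_intros)
      show "(\<lambda>t. E (f t) (g t)) holomorphic_on S"
        unfolding E_def cft_psi_def
        by (intro holomorphic_on_diff holomorphic_on_mult holomorphic_on_add holomorphic_on_const holomorphic_on_exp'
            comp[OF hol(1)] comp[OF hol(2)] Ln
            state_sum.psi_holomorphic[OF state_sum S comp(1)[OF lr(1)] comp(2)[OF lr(2)]]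
            state_sum.psi_holomorphic[OF state_sum S comp(1)[OF lr(3)] comp(2)[OF lr(4)]] Re_neg D_in)
    qed
    show "E z (cnj z) = 0" if "z \<in> ball (of_real p) e" for z
      using crossing_on_antidiagonal[of z] e(2) that by (auto simp: E_def)
  qed
  then show ?thesis by (simp add: E_def)
qed

text \<open>Both logarithms have to be on the branches of the crossing identity. For log v this is
  automatic on \<open>DD\<close> (\<open>log_v_DD\<close>); for log u it is where the crossing
  number enters.\<close>

lemma channel_values_agree:
  assumes C: "C \<in> DD" and r: "cross_roots C z zb" and z: "z \<in> D" "zb \<in> D"
    and lu: "log_u (ln_x2 C) = lam1 z + lam2 zb" and lv: "log_v (ln_x2 C) = Ln (1 - z) + Ln (1 - zb)"
  shows "channel_value T q (ln_x2 C) C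
    = channel_value T (q \<circ> \<sigma>) (\<lambda>m n. Ln (x2 C (\<sigma> m) (\<sigma> n))) (permute_points \<sigma> C)"
proof -
  note x = DD_x2_nonzero[OF C]
  have ne: "\<sigma> i \<noteq> \<sigma> j" if "i \<noteq> j" for i j using that \<sigma> by metis
  have lu': "log_u (\<lambda>m n. Ln (x2 C (\<sigma> m) (\<sigma> n))) = kap1 z + kap2 zb"
    using log_u_\<sigma>[OF ln_x2_commute lu lv] .
  have r': "cross_roots (permute_points \<sigma> C) (zet z) (zet zb)"
    by (rule roots[OF x r])
  have slit': "w \<notin> complex_of_real ` {1..}" if "cross_roots (permute_points \<sigma> C) w wb" for w wb
    using cross_roots_unique[OF r' that] slit(2)[OF z(1)] slit(2)[OF z(2)] by (metis prod.inject)
  have "channel_value T q (ln_x2 C) C = cft_prefactor T q (ln_x2 C)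
      * cft_psi T q (log_rho (lam1 z) z) (log_rho (lam2 zb) zb)"
    by (rule channel_value_eq(1)[OF _ _ r exp_log_rho[OF logs(1)[OF z(1)]] log_rho_add[OF lu]])
      (use x DD_roots[OF C] in auto)
  also have "\<dots> = cft_prefactor T (q \<circ> \<sigma>) (\<lambda>m n. Ln (x2 C (\<sigma> m) (\<sigma> n)))
      * cft_psi T (q \<circ> \<sigma>) (log_rho (kap1 z) (zet z)) (log_rho (kap2 zb) (zet zb))"
    using prefactors[of "ln_x2 C", OF ln_x2_commute] crossing_identity[OF z] unfolding lu lv by simp
  also have "\<dots> = channel_value T (q \<circ> \<sigma>) (\<lambda>m n. Ln (x2 C (\<sigma> m) (\<sigma> n))) (permute_points \<sigma> C)"
    by (rule channel_value_eq(1)[OF _ _ r' exp_log_rho[OF logs(3)[OF z(1)]] log_rho_add[OF lu'], symmetric])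
      (use x ne slit' in \<open>auto simp: x2_permute\<close>)
  finally show ?thesis .
qed

end

text \<open>Both sides are continuous logarithms of one function on a connected set, so equality
  propagates from C1. The symmetry of \<open>f\<close> makes its value continuous although the roots
  are only an unordered pair.\<close>

lemma symmetric_log_eq:
  fixes X :: "'n::finite config set" and k :: "'n config \<Rightarrow> complex" and f :: "complex \<Rightarrow> complex \<Rightarrow> complex"
  assumes X: "connected X" "X \<subseteq> DD" and k: "continuous_on X k"
    and f: "continuous_on (W \<times> W) (\<lambda>(z, w). f z w)" and sym: "\<And>z w. f z w = f w z"
    and W: "\<And>C z w. C \<in> X \<Longrightarrow> cross_roots C z w \<Longrightarrow> z \<in> W"
    and e: "\<And>C z w. C \<in> X \<Longrightarrow> cross_roots C z w \<Longrightarrow> exp (k C) = exp (f z w)"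
    and C1: "C1 \<in> X" "cross_roots C1 z1 w1" "k C1 = f z1 w1"
    and C: "C \<in> X" "cross_roots C z w"
  shows "k C = f z w"
proof -
  define g where "g C = (let p = SOME p. cross_roots C (fst p) (snd p) in f (fst p) (snd p))" for C :: "'n config"
  have g: "g C = f z w" if "cross_roots C z w" for C z w
  proof -
    define p where "p = (SOME p. cross_roots C (fst p) (snd p))"
    have "cross_roots C (fst p) (snd p)"
      unfolding p_def by (rule someI_ex[of "\<lambda>p. cross_roots C (fst p) (snd p)"]) (metis that fst_conv snd_conv)
    from cross_roots_unique[OF this that] show ?thesis
      unfolding g_def Let_def p_def[symmetric] using sym by auto
  qed
  have "x2 C 1 3 \<noteq> 0" "x2 C 2 4 \<noteq> 0" if "C \<in> X" for C
    using DD_x2_nonzero[of C] that X(2) by auto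
  from cross_ratios_time_analytic[OF this]
  have uv: "continuous_on X cross_u" "continuous_on X cross_v"
    by (simp_all add: time_analytic_on_iff)
  have "continuous_on X g"
    by (rule continuous_on_symmetric_roots[OF uv f]) (use W g cross_roots_swap in blast)
  then have "k C - g C = k C1 - g C1"
  proof (intro exp_constant_imp_constant[of X "\<lambda>C. k C - g C"] X C C1 continuous_intros k)
    fix C assume "C \<in> X"
    moreover obtain z w where "cross_roots C z w" by (rule cross_roots_exist)
    ultimately show "exp (k C - g C) = 1" using e g by (simp add: exp_diff)
  qed
  then show ?thesis using C1 C g by simp
qed

lemma continuous_on_ln_x2:
  assumes "m \<noteq> n"
  shows "continuous_on DD (\<lambda>C. ln_x2 C m n)"
  by (intro continuous_intros continuous_on_x2) (use DD_x2_slit[OF _ assms] in auto)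

lemma continuous_on_log_u_v: "continuous_on DD (\<lambda>C. log_u (ln_x2 C))" "continuous_on DD (\<lambda>C. log_v (ln_x2 C))"
  unfolding log_u_def log_v_def by (intro continuous_intros continuous_on_ln_x2; simp)+

lemma DE_euclidean: "C \<in> DE \<Longrightarrow> C \<in> euclidean_configs"
  by (auto simp: DE_def euclidean_configs_def DD_x2_nonzero)

lemma DE_nonempty: obtains C :: "'n::finite config" where "C \<in> DE"
proof
  show "(\<chi> k. if k = 1 then 3 else if k = 2 then 2 else if k = 3 then 1 else 0, 0) \<in> DE"
    by (simp add: DE_def DD_def)
qed

text \<open>On \<open>DD\<close> the numbers 1 - z and 1 - zb stay off the cut of \<open>Ln\<close>,
  so the sum of their principal logarithms is continuous, and a Euclidean configuration fixes the
  constant.\<close>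

lemma log_v_DD:
  assumes C: "C \<in> DD" and r: "cross_roots C z zb"
  shows "log_v (ln_x2 C) = Ln (1 - z) + Ln (1 - zb)"
proof -
  obtain C1 :: "'a config" where C1: "C1 \<in> DE" by (rule DE_nonempty)
  obtain z1 w1 where r1: "cross_roots C1 z1 w1" by (rule cross_roots_exist)
  have DD1: "C1 \<in> DD" using C1 by (simp add: DE_def)
  have nz: "1 - z \<noteq> 0" if "C \<in> DD" "cross_roots C z zb" for C :: "'a config" and z zb
    using DD_roots[OF that] by (auto simp: slit_iff)
  show ?thesis
  proof (rule symmetric_log_eq[of DD "\<lambda>C. log_v (ln_x2 C)" "- complex_of_real ` {1..}" "\<lambda>z w. Ln (1 - z) + Ln (1 - w)", OF _ _ _ _ _ _ _ DD1 r1 _ C r])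
    show "connected (DD :: 'a config set)" by (intro convex_connected convex_DD)
    show "continuous_on ((- complex_of_real ` {1..}) \<times> (- complex_of_real ` {1..})) (\<lambda>(z, w). Ln (1 - z) + Ln (1 - w))"
      unfolding case_prod_beta by (intro continuous_intros) (auto simp: slit_iff)
    show "exp (log_v (ln_x2 C)) = exp (Ln (1 - z) + Ln (1 - w))" if "C \<in> DD" "cross_roots C z w" for C :: "'a config" and z w
      using exp_log_u_v(2)[OF DD_x2_nonzero[OF that(1)] that(2)] nz[OF that] nz[OF that(1) cross_roots_swap[OF that(2)]]
      by (simp add: exp_add)
    have "w1 = cnj z1" by (rule euclid_roots_conjugate[OF DE_euclidean[OF C1] r1])
    moreover have "cnj (Ln (1 - z1)) = Ln (1 - cnj z1)"
      using cnj_Ln[of "1 - z1"] DD_roots[OF DD1 r1] by (simp add: slit_iff)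
    ultimately show "log_v (ln_x2 C1) = Ln (1 - z1) + Ln (1 - w1)"
      using euclid_log_u_v(2)[OF DE_euclidean[OF C1] r1, of "Ln (1 - z1)"] nz[OF DD1 r1] by simp
    show "z \<in> - complex_of_real ` {1..}" if "C \<in> DD" "cross_roots C z w" for C :: "'a config" and z w
      using DD_roots[OF that] by simp
  qed (simp_all add: add.commute continuous_on_log_u_v)
qed

text \<open>For e = - 1 a hit of (0, 1) by f is a hit of the negative axis by - f, since f avoids
  [1, oo). The sign exchanges above and below, whence the factor Re e. All hits occur before a, so
  counting up to a loses none.\<close>

lemma card_crossings_eq:
  fixes f :: "real \<Rightarrow> complex"
  assumes e: "(e = 1 \<and> I = {..<0}) \<or> (e = - 1 \<and> I = {0<..<1})" and a: "a < 1"
    and hits: "\<And>s. s \<in> {0..1} \<Longrightarrow> f s \<in> complex_of_real ` I \<Longrightarrow> s < a"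
    and slit: "\<And>s. s \<in> {0..<1} \<Longrightarrow> f s \<notin> complex_of_real ` {1..}"
  shows "real_of_int (int (card {s \<in> {0<..<a}. crosses_from_above (\<lambda>s. e * f s) {..<0} s})
      - int (card {s \<in> {0<..<a}. crosses_from_below (\<lambda>s. e * f s) {..<0} s})) = Re e * of_int (signed_crossings f I)"
    (is "real_of_int (int (card ?A) - int (card ?B)) = _")
proof -
  have *: "{s \<in> {0<..<a}. crosses_from_above f I s} = {s \<in> {0<..<1}. crosses_from_above f I s}"
    "{s \<in> {0<..<a}. crosses_from_below f I s} = {s \<in> {0<..<1}. crosses_from_below f I s}"
    using hits a by (auto simp: crosses_from_above_def crosses_from_below_def)
  from e show ?thesis
  proof
    assume "e = 1 \<and> I = {..<0}"
    then show ?thesis using * by (simp add: signed_crossings_def)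
  next
    assume e: "e = - 1 \<and> I = {0<..<1}"
    have "- f s \<in> complex_of_real ` {..<0} \<longleftrightarrow> f s \<in> complex_of_real ` {0<..<1}" if "s \<in> {0<..<a}" for s
      using slit[of s] that a by (auto simp: complex_eq_iff image_iff)
    then have "?A = {s \<in> {0<..<a}. crosses_from_below f I s}" "?B = {s \<in> {0<..<a}. crosses_from_above f I s}"
      using e by (auto simp: crosses_from_above_def crosses_from_below_def)
    then show ?thesis using * e by (simp add: signed_crossings_def)
  qed
qed

text \<open>Along the path log u is the sum of continuous logarithms of e z and e zb, because e e =
  1 and the sum is correct at the Euclidean start. Each of them departs from the principal logarithm
  by 2 pi i times its signed crossings, and these cancel when the total is 0.\<close>

lemma log_u_near_endpoint:
  fixes C :: "'n::finite config"
  assumes N: "has_crossing_number I C 0" and avoid: "roots_avoid C I"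
    and e: "(e = 1 \<and> I = {..<0}) \<or> (e = - 1 \<and> I = {0<..<1})" and r: "r > 0"
  obtains C1 z zb where "C1 \<in> ball C r \<inter> DD" "cross_roots C1 z zb" "log_u (ln_x2 C1) = Ln (e * z) + Ln (e * zb)"
proof -
  obtain \<gamma> :: "real \<Rightarrow> 'n config" and z zb where
    \<gamma>: "continuous_on {0..1} \<gamma>" "\<gamma> 0 \<in> DE" "\<And>s. s \<in> {0..<1} \<Longrightarrow> \<gamma> s \<in> DD" "\<gamma> 1 = C"
    and z: "continuous_on {0..1} z" "continuous_on {0..1} zb"
      "\<And>s. s \<in> {0..1} \<Longrightarrow> cross_roots (\<gamma> s) (z s) (zb s)" "Im (z 0) > 0"
    and fin: "finite {s \<in> {0..1}. z s \<in> complex_of_real ` I \<or> zb s \<in> complex_of_real ` I}"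
    and sum: "0 = signed_crossings z I + signed_crossings zb I"
    using N unfolding has_crossing_number_def by blast
  define H where "H = {s \<in> {0..1}. z s \<in> complex_of_real ` I \<or> zb s \<in> complex_of_real ` I}"
  have "1 \<notin> H"
    using avoid z(3)[of 1] \<gamma>(4) by (auto simp: H_def roots_avoid_def)
  then have H1: "s < 1" if "s \<in> H" for s using that by (cases "s = 1") (auto simp: H_def)
  define s0 where "s0 = Max (insert 0 H)"
  have finH: "finite (insert 0 H)" using fin by (simp add: H_def)
  have s0: "0 \<le> s0" "\<And>s. s \<in> H \<Longrightarrow> s \<le> s0"
    using finH by (auto simp: s0_def)
  have "s0 \<in> insert 0 H" unfolding s0_def using finH by (rule Max_in) simp
  then have "s0 < 1" using H1 by auto
  obtain d where d: "d > 0" "\<And>s. s \<in> {0..1} \<Longrightarrow> dist s 1 < d \<Longrightarrow> dist (\<gamma> s) (\<gamma> 1) < r"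
    using \<gamma>(1) r unfolding continuous_on_iff by (metis atLeastAtMost_iff zero_le_one order_refl)
  \<comment> \<open>The path is stopped short of its end, after the last hit s0 of I and within the
    ball: at time a it is still in \<open>DD\<close>.\<close>
  define a where "a = max ((s0 + 1) / 2) (1 - d / 2)"
  have a: "s0 < a" "0 < a" "a < 1" "dist a 1 < d"
    using s0(1) \<open>s0 < 1\<close> d(1) by (auto simp: a_def dist_real_def less_max_iff_disj)
  have Ca: "\<gamma> a \<in> ball C r \<inter> DD"
    using d(2)[of a] a \<gamma>(3)[of a] \<gamma>(4) by (simp add: dist_commute)
  have sub: "{0..a} \<subseteq> {0..1}" using a by auto
  have DDs: "\<gamma> s \<in> DD" if "s \<in> {0..a}" for s using \<gamma>(3)[of s] that a by simp
  have e0: "e \<noteq> 0" and ee: "e * e = 1" using e by auto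
  have sw: "cross_roots (\<gamma> s) (zb s) (z s)" if "s \<in> {0..1}" for s using cross_roots_swap[OF z(3)[OF that]] .
  have nz: "z s \<noteq> 0" "zb s \<noteq> 0" if "s \<in> {0..a}" for s
    using z(3)[of s] DD_x2_nonzero[OF DDs[OF that]] that sub by (auto simp: cross_roots_def cross_u_def)
  have contr: "contractible {0..a}" by (intro convex_imp_contractible) simp
  have lift: "\<exists>g. continuous_on {0..a} g \<and> (\<forall>s\<in>{0..a}. exp (g s) = e * f s) \<and> g 0 = Ln (e * f 0)"
    if f: "continuous_on {0..1} f" and fnz: "\<And>s. s \<in> {0..a} \<Longrightarrow> f s \<noteq> 0" for f
  proof -
    have "continuous_on {0..a} (\<lambda>s. e * f s)"
      using continuous_on_subset[OF f sub] by (intro continuous_intros)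
    then obtain g where g: "continuous_on {0..a} g" "\<And>s. s \<in> {0..a} \<Longrightarrow> e * f s = exp (g s)"
      using continuous_logarithm_on_contractible[OF _ contr] fnz e0 by (metis mult_eq_0_iff)
    define g' where "g' s = g s - g 0 + Ln (e * f 0)" for s
    have "exp (g' s) = e * f s" if "s \<in> {0..a}" for s
      using g(2)[OF that] g(2)[of 0] a(2) fnz[of 0] e0
      by (simp add: g'_def exp_add exp_diff)
    moreover have "continuous_on {0..a} g'"
      unfolding g'_def by (intro continuous_intros g(1))
    ultimately show ?thesis by (intro exI[of _ g']) (auto simp: g'_def)
  qed
  obtain g where g: "continuous_on {0..a} g" "\<And>s. s \<in> {0..a} \<Longrightarrow> exp (g s) = e * z s" "g 0 = Ln (e * z 0)"
    using lift[OF z(1) nz(1)] by blast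
  obtain gb where gb: "continuous_on {0..a} gb" "\<And>s. s \<in> {0..a} \<Longrightarrow> exp (gb s) = e * zb s" "gb 0 = Ln (e * zb 0)"
    using lift[OF z(2) nz(2)] by blast
  have zb0: "zb 0 = cnj (z 0)"
    by (rule euclid_roots_conjugate[OF DE_euclidean[OF \<gamma>(2)] z(3)]) simp
  have "log_u (ln_x2 (\<gamma> a)) - (g a + gb a) = log_u (ln_x2 (\<gamma> 0)) - (g 0 + gb 0)"
  proof (rule exp_constant_imp_constant[of "{0..a}" "\<lambda>s. log_u (ln_x2 (\<gamma> s)) - (g s + gb s)"])
    have "continuous_on {0..a} (\<lambda>s. log_u (ln_x2 (\<gamma> s)))"
      by (rule continuous_on_compose2[OF continuous_on_log_u_v(1) continuous_on_subset[OF \<gamma>(1) sub]]) (use DDs in auto)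
    then show "continuous_on {0..a} (\<lambda>s. log_u (ln_x2 (\<gamma> s)) - (g s + gb s))"
      by (intro continuous_intros g gb)
    show "exp (log_u (ln_x2 (\<gamma> s)) - (g s + gb s)) = 1" if s: "s \<in> {0..a}" for s
    proof -
      have "exp (log_u (ln_x2 (\<gamma> s))) = z s * zb s"
        using exp_log_u_v(1)[OF DD_x2_nonzero[OF DDs[OF s]] z(3)] s sub by auto
      moreover have "exp (g s + gb s) = (e * e) * (z s * zb s)"
        using g(2)[OF s] gb(2)[OF s] by (simp add: exp_add)
      ultimately show ?thesis using nz[OF s] by (simp add: ee exp_diff)
    qed
  qed (use a in auto)
  also have "log_u (ln_x2 (\<gamma> 0)) = g 0 + gb 0"
  proof -
    have "Im (e * z 0) \<noteq> 0" using z(4) e by auto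
    then have c: "cnj (Ln (e * z 0)) = Ln (e * cnj (z 0))"
      using cnj_Ln[of "e * z 0"] e by (auto simp: complex_nonpos_Reals_iff)
    have "log_u (ln_x2 (\<gamma> 0)) = Ln (e * z 0) + Ln (e * cnj (z 0))"
    proof -
      \<comment> \<open>For e = - 1 a logarithm of z is Ln (- z) + i pi, and the i pi drops out of k
        + cnj k.\<close>
      define k where "k = Ln (e * z 0) + (if e = 1 then 0 else \<i> * of_real pi)"
      have "exp k = z 0"
        using e nz[of 0] a by (auto simp: k_def exp_add)
      from euclid_log_u_v(1)[OF DE_euclidean[OF \<gamma>(2)] z(3) this]
      have "log_u (ln_x2 (\<gamma> 0)) = k + cnj k" by simp
      then show ?thesis using c by (simp add: k_def)
    qed
    then show ?thesis by (simp add: g gb zb0)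
  qed
  finally have lu: "log_u (ln_x2 (\<gamma> a)) = g a + gb a" by simp
  have count: "k a = Ln (e * f a) + 2 * of_real pi * \<i> * of_real (Re e * signed_crossings f I)"
    if f: "continuous_on {0..1} f" and fr: "\<And>s. s \<in> {0..1} \<Longrightarrow> \<exists>w. cross_roots (\<gamma> s) (f s) w"
      and k: "continuous_on {0..a} k" "\<And>s. s \<in> {0..a} \<Longrightarrow> exp (k s) = e * f s" "k 0 = Ln (e * f 0)"
      and H: "\<And>s. s \<in> {0..1} \<Longrightarrow> f s \<in> complex_of_real ` I \<Longrightarrow> s \<in> H" and Im: "Im (f 0) \<noteq> 0"
    for f k
  proof -
    have slit: "f s \<notin> complex_of_real ` {1..}" if "s \<in> {0..<1}" for s
      using fr[of s] DD_roots[OF \<gamma>(3)[OF that]] that by fastforce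
    have hits: "s < a" if "s \<in> {0..1}" "f s \<in> complex_of_real ` I" for s
      using H[OF that] s0(2) a(1) by fastforce
    have neg: "e * f s \<in> complex_of_real ` {..<0} \<longleftrightarrow> f s \<in> complex_of_real ` I" if "s \<in> {0..<1}" for s
      using e slit[OF that] by (auto simp: complex_eq_iff image_iff)
    define N where "N = int (card {s \<in> {0<..<a}. crosses_from_above (\<lambda>s. e * f s) {..<0} s})
       - int (card {s \<in> {0<..<a}. crosses_from_below (\<lambda>s. e * f s) {..<0} s})"
    have N: "real_of_int N = Re e * of_int (signed_crossings f I)"
      unfolding N_def by (rule card_crossings_eq[OF e a(3) hits slit])
    have "k a = Ln (e * f a) + 2 * of_real pi * \<i> * of_int N"
      unfolding N_def
    proof (rule continuous_log_crossings[OF _ _ k(1,2)])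
      show "continuous_on {0..a} (\<lambda>s. e * f s)"
        using continuous_on_subset[OF f sub] by (intro continuous_intros)
      have "{s \<in> {0..a}. e * f s \<in> complex_of_real ` {..<0}} \<subseteq> H"
      proof
        fix s assume "s \<in> {s \<in> {0..a}. e * f s \<in> complex_of_real ` {..<0}}"
        then show "s \<in> H" using neg[of s] H[of s] a(3) by auto
      qed
      then show "finite {s \<in> {0..a}. e * f s \<in> complex_of_real ` {..<0}}"
        using finH by (auto intro: finite_subset)
      show "e * f 0 \<notin> complex_of_real ` {..<0}"
        using neg[of 0] Im e by (auto simp: image_iff complex_eq_iff)
      show "e * f a \<notin> complex_of_real ` {..<0}"
        using neg[of a] hits[of a] a by auto
    qed (use a k in auto)
    then show ?thesis
      unfolding N[symmetric] by simp
  qed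
  have "g a = Ln (e * z a) + 2 * of_real pi * \<i> * of_real (Re e * signed_crossings z I)"
    by (rule count[OF z(1) _ g]) (use z(3,4) in \<open>auto simp: H_def\<close>)
  moreover have "gb a = Ln (e * zb a) + 2 * of_real pi * \<i> * of_real (Re e * signed_crossings zb I)"
    by (rule count[OF z(2) _ gb]) (use sw z(4) zb0 in \<open>auto simp: H_def\<close>)
  moreover have "signed_crossings zb I = - signed_crossings z I" using sum by simp
  ultimately have "log_u (ln_x2 (\<gamma> a)) = Ln (e * z a) + Ln (e * zb a)"
    unfolding lu by simp
  with that[OF Ca z(3)[of a]] a show thesis by simp
qed

text \<open>\<open>W\<close> is the plane without the cut of the crossed channel. At C0 itself the
  roots may lie on the s-channel cut [1, oo), so \<open>W\<close> rather than D is a neighbourhood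
  of them; on \<open>DD\<close> that cut is avoided anyway, and the roots nearby are in D.\<close>

lemma (in crossing) channel_extension:
  assumes C0: "C0 \<in> DL" and N: "has_crossing_number I C0 0" "roots_avoid C0 I"
    and e: "(e = 1 \<and> I = {..<0}) \<or> (e = - 1 \<and> I = {0<..<1})"
    and lam: "\<And>z w. lam1 z + lam2 w = Ln (e * z) + Ln (e * w)"
    and W: "open W" "\<And>z w. cross_roots C0 z w \<Longrightarrow> z \<in> W" "W - complex_of_real ` {1..} \<subseteq> D"
    and slit0: "\<And>z zb. cross_roots (permute_points \<sigma> C0) z zb \<Longrightarrow> z \<notin> complex_of_real ` {1..}"
  shows "\<exists>w. analytic_at_with_value (\<lambda>C. channel_value T q (ln_x2 C) C) C0 w \<and> given_by_channel T q \<sigma> C0 w"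
proof -
  have "isCont cross_u C0" "isCont cross_v C0"
    using C0 by (auto intro!: isCont_cross_ratios simp: DL_def)
  then have "\<forall>\<^sub>F C in nhds C0. \<forall>z w. cross_roots C z w \<longrightarrow> z \<in> W"
    by (rule eventually_roots_in[OF _ _ W(1)]) (use W(2) in blast)
  then obtain r where r: "r > 0" "\<And>C z w. C \<in> ball C0 r \<Longrightarrow> cross_roots C z w \<Longrightarrow> z \<in> W"
    unfolding eventually_nhds_metric by (force simp: dist_commute)
  have inD: "z \<in> D" if "C \<in> ball C0 r \<inter> DD" "cross_roots C z w" for C z w
    using r(2)[of C z w] DD_roots[of C z w] that W(3) by auto
  obtain C1 z1 w1 where C1: "C1 \<in> ball C0 r \<inter> DD" "cross_roots C1 z1 w1" "log_u (ln_x2 C1) = Ln (e * z1) + Ln (e * w1)"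
    using log_u_near_endpoint[OF N e r(1)] by blast
  have lu: "log_u (ln_x2 C) = lam1 z + lam2 zb" if C: "C \<in> ball C0 r \<inter> DD" "cross_roots C z zb" for C z zb
  proof (rule symmetric_log_eq[of "ball C0 r \<inter> DD" "\<lambda>C. log_u (ln_x2 C)" D "\<lambda>z w. lam1 z + lam2 w", OF _ _ _ _ lam_sym _ _ C1(1,2) _ C])
    show "connected (ball C0 r \<inter> DD)" by (intro convex_connected convex_Int convex_ball convex_DD)
    show "continuous_on (ball C0 r \<inter> DD) (\<lambda>C. log_u (ln_x2 C))"
      by (rule continuous_on_subset[OF continuous_on_log_u_v(1)]) auto
    have "continuous_on (D \<times> D) (\<lambda>x. lam1 (fst x))" "continuous_on (D \<times> D) (\<lambda>x. lam2 (snd x))"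
      by (rule continuous_on_compose2[OF holomorphic_on_imp_continuous_on[OF hol(1)]];
            auto intro!: continuous_intros)
         (rule continuous_on_compose2[OF holomorphic_on_imp_continuous_on[OF hol(2)]];
            auto intro!: continuous_intros)
    then show "continuous_on (D \<times> D) (\<lambda>(z, w). lam1 z + lam2 w)"
      unfolding case_prod_beta by (intro continuous_intros)
    show "exp (log_u (ln_x2 C)) = exp (lam1 z + lam2 w)" if "C \<in> ball C0 r \<inter> DD" "cross_roots C z w" for C z w
      using exp_log_u_v(1)[OF DD_x2_nonzero[of C] that(2)] that logs(1)[OF inD[OF that]]
        logs(2)[OF inD[OF that(1) cross_roots_swap[OF that(2)]]]
      by (simp add: exp_add)
    show "log_u (ln_x2 C1) = lam1 z1 + lam2 w1" using C1(3) lam by simp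
  qed (use inD in auto)
  show ?thesis
  proof (rule extension_at[OF C0 \<sigma> slit0 r(1)])
    fix C assume C: "C \<in> ball C0 r \<inter> DD"
    obtain z zb where rt: "cross_roots C z zb" by (rule cross_roots_exist)
    show "channel_value T q (ln_x2 C) C = channel_value T (q \<circ> \<sigma>) (\<lambda>m n. Ln (x2 C (\<sigma> m) (\<sigma> n))) (permute_points \<sigma> C)"
      by (rule channel_values_agree[OF _ rt inD[OF C rt] inD[OF C cross_roots_swap[OF rt]] lu[OF C rt] log_v_DD[OF _ rt]])
        (use C in auto)
  qed
qed

section \<open>The data of the t- and u-channels, and the conclusion\<close>

lemma prefactor_exp:
  "prefactor a b c d l = exp (- of_real ((a + b) / 2) * l 1 2 - of_real ((c + d) / 2) * l 3 4
    + of_real ((a - b) / 2) * (l 2 4 - l 1 4) + of_real ((c - d) / 2) * (l 1 4 - l 1 3))"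
proof -
  have "1 / (exp x * exp y) * exp s * exp t = exp (- x - y + s + t)" for x y s t :: complex
    by (simp add: exp_add exp_diff exp_minus field_simps)
  then show ?thesis unfolding prefactor_def by simp
qed

lemma t_channel_simps: "t_channel 1 = 3" "t_channel 2 = 2" "t_channel 3 = 1" "t_channel 4 = 4"
  by (simp_all add: t_channel_def)

lemma u_channel_simps: "u_channel 1 = 1" "u_channel 2 = 3" "u_channel 3 = 2" "u_channel 4 = 4"
  by (simp_all add: u_channel_def)

lemma t_channel_involution: "t_channel (t_channel k) = k"
  using exhaust_4[of k] by (auto simp: t_channel_simps)

lemma u_channel_involution: "u_channel (u_channel k) = k"
  using exhaust_4[of k] by (auto simp: u_channel_simps)

lemma t_channel_roots:
  "cross_roots C z zb \<Longrightarrow> cross_roots (permute_points t_channel C) (1 - z) (1 - zb)"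
  by (simp add: cross_roots_def cross_u_def cross_v_def x2_permute t_channel_simps
      x2_commute[of C 3 2] x2_commute[of C 3 1] x2_commute[of C 2 1] mult.commute)

lemma u_channel_roots:
  assumes "\<And>m n. m \<noteq> n \<Longrightarrow> x2 C m n \<noteq> 0" "cross_roots C z zb"
  shows "cross_roots (permute_points u_channel C) (1 / z) (1 / zb)"
proof -
  have u: "z * zb = cross_u C" and v: "(1 - z) * (1 - zb) = cross_v C"
    using assms(2) by (simp_all add: cross_roots_def)
  have "cross_u C \<noteq> 0" using assms(1) by (simp add: cross_u_def)
  then have nz: "z \<noteq> 0" "zb \<noteq> 0" using u by auto
  have "1 / z * (1 / zb) = 1 / cross_u C" by (simp add: u[symmetric])
  moreover have "(1 - 1 / z) * (1 - 1 / zb) = cross_v C / cross_u C"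
    using nz by (simp add: u[symmetric] v[symmetric] field_simps)
  moreover have "cross_u (permute_points u_channel C) = 1 / cross_u C"
      "cross_v (permute_points u_channel C) = cross_v C / cross_u C"
    using assms(1) by (simp_all add: cross_u_def cross_v_def x2_permute u_channel_simps x2_commute[of C 3 2])
  ultimately show ?thesis by (simp add: cross_roots_def)
qed

lemma closed_of_real_image: "closed (I :: real set) \<Longrightarrow> closed (complex_of_real ` I)"
  by (rule closed_injective_linear_image) (auto intro: linear_of_real inj_of_real)

text \<open>The exponents come from comparing the coefficients of each logarithm of a squared
  distance in the two prefactors. D is symmetric under z to 1 - z, and the base point 1/2 lies
  between the two cuts.\<close>

lemma t_crossing:
  fixes T :: "('op, 'p, 's, 'n::finite) cft"
  assumes "unitary_cft T"
  shows "crossing T (- complex_of_real ` ({..0} \<union> {1..})) Ln Ln (\<lambda>z. Ln (1 - z)) (\<lambda>z. Ln (1 - z)) (\<lambda>z. 1 - z) (1 / 2)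
    t_channel q (- ((sdim T (q 1) + sdim T (q 2)) / 2)) ((sdim T (q 2) + sdim T (q 3)) / 2)"
proof -
  interpret unitary_cft T by fact
  define D where "D = - complex_of_real ` ({..0} \<union> {1..})"
  have D: "z \<in> D \<longleftrightarrow> z \<notin> \<real>\<^sub>\<le>\<^sub>0 \<and> 1 - z \<notin> \<real>\<^sub>\<le>\<^sub>0" for z
    by (auto simp: D_def complex_double_slot_eq complex_nonpos_Reals_iff)
  have nz: "z \<noteq> 0" "z \<noteq> 1" if "z \<in> D" for z using that D[of z] by auto
  have "crossing T D Ln Ln (\<lambda>z. Ln (1 - z)) (\<lambda>z. Ln (1 - z)) (\<lambda>z. 1 - z) (1 / 2)
    t_channel q (- ((sdim T (q 1) + sdim T (q 2)) / 2)) ((sdim T (q 2) + sdim T (q 3)) / 2)"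
  proof
    show "open D"
      unfolding D_def by (intro open_Compl closed_of_real_image closed_Un) auto
    show "connected D"
      unfolding D_def by (intro starlike_imp_connected starlike_doubly_slotted_complex_plane) simp
    show "complex_of_real (1 / 2) \<in> D"
      by (auto simp: D_def complex_double_slot_eq)
    show "cnj z \<in> D" if "z \<in> D" for z
      using that by (auto simp: D_def complex_double_slot_eq)
    show "cft_prefactor T q l = cft_prefactor T (q \<circ> t_channel) (\<lambda>m n. l (t_channel m) (t_channel n))
        * exp (of_real (- ((sdim T (q 1) + sdim T (q 2)) / 2)) * log_u l + of_real ((sdim T (q 2) + sdim T (q 3)) / 2) * log_v l)"
      if sym: "\<And>m n. l m n = l n m" for l
      unfolding cft_prefactor_def prefactor_exp exp_add[symmetric]
      by (rule arg_cong[of _ _ exp])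
        (simp add: t_channel_simps sym[of 3 2] sym[of 3 1] log_u_def log_v_def field_simps)
    show "log_u (\<lambda>m n. l (t_channel m) (t_channel n)) = Ln (1 - z) + Ln (1 - zb)"
      if "\<And>m n. l m n = l n m" "log_v l = Ln (1 - z) + Ln (1 - zb)" for l z zb
      unfolding that(2)[symmetric]
      by (simp add: t_channel_simps that(1)[of 3 2] that(1)[of 3 1] log_u_def log_v_def)
    show "cross_roots (permute_points t_channel C) (1 - z) (1 - zb)" if "cross_roots C z zb" for C :: "'n config" and z zb
      by (rule t_channel_roots[OF that])
    show "Ln (cnj z) = cnj (Ln z)" "Ln (1 - cnj z) = cnj (Ln (1 - z))" if "z \<in> D" for z
      using that cnj_Ln[of z] cnj_Ln[of "1 - z"] by (simp_all add: D)
  qed (use D in \<open>auto simp: nz slit_iff t_channel_involution intro!: holomorphic_intros\<close>)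
  then show ?thesis by (simp only: D_def)
qed

text \<open>z and 1 / z both avoid [1, oo) exactly off the positive axis, for z nonzero. The factor
  v cancels between the prefactors, so its exponent is 0; the shifts by i pi cancel in each sum over
  the two roots.\<close>

lemma u_crossing:
  fixes T :: "('op, 'p, 's, 'n::finite) cft"
  assumes "unitary_cft T"
  shows "crossing T (- complex_of_real ` {0..}) (\<lambda>z. Ln (- z) + \<i> * of_real pi) (\<lambda>z. Ln (- z) - \<i> * of_real pi)
    (\<lambda>z. - Ln (- z) - \<i> * of_real pi) (\<lambda>z. - Ln (- z) + \<i> * of_real pi) (\<lambda>z. 1 / z) (- 1)
    u_channel q (- ((sdim T (q 1) + sdim T (q 4)) / 2)) 0"
proof -
  interpret unitary_cft T by fact
  define D where "D = - complex_of_real ` {0..}"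
  have D: "z \<in> D \<longleftrightarrow> - z \<notin> \<real>\<^sub>\<le>\<^sub>0" for z
    by (auto simp: D_def complex_slot_right_eq complex_nonpos_Reals_iff)
  have nz: "z \<noteq> 0" if "- z \<notin> \<real>\<^sub>\<le>\<^sub>0" for z :: complex using that by auto
  have s1: "1 - z \<notin> \<real>\<^sub>\<le>\<^sub>0" "1 - 1 / z \<notin> \<real>\<^sub>\<le>\<^sub>0" if "- z \<notin> \<real>\<^sub>\<le>\<^sub>0" for z :: complex
  proof -
    show "1 - z \<notin> \<real>\<^sub>\<le>\<^sub>0" using that by (auto simp: complex_nonpos_Reals_iff)
    have "z \<in> complex_of_real ` {0..}" if w: "1 / z \<in> complex_of_real ` {1..}"
    proof -
      obtain t where t: "1 / z = of_real t" "t \<ge> 1" using w by auto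
      then have "z = of_real (1 / t)" using nz[OF \<open>- z \<notin> \<real>\<^sub>\<le>\<^sub>0\<close>] by (simp add: field_simps)
      then show ?thesis using t(2) by (intro image_eqI[of _ _ "1 / t"]) auto
    qed
    then show "1 - 1 / z \<notin> \<real>\<^sub>\<le>\<^sub>0" using that D[of z] D_def slit_iff[of "1 / z"] by auto
  qed
  have c: "Ln (- cnj z) = cnj (Ln (- z))" if "- z \<notin> \<real>\<^sub>\<le>\<^sub>0" for z
    using cnj_Ln[OF that] by simp
  have "crossing T D (\<lambda>z. Ln (- z) + \<i> * of_real pi) (\<lambda>z. Ln (- z) - \<i> * of_real pi)
    (\<lambda>z. - Ln (- z) - \<i> * of_real pi) (\<lambda>z. - Ln (- z) + \<i> * of_real pi) (\<lambda>z. 1 / z) (- 1)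
    u_channel q (- ((sdim T (q 1) + sdim T (q 4)) / 2)) 0"
  proof
    show "open D"
      unfolding D_def by (intro open_Compl closed_of_real_image) auto
    show "connected D"
      unfolding D_def by (intro starlike_imp_connected starlike_slotted_complex_plane_right)
    show "complex_of_real (- 1) \<in> D"
      by (auto simp: D_def complex_slot_right_eq)
    show "cnj z \<in> D" if "z \<in> D" for z
      using that by (auto simp: D_def complex_slot_right_eq)
    show "cft_prefactor T q l = cft_prefactor T (q \<circ> u_channel) (\<lambda>m n. l (u_channel m) (u_channel n))
        * exp (of_real (- ((sdim T (q 1) + sdim T (q 4)) / 2)) * log_u l + of_real 0 * log_v l)" for l
      unfolding cft_prefactor_def prefactor_exp exp_add[symmetric]
      by (rule arg_cong[of _ _ exp]) (simp add: u_channel_simps log_u_def field_simps)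
    show "log_u (\<lambda>m n. l (u_channel m) (u_channel n)) = - Ln (- z) - \<i> * of_real pi + (- Ln (- zb) + \<i> * of_real pi)"
      if "log_u l = Ln (- z) + \<i> * of_real pi + (Ln (- zb) - \<i> * of_real pi)" for l z zb
    proof -
      have "log_u (\<lambda>m n. l (u_channel m) (u_channel n)) = - log_u l"
        by (simp add: u_channel_simps log_u_def)
      then show ?thesis using that by simp
    qed
    show "cross_roots (permute_points u_channel C) (1 / z) (1 / zb)"
      if "\<And>m n. m \<noteq> n \<Longrightarrow> x2 C m n \<noteq> 0" "cross_roots C z zb" for C :: "'n config" and z zb
      by (rule u_channel_roots[OF that])
    show "Ln (- cnj z) - \<i> * of_real pi = cnj (Ln (- z) + \<i> * of_real pi)"
      "- Ln (- cnj z) + \<i> * of_real pi = cnj (- Ln (- z) - \<i> * of_real pi)" if "z \<in> D" for z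
      using that c by (simp_all add: D)
    show "exp (Ln (- z) + \<i> * of_real pi) = z" "exp (Ln (- z) - \<i> * of_real pi) = z"
      "exp (- Ln (- z) - \<i> * of_real pi) = 1 / z" "exp (- Ln (- z) + \<i> * of_real pi) = 1 / z" if "z \<in> D" for z
      using that nz[of z] by (simp_all add: D exp_add exp_diff exp_minus field_simps)
  qed (use D nz s1 in \<open>auto simp: slit_iff u_channel_involution intro!: holomorphic_intros\<close>)
  then show ?thesis by (simp only: D_def)
qed

theorem mainTheorem5:
  fixes T :: "('op, 'p, 's, 'n::finite) cft"
    and \<O> :: "4 \<Rightarrow> 'op"
  assumes "unitary_cft T"
  shows "\<exists>F :: 'n config \<Rightarrow> complex.
    (\<forall>C\<in>DE. F C = corr T (\<O> 1) (\<O> 2) (\<O> 3) (\<O> 4) C) \<and>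
    time_analytic_on F DD \<and>
    (\<forall>C\<in>DL.
      (roots_avoid C {1<..} \<longrightarrow>
        (\<exists>w. analytic_at_with_value F C w \<and> given_by_channel T \<O> s_channel C w)) \<and>
      (roots_avoid C {..<0} \<and> has_crossing_number {..<0} C 0 \<longrightarrow>
        (\<exists>w. analytic_at_with_value F C w \<and> given_by_channel T \<O> t_channel C w)) \<and>
      (roots_avoid C {0<..<1} \<and> has_crossing_number {0<..<1} C 0 \<longrightarrow>
        (\<exists>w. analytic_at_with_value F C w \<and> given_by_channel T \<O> u_channel C w)))"
proof -
  interpret unitary_cft T by fact
  interpret t: crossing T "- complex_of_real ` ({..0} \<union> {1..})" Ln Ln "\<lambda>z. Ln (1 - z)" "\<lambda>z. Ln (1 - z)" "\<lambda>z. 1 - z" "1 / 2"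
    t_channel \<O> "- ((sdim T (\<O> 1) + sdim T (\<O> 2)) / 2)" "(sdim T (\<O> 2) + sdim T (\<O> 3)) / 2"
    by (rule t_crossing[OF assms])
  interpret u: crossing T "- complex_of_real ` {0..}" "\<lambda>z. Ln (- z) + \<i> * of_real pi" "\<lambda>z. Ln (- z) - \<i> * of_real pi"
    "\<lambda>z. - Ln (- z) - \<i> * of_real pi" "\<lambda>z. - Ln (- z) + \<i> * of_real pi" "\<lambda>z. 1 / z" "- 1"
    u_channel \<O> "- ((sdim T (\<O> 1) + sdim T (\<O> 4)) / 2)" 0
    by (rule u_crossing[OF assms])
  define F where "F C = channel_value T \<O> (ln_x2 C) C" for C
  \<comment> \<open>Supplies the endpoints 0 and 1 that the open intervals in the hypotheses leave
    out: u and v do not vanish on \<open>DL\<close>.\<close>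
  have DL_roots: "z \<noteq> 0" "z \<noteq> 1" if "C \<in> DL" "cross_roots C z zb" for C :: "'n config" and z zb
    using that by (auto simp: DL_def cross_roots_def cross_u_def cross_v_def)
  have "F C = corr T (\<O> 1) (\<O> 2) (\<O> 3) (\<O> 4) C" if C: "C \<in> DE" for C
  proof -
    obtain z zb where r: "cross_roots C z zb" by (rule cross_roots_exist)
    have DD: "C \<in> DD" using C by (simp add: DE_def)
    have "z \<noteq> 0" using r DD_x2_nonzero[OF DD] by (auto simp: cross_roots_def cross_u_def)
    then have e: "exp (Ln (rho z)) = rho z" by (simp add: rho_nonzero)
    have s: "Ln (rho z) + (log_rho_rhob (ln_x2 C) z zb - Ln (rho z)) = log_rho_rhob (ln_x2 C) z zb" by simp
    show ?thesis
      unfolding F_def corr_eq_channel_value[OF DE_euclidean[OF C] r DD_roots[OF DD r] e s]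
      by (rule channel_value_eq(1)[OF _ _ r e s]) (use DD_x2_nonzero[OF DD] DD_roots[OF DD] in auto)
  qed
  moreover have "time_analytic_on F DD"
  proof -
    have "channel_region DD (\<lambda>i j (C :: 'n config). ln_x2 C i j)"
    proof
      show "exp (ln_x2 C i j) = x2 C i j" if "C \<in> DD" "i \<noteq> j" for C :: "'n config" and i j
        using DD_x2_nonzero[OF that] by simp
      show "time_analytic_on (\<lambda>C :: 'n config. ln_x2 C i j) DD" if "i \<noteq> j" for i j
        by (intro time_analytic_on_Ln x2_time_analytic DD_x2_slit that)
    qed (use open_DD DD_roots in blast)+
    from channel_value_analytic[OF this] show ?thesis by (simp add: F_def[abs_def])
  qed
  moreover have "\<exists>w. analytic_at_with_value F C w \<and> given_by_channel T \<O> s_channel C w"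
    if C: "C \<in> DL" and avoid: "roots_avoid C {1<..}" for C
  \<comment> \<open>F is the s-channel value on all of \<open>DD\<close>, so any radius will do,
    here 1.\<close>
  proof (rule extension_at[OF C _ _ zero_less_one])
    have id: "permute_points s_channel C = C" for C :: "'n config"
      by (simp add: permute_points_def s_channel_def)
    show "z \<notin> complex_of_real ` {1..}" if "cross_roots (permute_points s_channel C) z zb" for z zb
      using that avoid DL_roots(2)[OF C] unfolding id roots_avoid_def by (force simp: image_iff)
    show "F C' = channel_value T (\<O> \<circ> s_channel) (\<lambda>m n. Ln (x2 C' (s_channel m) (s_channel n))) (permute_points s_channel C')" for C'
      by (simp add: F_def id) (simp add: s_channel_def)
  qed (simp add: s_channel_def)
  moreover have "\<exists>w. analytic_at_with_value F C w \<and> given_by_channel T \<O> t_channel C w"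
    if C: "C \<in> DL" and avoid: "roots_avoid C {..<0}" and N: "has_crossing_number {..<0} C 0" for C
    unfolding F_def[abs_def]
  proof (rule t.channel_extension[OF C N avoid, of 1 "- complex_of_real ` {..0}"])
    have W: "z \<notin> complex_of_real ` {..0}" if "cross_roots C z w" for z w
      using that avoid DL_roots(1)[OF C that] unfolding roots_avoid_def by (force simp: image_iff)
    then show "z \<in> - complex_of_real ` {..0}" if "cross_roots C z w" for z w using that by blast
    show "z \<notin> complex_of_real ` {1..}" if "cross_roots (permute_points t_channel C) z zb" for z zb
    proof -
      have "cross_roots C (1 - z) (1 - zb)"
        using t_channel_roots[OF that] by (simp add: permute_points_involution[OF t_channel_involution])
      from W[OF this] show ?thesis by (auto simp: complex_slot_left_eq complex_slot_right_eq)
    qed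
    show "open (- complex_of_real ` {..0})" by (intro open_Compl closed_of_real_image) auto
  qed auto
  moreover have "\<exists>w. analytic_at_with_value F C w \<and> given_by_channel T \<O> u_channel C w"
    if C: "C \<in> DL" and avoid: "roots_avoid C {0<..<1}" and N: "has_crossing_number {0<..<1} C 0" for C
    unfolding F_def[abs_def]
  proof (rule u.channel_extension[OF C N avoid, of "- 1" "- complex_of_real ` {0..1}"])
    have W: "z \<notin> complex_of_real ` {0..1}" if r: "cross_roots C z w" for z w
    proof
      assume "z \<in> complex_of_real ` {0..1}"
      then obtain t where t: "z = of_real t" "0 \<le> t" "t \<le> 1" by auto
      then have "0 < t" "t < 1" using DL_roots[OF C r] by (auto simp: order.order_iff_strict)
      then show False using avoid r t(1) unfolding roots_avoid_def by fastforce
    qed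
    then show "z \<in> - complex_of_real ` {0..1}" if "cross_roots C z w" for z w using that by blast
    show "- complex_of_real ` {0..1} - complex_of_real ` {1..} \<subseteq> - complex_of_real ` {0..}" by force
    show "z \<notin> complex_of_real ` {1..}" if r: "cross_roots (permute_points u_channel C) z zb" for z zb
    proof
      assume "z \<in> complex_of_real ` {1..}"
      then obtain t where t: "z = of_real t" "t \<ge> 1" by auto
      have "cross_roots C (1 / z) (1 / zb)"
      proof -
        have "x2 (permute_points u_channel C) m n \<noteq> 0" if "m \<noteq> n" for m n
          using C that u_channel_involution unfolding x2_permute DL_def by (metis (mono_tags, lifting) mem_Collect_eq)
        from u_channel_roots[OF this r] show ?thesis
          by (simp add: permute_points_involution[OF u_channel_involution])
      qed
      from W[OF this] show False using t by (auto simp: image_iff dest: bspec[of _ _ "1 / t"])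
    qed
    show "open (- complex_of_real ` {0..1})" by (intro open_Compl closed_of_real_image) auto
  qed auto
  ultimately show ?thesis by blast
qed

end
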